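(* Let $M$ be a smooth manifold of dimension $n$. If $V_{n-1}$ is an $(n-1)$-vector field on $M$ such that $(V_{n-1})_{x_0}\neq 0$ at a point $x_0\in M$, then $V_{n-1}$ has constant coefficients on an open neighbourhood $U$ of $x_0$ if and only if the following two conditions hold: (1) The Pfaffian system $P=\{w\in T_x^\ast M: i_w(V_{n-1})_x=0,\ x\in M\}$ associated to $V_{n-1}$ has locally constant rank, and for every $x\in M$ there exists an open neighbourhood $U_x$ such that $\Gamma(U_x,P)$ admits a basis of closed $1$-forms (hence $P$ is integrable). (2) Let $\eta$ be the $\wedge^nTM$-valued differential $1$-form defined by $\eta(X)=X\wedge V_{n-1}$ for all $X\in\mathfrak{X}(M)$. There exists a derivation law $\nabla\colon\mathfrak{X}(M)\times\wedge^n\mathfrak{X}(M)\to\wedge^n\mathfrak{X}(M)$, $(X,W_n)\mapsto\nabla_XW_n$, with vanishing curvature (i.e., $R_\nabla=0$) such that $d^\nabla\eta=0$.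
   Context: A $q$-vector field $V_q\in\wedge^q\mathfrak{X}(M)$ is said to have constant coefficients on a neighbourhood of a point $x\in M$ if there exists a system of coordinates $(u^1,\dots,u^n)$ centred at $x$ such that all the functions $V_q(du^{i_1},\dots,du^{i_q})$, $1\le i_1<\dots<i_q\le n$, are constant. $\mathfrak{X}(M)$ is the module of vector fields on $M$, and $i_w$ denotes contraction of a multivector with the covector $w$. $\Gamma(U_x,P)$ is the module of sections of $P$ over $U_x$. A derivation law on $\wedge^n\mathfrak{X}(M)$ is a linear connection (covariant derivative) on the line bundle $\wedge^nTM$; $R_\nabla$ is its curvature, and $d^\nabla$ is the induced exterior covariant derivative on $\wedge^nTM$-valued differential forms, so that $(d^\nabla\eta)(X,Y)=\nabla_X(\eta(Y))-\nabla_Y(\eta(X))-\eta([X,Y])$.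
   Formalization: Conditions (1) and (2) are imposed on some open neighbourhood of x_0 rather than on all of M (V far from x_0 makes the global "only if" false), and n ≥ 2 is assumed (for n = 1 a nonconstant function satisfies both conditions). *)

theory Defs
  imports "HOL-Analysis.Analysis" "HOL-Library.Function_Algebras"
begin

section \<open>Functions into a real vector space form a real vector space\<close>

instantiation "fun" :: (type, real_vector) real_vector
begin

definition scaleR_fun :: "real \<Rightarrow> ('a \<Rightarrow> 'b) \<Rightarrow> 'a \<Rightarrow> 'b"
  where "scaleR_fun c f = (\<lambda>x. c *\<^sub>R f x)"

instance
  by standard (simp_all add: scaleR_fun_def plus_fun_def fun_eq_iff scaleR_add_right scaleR_add_left)

end


section \<open>Smooth maps between normed spaces\<close>

text \<open>These notions are only used on open sets; on finite-dimensional spaces they are the usual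
  classes $C^k$ and $C^\infty$.\<close>

primrec Ck_on :: "nat \<Rightarrow> 'a::real_normed_vector set \<Rightarrow> ('a \<Rightarrow> 'b::real_normed_vector) \<Rightarrow> bool"
  where
    "Ck_on 0 S f \<longleftrightarrow> continuous_on S f"
  | "Ck_on (Suc k) S f \<longleftrightarrow>
       (\<forall>x\<in>S. f differentiable (at x)) \<and> (\<forall>v. Ck_on k S (\<lambda>x. frechet_derivative f (at x) v))"

definition smooth_on :: "'a::real_normed_vector set \<Rightarrow> ('a \<Rightarrow> 'b::real_normed_vector) \<Rightarrow> bool"
  where "smooth_on S f \<longleftrightarrow> (\<forall>k. Ck_on k S f)"


section \<open>Smooth manifolds\<close>

text \<open>A manifold is the whole of a Hausdorff second countable type \<open>'m\<close>, with an atlas \<open>A\<close> of charts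
  \<open>(U, u)\<close>, \<open>u\<close> mapping \<open>U\<close> homeomorphically onto an open subset of \<open>real^'n\<close>. Its dimension
  is \<open>CARD('n)\<close>; the linear order on \<open>'n\<close> is only there to speak of increasing multi-indices.
  The values of \<open>u\<close> outside \<open>U\<close> are irrelevant.\<close>

type_synonym ('m, 'n) chart = "'m set \<times> ('m \<Rightarrow> real^'n)"

definition is_chart :: "('m::topological_space, 'n::finite) chart \<Rightarrow> bool"
  where "is_chart c \<longleftrightarrow> (case c of (U, u) \<Rightarrow>
           open U \<and> open (u ` U) \<and> (\<exists>g. homeomorphism U (u ` U) u g))"

definition compatible :: "('m, 'n::finite) chart \<Rightarrow> ('m, 'n) chart \<Rightarrow> bool"
  where "compatible c d \<longleftrightarrow> (case (c, d) of ((U, u), (W, w)) \<Rightarrow>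
           smooth_on (u ` (U \<inter> W)) (w \<circ> inv_into U u) \<and>
           smooth_on (w ` (U \<inter> W)) (u \<circ> inv_into W w))"

definition smooth_manifold ::
    "('m::{t2_space, second_countable_topology}, 'n::finite) chart set \<Rightarrow> bool"
  where "smooth_manifold A \<longleftrightarrow>
           (\<forall>c\<in>A. is_chart c) \<and> (\<Union>(U, u)\<in>A. U) = UNIV \<and> (\<forall>c\<in>A. \<forall>d\<in>A. compatible c d)"

definition coordinate_system ::
    "('m::topological_space, 'n::finite) chart set \<Rightarrow> ('m, 'n) chart \<Rightarrow> bool"
  where "coordinate_system A c \<longleftrightarrow> is_chart c \<and> (\<forall>d\<in>A. compatible c d)"

definition smooth_fun ::
    "('m::topological_space, 'n::finite) chart set \<Rightarrow> 'm set \<Rightarrow> ('m \<Rightarrow> real) \<Rightarrow> bool"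
  where "smooth_fun A W f \<longleftrightarrow> (\<forall>(U, u)\<in>A. smooth_on (u ` (U \<inter> W)) (f \<circ> inv_into U u))"

definition smooth_at ::
    "('m::topological_space, 'n::finite) chart set \<Rightarrow> 'm \<Rightarrow> ('m \<Rightarrow> real) \<Rightarrow> bool"
  where "smooth_at A x f \<longleftrightarrow> (\<exists>W. open W \<and> x \<in> W \<and> smooth_fun A W f)"

text \<open>Throughout, functions, vector fields, forms and multivector fields over an open set \<open>U\<close> are
  extended by zero outside \<open>U\<close>, so that they are determined by their restriction to \<open>U\<close>.\<close>

definition smooth_functions ::
    "('m::topological_space, 'n::finite) chart set \<Rightarrow> 'm set \<Rightarrow> ('m \<Rightarrow> real) set"
  where "smooth_functions A U = {f. smooth_fun A U f \<and> (\<forall>x. x \<notin> U \<longrightarrow> f x = 0)}"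


section \<open>Tangent vectors, covectors and multivectors at a point\<close>

type_synonym 'm tvec = "('m \<Rightarrow> real) \<Rightarrow> real"
type_synonym 'm covec = "'m tvec \<Rightarrow> real"
type_synonym 'm mvec = "'m covec list \<Rightarrow> real"

text \<open>Tangent vectors at \<open>x\<close> are the derivations at \<open>x\<close> of the germs of smooth functions at \<open>x\<close>. A germ
  is given by any function representing it; the value on functions that are not smooth
  around \<open>x\<close> is fixed to be zero.\<close>

definition tangent_space ::
    "('m::topological_space, 'n::finite) chart set \<Rightarrow> 'm \<Rightarrow> 'm tvec set"
  where "tangent_space A x = {v.
    (\<forall>f g a b. smooth_at A x f \<longrightarrow> smooth_at A x g \<longrightarrow>
       v (\<lambda>y. a * f y + b * g y) = a * v f + b * v g) \<and>
    (\<forall>f g. smooth_at A x f \<longrightarrow> smooth_at A x g \<longrightarrow>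
       v (\<lambda>y. f y * g y) = f x * v g + g x * v f) \<and>
    (\<forall>f g. smooth_at A x f \<longrightarrow> smooth_at A x g \<longrightarrow>
       (\<exists>W. open W \<and> x \<in> W \<and> (\<forall>y\<in>W. f y = g y)) \<longrightarrow> v f = v g) \<and>
    (\<forall>f. \<not> smooth_at A x f \<longrightarrow> v f = 0)}"

definition cotangent_space ::
    "('m::topological_space, 'n::finite) chart set \<Rightarrow> 'm \<Rightarrow> 'm covec set"
  where "cotangent_space A x = {w.
    (\<forall>v\<in>tangent_space A x. \<forall>v'\<in>tangent_space A x. \<forall>a b.
       w (a *\<^sub>R v + b *\<^sub>R v') = a * w v + b * w v') \<and>
    (\<forall>v. v \<notin> tangent_space A x \<longrightarrow> w v = 0)}"

text \<open>The \<open>q\<close>-th exterior power of the tangent space at \<open>x\<close>, as the space of alternating \<open>q\<close>-linear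
  forms on the cotangent space; the arguments are given as a list of length \<open>q\<close>.\<close>

definition multivectors ::
    "('m::topological_space, 'n::finite) chart set \<Rightarrow> nat \<Rightarrow> 'm \<Rightarrow> 'm mvec set"
  where "multivectors A q x = {B.
    (\<forall>ws w w' a b i. length ws = q \<longrightarrow> set ws \<subseteq> cotangent_space A x \<longrightarrow>
       w \<in> cotangent_space A x \<longrightarrow> w' \<in> cotangent_space A x \<longrightarrow> i < q \<longrightarrow>
       B (ws[i := a *\<^sub>R w + b *\<^sub>R w']) = a * B (ws[i := w]) + b * B (ws[i := w'])) \<and>
    (\<forall>ws i j. length ws = q \<longrightarrow> set ws \<subseteq> cotangent_space A x \<longrightarrow>
       i < j \<longrightarrow> j < q \<longrightarrow> ws ! i = ws ! j \<longrightarrow> B ws = 0) \<and>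
    (\<forall>ws. \<not> (length ws = q \<and> set ws \<subseteq> cotangent_space A x) \<longrightarrow> B ws = 0)}"

definition differential ::
    "('m::topological_space, 'n::finite) chart set \<Rightarrow> ('m \<Rightarrow> real) \<Rightarrow> 'm \<Rightarrow> 'm covec"
  where "differential A f x = (\<lambda>v. if v \<in> tangent_space A x then v f else 0)"

definition contract :: "'m covec \<Rightarrow> 'm mvec \<Rightarrow> 'm mvec"
  where "contract w B = (\<lambda>ws. B (w # ws))"

text \<open>The exterior product of a vector \<open>v\<close> and a \<open>q\<close>-vector \<open>B\<close>, in the normalization
  $(v \wedge B)(w_0, \dots, w_q) = \sum_k (-1)^k w_k(v)\, B(w_0, \dots, \widehat{w_k}, \dots, w_q)$.\<close>

definition wedge ::
    "('m::topological_space, 'n::finite) chart set \<Rightarrow> nat \<Rightarrow> 'm \<Rightarrow> 'm tvec \<Rightarrow> 'm mvec \<Rightarrow> 'm mvec"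
  where "wedge A q x v B = (\<lambda>ws.
    if length ws = Suc q \<and> set ws \<subseteq> cotangent_space A x
    then (\<Sum>k<Suc q. (- 1) ^ k * (ws ! k) v * B (take k ws @ drop (Suc k) ws))
    else 0)"


section \<open>Vector fields, 1-forms and multivector fields\<close>

definition vector_fields ::
    "('m::topological_space, 'n::finite) chart set \<Rightarrow> 'm set \<Rightarrow> ('m \<Rightarrow> 'm tvec) set"
  where "vector_fields A U = {X.
    (\<forall>x\<in>U. X x \<in> tangent_space A x) \<and> (\<forall>x. x \<notin> U \<longrightarrow> X x = 0) \<and>
    (\<forall>W f. open W \<longrightarrow> W \<subseteq> U \<longrightarrow> smooth_fun A W f \<longrightarrow> smooth_fun A W (\<lambda>x. X x f))}"

definition one_forms ::
    "('m::topological_space, 'n::finite) chart set \<Rightarrow> 'm set \<Rightarrow> ('m \<Rightarrow> 'm covec) set"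
  where "one_forms A U = {w.
    (\<forall>x\<in>U. w x \<in> cotangent_space A x) \<and> (\<forall>x. x \<notin> U \<longrightarrow> w x = 0) \<and>
    (\<forall>W X. open W \<longrightarrow> W \<subseteq> U \<longrightarrow> X \<in> vector_fields A W \<longrightarrow> smooth_fun A W (\<lambda>x. w x (X x)))}"

definition multivector_fields ::
    "('m::topological_space, 'n::finite) chart set \<Rightarrow> nat \<Rightarrow> 'm set \<Rightarrow> ('m \<Rightarrow> 'm mvec) set"
  where "multivector_fields A q U = {B.
    (\<forall>x\<in>U. B x \<in> multivectors A q x) \<and> (\<forall>x. x \<notin> U \<longrightarrow> B x = 0) \<and>
    (\<forall>W ws. open W \<longrightarrow> W \<subseteq> U \<longrightarrow> length ws = q \<longrightarrow> set ws \<subseteq> one_forms A W \<longrightarrow>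
       smooth_fun A W (\<lambda>x. B x (map (\<lambda>w. w x) ws)))}"

definition fun_mult :: "('m \<Rightarrow> real) \<Rightarrow> ('m \<Rightarrow> 'v::real_vector) \<Rightarrow> 'm \<Rightarrow> 'v"
  where "fun_mult f s = (\<lambda>x. f x *\<^sub>R s x)"

definition lie_deriv :: "('m \<Rightarrow> 'm tvec) \<Rightarrow> ('m \<Rightarrow> real) \<Rightarrow> 'm \<Rightarrow> real"
  where "lie_deriv X f = (\<lambda>x. X x f)"

text \<open>The case distinction keeps the convention that tangent vectors vanish on functions which are
  not smooth around the base point.\<close>

definition lie_bracket ::
    "('m::topological_space, 'n::finite) chart set \<Rightarrow>
       ('m \<Rightarrow> 'm tvec) \<Rightarrow> ('m \<Rightarrow> 'm tvec) \<Rightarrow> 'm \<Rightarrow> 'm tvec"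
  where "lie_bracket A X Y = (\<lambda>x f.
    if smooth_at A x f then X x (lie_deriv Y f) - Y x (lie_deriv X f) else 0)"

definition closed_form ::
    "('m::topological_space, 'n::finite) chart set \<Rightarrow> 'm set \<Rightarrow> ('m \<Rightarrow> 'm covec) \<Rightarrow> bool"
  where "closed_form A U w \<longleftrightarrow>
    (\<forall>X\<in>vector_fields A U. \<forall>Y\<in>vector_fields A U. \<forall>x\<in>U.
       X x (\<lambda>y. w y (Y y)) - Y x (\<lambda>y. w y (X y)) - w x (lie_bracket A X Y x) = 0)"


section \<open>Constant coefficients\<close>

definition constant_coefficients_near ::
    "('m::topological_space, 'n::{finite, linorder}) chart set \<Rightarrow> nat \<Rightarrow> ('m \<Rightarrow> 'm mvec) \<Rightarrow> 'm \<Rightarrow> bool"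
  where "constant_coefficients_near A q V x0 \<longleftrightarrow>
    (\<exists>U u. coordinate_system A (U, u) \<and> x0 \<in> U \<and> u x0 = 0 \<and>
      (\<forall>is :: 'n list. length is = q \<longrightarrow> sorted_wrt (<) is \<longrightarrow>
         (\<exists>c. \<forall>x\<in>U. V x (map (\<lambda>i. differential A (\<lambda>y. u y $ i) x) is) = c)))"


section \<open>The associated Pfaffian system\<close>

definition pfaffian_system ::
    "('m::topological_space, 'n::finite) chart set \<Rightarrow> ('m \<Rightarrow> 'm mvec) \<Rightarrow> 'm \<Rightarrow> 'm covec set"
  where "pfaffian_system A V x = {w \<in> cotangent_space A x. contract w (V x) = 0}"

definition locally_constant_rank ::
    "'m::topological_space set \<Rightarrow> ('m \<Rightarrow> 'm covec set) \<Rightarrow> bool"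
  where "locally_constant_rank U P \<longleftrightarrow>
    (\<forall>x\<in>U. \<exists>W r. open W \<and> x \<in> W \<and> W \<subseteq> U \<and> (\<forall>y\<in>W. dim (P y) = r))"

definition pfaff_sections ::
    "('m::topological_space, 'n::finite) chart set \<Rightarrow> 'm set \<Rightarrow> ('m \<Rightarrow> 'm covec set) \<Rightarrow>
       ('m \<Rightarrow> 'm covec) set"
  where "pfaff_sections A U P = {w \<in> one_forms A U. \<forall>x\<in>U. w x \<in> P x}"

definition is_closed_basis ::
    "('m::topological_space, 'n::finite) chart set \<Rightarrow> 'm set \<Rightarrow> ('m \<Rightarrow> 'm covec set) \<Rightarrow>
       ('m \<Rightarrow> 'm covec) list \<Rightarrow> bool"
  where "is_closed_basis A U P ws \<longleftrightarrow>
    set ws \<subseteq> pfaff_sections A U P \<and> (\<forall>w\<in>set ws. closed_form A U w) \<and>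
    (\<forall>w\<in>pfaff_sections A U P. \<exists>!fs. length fs = length ws \<and> set fs \<subseteq> smooth_functions A U \<and>
       w = (\<Sum>i<length ws. fun_mult (fs ! i) (ws ! i)))"

definition locally_closed_basis ::
    "('m::topological_space, 'n::finite) chart set \<Rightarrow> 'm set \<Rightarrow> ('m \<Rightarrow> 'm covec set) \<Rightarrow> bool"
  where "locally_closed_basis A U P \<longleftrightarrow>
    (\<forall>x\<in>U. \<exists>W ws. open W \<and> x \<in> W \<and> W \<subseteq> U \<and> is_closed_basis A W P ws)"


section \<open>Derivation laws on the top exterior power\<close>

definition derivation_law ::
    "('m::topological_space, 'n::finite) chart set \<Rightarrow> 'm set \<Rightarrow>
       (('m \<Rightarrow> 'm tvec) \<Rightarrow> ('m \<Rightarrow> 'm mvec) \<Rightarrow> ('m \<Rightarrow> 'm mvec)) \<Rightarrow> bool"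
  where "derivation_law A U nabla \<longleftrightarrow>
    (let XX = vector_fields A U; EE = multivector_fields A CARD('n) U; CC = smooth_functions A U in
      (\<forall>X\<in>XX. \<forall>E\<in>EE. nabla X E \<in> EE) \<and>
      (\<forall>X\<in>XX. \<forall>Y\<in>XX. \<forall>E\<in>EE. nabla (X + Y) E = nabla X E + nabla Y E) \<and>
      (\<forall>f\<in>CC. \<forall>X\<in>XX. \<forall>E\<in>EE. nabla (fun_mult f X) E = fun_mult f (nabla X E)) \<and>
      (\<forall>X\<in>XX. \<forall>E\<in>EE. \<forall>F\<in>EE. nabla X (E + F) = nabla X E + nabla X F) \<and>
      (\<forall>f\<in>CC. \<forall>X\<in>XX. \<forall>E\<in>EE.
         nabla X (fun_mult f E) = fun_mult (lie_deriv X f) E + fun_mult f (nabla X E)))"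

definition flat_law ::
    "('m::topological_space, 'n::finite) chart set \<Rightarrow> 'm set \<Rightarrow>
       (('m \<Rightarrow> 'm tvec) \<Rightarrow> ('m \<Rightarrow> 'm mvec) \<Rightarrow> ('m \<Rightarrow> 'm mvec)) \<Rightarrow> bool"
  where "flat_law A U nabla \<longleftrightarrow>
    (\<forall>X\<in>vector_fields A U. \<forall>Y\<in>vector_fields A U. \<forall>E\<in>multivector_fields A CARD('n) U.
       nabla X (nabla Y E) - nabla Y (nabla X E) - nabla (lie_bracket A X Y) E = 0)"

definition eta_form ::
    "('m::topological_space, 'n::finite) chart set \<Rightarrow> ('m \<Rightarrow> 'm mvec) \<Rightarrow>
       ('m \<Rightarrow> 'm tvec) \<Rightarrow> 'm \<Rightarrow> 'm mvec"
  where "eta_form A V X = (\<lambda>x. wedge A (CARD('n) - 1) x (X x) (V x))"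

definition ext_cov_deriv ::
    "('m::topological_space, 'n::finite) chart set \<Rightarrow>
       (('m \<Rightarrow> 'm tvec) \<Rightarrow> ('m \<Rightarrow> 'm mvec) \<Rightarrow> ('m \<Rightarrow> 'm mvec)) \<Rightarrow>
       (('m \<Rightarrow> 'm tvec) \<Rightarrow> 'm \<Rightarrow> 'm mvec) \<Rightarrow>
       ('m \<Rightarrow> 'm tvec) \<Rightarrow> ('m \<Rightarrow> 'm tvec) \<Rightarrow> 'm \<Rightarrow> 'm mvec"
  where "ext_cov_deriv A nabla eta X Y =
    nabla X (eta Y) - nabla Y (eta X) - eta (lie_bracket A X Y)"

end

theory Submission
  imports Defs
begin

text \<open>Every top multivector is a multiple of the volume element \<open>vol\<close> of a chart, and \<open>v \<and> V = \<beta>(v) vol\<close> for a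
  covector \<open>\<beta>\<close>, which spans the Pfaffian system where \<open>V\<close> does not vanish. If \<open>V\<close> has constant coefficients, then
  \<open>\<beta>\<close> is closed and the connection for which \<open>vol\<close> is parallel is flat with \<open>d\<^sup>\<nabla>\<eta> = 0\<close>.
  Conversely, let \<open>\<nabla>vol = \<theta> vol\<close>. Flatness means \<open>d\<theta> = 0\<close>, so \<open>\<theta> = dF\<close> locally, and \<open>d\<^sup>\<nabla>\<eta> = 0\<close> becomes
  \<open>d(e\<^sup>F \<beta>) = 0\<close>, so \<open>e\<^sup>F \<beta> = dy\<close>. A chart containing \<open>y\<close> as a coordinate and having volume element
  \<open>e\<^sup>-\<^sup>F vol\<close> exists because \<open>n \<ge> 2\<close>, and in it \<open>V\<close> has constant coefficients.\<close>

section \<open>Calculus of smooth maps\<close>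

text \<open>Multiplying \<beta> by e^F and \<open>vol\<close> by e^-F leaves v \<and> V = \<beta>(v)
  vol intact, so one function F both makes \<beta> exact and makes the volume element parallel. The
  components of \<beta> are, up to sign, the coefficients of V; a chart with volume element e^-F vol
  in which dy is a coordinate differential therefore has a single nonzero coefficient, 1 or -1. The
  choice of y as a coordinate does not control the Jacobian: a second coordinate has to absorb the
  remaining factor, and this is where n \<ge> 2 enters. The main obstacle is that a derivation law
  over an open set G acts only on fields over all of G, while G need not lie in a chart. Coordinate
  fields and \<open>vol\<close> have to be cut off by bump functions, and the locality of the law
  has to be derived from its linearity over functions. Tangent vectors are derivations of germs, so
  that coordinate expressions depend on Hadamard's lemma. That lemma, the Poincare lemma and
  primitives in one coordinate all rest on integrals along segments that depend smoothly on the end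
  point.\<close>

abbreviation FD :: "('a::real_normed_vector \<Rightarrow> 'b::real_normed_vector) \<Rightarrow> 'a \<Rightarrow> 'a \<Rightarrow> 'b"
  where "FD f x \<equiv> frechet_derivative f (at x)"

lemma Ck_on_cong:
  assumes "open S" "\<And>x. x \<in> S \<Longrightarrow> f x = g x" "Ck_on k S f"
  shows "Ck_on k S g"
  using assms(2,3)
proof (induction k arbitrary: f g)
  case 0
  then show ?case by (simp cong: continuous_on_cong)
next
  case (Suc k)
  have der: "(g has_derivative FD f x) (at x)" if "x \<in> S" for x
    using has_derivative_transform_within_open[OF _ assms(1) that] Suc.prems that
    by (metis Ck_on.simps(2) frechet_derivative_works)
  then have fd: "FD f x = FD g x" if "x \<in> S" for x
    using frechet_derivative_at that by blast
  have "Ck_on k S (\<lambda>x. FD g x v)" for v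
  proof (rule Suc.IH)
    show "Ck_on k S (\<lambda>x. FD f x v)"
      using Suc.prems(2) by simp
  qed (simp add: fd)
  then show ?case using der unfolding Ck_on.simps differentiable_def by blast
qed

lemma Ck_on_SucI:
  assumes "open S" "\<And>x. x \<in> S \<Longrightarrow> (f has_derivative f' x) (at x)" "\<And>v. Ck_on k S (\<lambda>x. f' x v)"
  shows "Ck_on (Suc k) S f"
proof -
  have "Ck_on k S (\<lambda>x. FD f x v)" for v
    by (rule Ck_on_cong[OF assms(1) _ assms(3)[of v]]) (metis assms(2) frechet_derivative_at)
  then show ?thesis using assms(2) unfolding Ck_on.simps differentiable_def by blast
qed

lemma Ck_on_has_derivative:
  assumes "Ck_on (Suc k) S f" "x \<in> S"
  shows "(f has_derivative FD f x) (at x)"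
  using assms by (auto simp: frechet_derivative_works)

lemma Ck_on_lower: "Ck_on (Suc k) S f \<Longrightarrow> Ck_on k S f"
proof (induction k arbitrary: f)
  case 0
  then show ?case
    by (auto intro!: continuous_at_imp_continuous_on differentiable_imp_continuous_within)
qed auto

lemma Ck_on_subset: "T \<subseteq> S \<Longrightarrow> Ck_on k S f \<Longrightarrow> Ck_on k T f"
proof (induction k arbitrary: f)
  case 0
  then show ?case by (auto intro: continuous_on_subset)
qed auto

lemma Ck_on_union: "(\<And>x. x \<in> S \<Longrightarrow> \<exists>T. open T \<and> x \<in> T \<and> Ck_on k T f) \<Longrightarrow> Ck_on k S f"
proof (induction k arbitrary: f)
  case 0
  show ?case unfolding Ck_on.simps
  proof (intro continuous_at_imp_continuous_on ballI)
    fix x assume "x \<in> S"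
    then obtain T where "open T" "x \<in> T" "continuous_on T f" using 0[of x] by auto
    then show "isCont f x" by (simp add: continuous_on_eq_continuous_at)
  qed
next
  case (Suc k)
  have "\<exists>T. open T \<and> x \<in> T \<and> Ck_on k T (\<lambda>x. FD f x v)" if "x \<in> S" for x v
    using Suc.prems[OF that] by auto
  then have "Ck_on k S (\<lambda>x. FD f x v)" for v
    by (intro Suc.IH)
  moreover have "f differentiable at x" if "x \<in> S" for x
    using Suc.prems[OF that] by auto
  ultimately show ?case by simp
qed

lemma Ck_on_const [simp]: "Ck_on k S (\<lambda>x. c)"
proof (induction k arbitrary: c)
  case (Suc k)
  have "FD (\<lambda>x. c) x = (\<lambda>v. 0)" for x
    using frechet_derivative_at[OF has_derivative_const, of c x] by simp
  then show ?case by (auto simp: Suc)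
qed simp

lemma Ck_on_linear:
  assumes "open S" "bounded_linear L"
  shows "Ck_on k S L"
proof (cases k)
  case 0
  then show ?thesis using assms by (simp add: linear_continuous_on)
next
  case (Suc k')
  have "Ck_on (Suc k') S L"
    by (rule Ck_on_SucI[where f'="\<lambda>x. L"]) (use assms bounded_linear_imp_has_derivative in auto)
  then show ?thesis using Suc by simp
qed

lemma Ck_on_linear_comp:
  assumes "open S" "bounded_linear L" "Ck_on k S f"
  shows "Ck_on k S (\<lambda>x. L (f x))"
  using assms(3)
proof (induction k arbitrary: f)
  case 0
  then show ?case
    using assms(2) by (auto intro: bounded_linear.continuous_on)
next
  case (Suc k)
  show ?case
  proof (rule Ck_on_SucI[OF assms(1)])
    show "((\<lambda>x. L (f x)) has_derivative (\<lambda>v. L (FD f x v))) (at x)" if "x \<in> S" for x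
      using bounded_linear.has_derivative[OF assms(2) Ck_on_has_derivative[OF Suc.prems that]] .
    show "Ck_on k S (\<lambda>x. L (FD f x v))" for v
      using Suc.prems by (intro Suc.IH) auto
  qed
qed

lemma Ck_on_add:
  assumes "open S" "Ck_on k S f" "Ck_on k S g"
  shows "Ck_on k S (\<lambda>x. f x + g x)"
  using assms(2,3)
proof (induction k arbitrary: f g)
  case 0
  then show ?case by (auto intro: continuous_intros)
next
  case (Suc k)
  show ?case
  proof (rule Ck_on_SucI[OF assms(1)])
    show "((\<lambda>x. f x + g x) has_derivative
        (\<lambda>v. FD f x v + FD g x v)) (at x)" if "x \<in> S" for x
      using has_derivative_add[OF Ck_on_has_derivative[OF Suc.prems(1) that]
          Ck_on_has_derivative[OF Suc.prems(2) that]] .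
    show "Ck_on k S (\<lambda>x. FD f x v + FD g x v)" for v
      using Suc.prems by (intro Suc.IH) auto
  qed
qed

lemma Ck_on_sum:
  assumes "open S" "\<And>i. i \<in> I \<Longrightarrow> Ck_on k S (f i)"
  shows "Ck_on k S (\<lambda>x. \<Sum>i\<in>I. f i x)"
  using assms(2) by (induction I rule: infinite_finite_induct) (auto intro: Ck_on_add assms(1))

lemma Ck_on_scaleR:
  assumes "open S" "Ck_on k S f" "Ck_on k S g"
  shows "Ck_on k S (\<lambda>x. f x *\<^sub>R g x)"
  using assms(2,3)
proof (induction k arbitrary: f g)
  case 0
  then show ?case by (auto intro: continuous_intros)
next
  case (Suc k)
  show ?case
  proof (rule Ck_on_SucI[OF assms(1), where
        f'="\<lambda>x v. f x *\<^sub>R FD g x v + FD f x v *\<^sub>R g x"])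
    show "((\<lambda>x. f x *\<^sub>R g x) has_derivative
        (\<lambda>v. f x *\<^sub>R FD g x v + FD f x v *\<^sub>R g x)) (at x)"
      if "x \<in> S" for x
      using has_derivative_scaleR[OF Ck_on_has_derivative[OF Suc.prems(1) that]
          Ck_on_has_derivative[OF Suc.prems(2) that]] .
    show "Ck_on k S (\<lambda>x. f x *\<^sub>R FD g x v + FD f x v *\<^sub>R g x)" for v
      using Suc.prems Ck_on_lower[OF Suc.prems(1)] Ck_on_lower[OF Suc.prems(2)]
      by (intro Ck_on_add Suc.IH assms(1)) simp_all
  qed
qed

lemma Ck_on_mult:
  fixes f g :: "'a::real_normed_vector \<Rightarrow> real"
  assumes "open S" "Ck_on k S f" "Ck_on k S g"
  shows "Ck_on k S (\<lambda>x. f x * g x)"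
  using Ck_on_scaleR[OF assms] by simp

lemma Ck_on_prod:
  fixes f :: "'i \<Rightarrow> 'a::real_normed_vector \<Rightarrow> real"
  assumes "open S" "\<And>i. i \<in> I \<Longrightarrow> Ck_on k S (f i)"
  shows "Ck_on k S (\<lambda>x. \<Prod>i\<in>I. f i x)"
  using assms(2) by (induction I rule: infinite_finite_induct) (auto intro: Ck_on_mult assms(1))

text \<open>\<open>Ck_on\<close> tests derivatives in fixed directions only, whereas the chain rule
  evaluates the derivative of g in the moving direction \<open>FD f x v\<close>. Expanding that
  vector in a basis of the intermediate space turns the derivative into a sum of products, to which
  the induction hypothesis applies.\<close>

lemma Ck_on_compose:
  fixes f :: "'a::real_normed_vector \<Rightarrow> 'b::euclidean_space" and g :: "'b \<Rightarrow> 'c::real_normed_vector"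
  assumes "open S" "open T" "f ` S \<subseteq> T" "Ck_on k S f" "Ck_on k T g"
  shows "Ck_on k S (\<lambda>x. g (f x))"
  using assms(4,5)
proof (induction k arbitrary: g)
  case 0
  then show ?case using assms(3) by (auto intro: continuous_on_compose2)
next
  case (Suc k)
  let ?D = "\<lambda>x v. \<Sum>b\<in>Basis. (FD f x v \<bullet> b) *\<^sub>R FD g (f x) b"
  show ?case
  proof (rule Ck_on_SucI[OF assms(1), where f'="?D"])
    fix x assume x: "x \<in> S"
    have dg: "(g has_derivative FD g (f x)) (at (f x))"
      using Ck_on_has_derivative[OF Suc.prems(2)] x assms(3) by auto
    have "((\<lambda>x. g (f x)) has_derivative (\<lambda>v. FD g (f x) (FD f x v))) (at x)"
      using has_derivative_compose[OF Ck_on_has_derivative[OF Suc.prems(1) x] dg] .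
    moreover have "(\<lambda>v. FD g (f x) (FD f x v)) = ?D x"
    proof
      fix v
      let ?w = "FD f x v"
      interpret linear "FD g (f x)"
        using dg has_derivative_linear by blast
      have "FD g (f x) ?w = FD g (f x) (\<Sum>b\<in>Basis. (?w \<bullet> b) *\<^sub>R b)"
        by (simp add: euclidean_representation)
      also have "\<dots> = ?D x v" by (simp only: sum scaleR)
      finally show "FD g (f x) ?w = ?D x v" .
    qed
    ultimately show "((\<lambda>x. g (f x)) has_derivative ?D x) (at x)" by (rule subst[rotated])
  next
    fix v
    have "Ck_on k S (\<lambda>x. FD g (f x) b)" for b
      using Suc.prems Ck_on_lower[OF Suc.prems(1)] by (intro Suc.IH[of "\<lambda>y. FD g y b"]) simp_all
    moreover have "Ck_on k S (\<lambda>x. FD f x v \<bullet> b)" for b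
      using Suc.prems by (intro Ck_on_linear_comp[OF assms(1) bounded_linear_inner_left]) auto
    ultimately show "Ck_on k S (\<lambda>x. ?D x v)"
      by (intro Ck_on_sum Ck_on_scaleR assms(1))
  qed
qed

text \<open>The derivative is a polynomial in the function itself, so the induction on k
  closes.\<close>

lemma Ck_on_inverse_real: "Ck_on k (- {0}) (inverse :: real \<Rightarrow> real)"
proof (induction k)
  case 0
  then show ?case by (auto intro: continuous_intros)
next
  case (Suc k)
  have "Ck_on k (- {0}) (\<lambda>x::real. - (inverse x * v * inverse x))" for v
    by (intro Ck_on_linear_comp[OF _ bounded_linear_minus[OF bounded_linear_ident]] Ck_on_mult Suc) auto
  then show ?case
    by (intro Ck_on_SucI[where f'="\<lambda>x v. - (inverse x * v * inverse x)"])
      (auto intro: has_derivative_inverse')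
qed

lemma Ck_on_inverse:
  fixes f :: "'a::real_normed_vector \<Rightarrow> real"
  assumes "open S" "Ck_on k S f" "\<And>x. x \<in> S \<Longrightarrow> f x \<noteq> 0"
  shows "Ck_on k S (\<lambda>x. inverse (f x))"
  by (rule Ck_on_compose[OF assms(1) _ _ assms(2) Ck_on_inverse_real]) (use assms(3) in auto)

lemma Ck_on_det:
  fixes M :: "'a::real_normed_vector \<Rightarrow> real^'n^'n"
  assumes "open S" "\<And>i j. Ck_on k S (\<lambda>x. M x $ i $ j)"
  shows "Ck_on k S (\<lambda>x. det (M x))"
  unfolding det_def by (intro Ck_on_sum Ck_on_mult Ck_on_prod assms Ck_on_const)

lemma Ck_on_vec:
  fixes f :: "'a::real_normed_vector \<Rightarrow> real^'n"
  assumes "open S" "\<And>i. Ck_on k S (\<lambda>x. f x $ i)"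
  shows "Ck_on k S f"
proof -
  have "Ck_on k S (\<lambda>x. \<Sum>i\<in>UNIV. (f x $ i) *\<^sub>R (axis i 1 :: real^'n))"
    by (intro Ck_on_sum Ck_on_scaleR assms Ck_on_const)
  moreover have "(\<lambda>x. \<Sum>i\<in>UNIV. (f x $ i) *\<^sub>R (axis i 1 :: real^'n)) = f"
    by (simp add: fun_eq_iff vec_eq_iff axis_def if_distrib[of "(*) _"] cong: if_cong)
  ultimately show ?thesis by simp
qed

section \<open>Maps of class C-infinity\<close>

text \<open>Smooth directional derivatives suffice: class C^k for all of them gives class C^(k+1)
  for f.\<close>

lemma smooth_onI:
  assumes "open S" "\<And>x. x \<in> S \<Longrightarrow> (f has_derivative f' x) (at x)" "\<And>v. smooth_on S (\<lambda>x. f' x v)"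
  shows "smooth_on S f"
  unfolding smooth_on_def
proof
  fix k show "Ck_on k S f"
    using Ck_on_lower[OF Ck_on_SucI[OF assms(1,2), of k]] assms(3) by (simp add: smooth_on_def)
qed

lemma smooth_on_has_derivative:
  "smooth_on S f \<Longrightarrow> x \<in> S \<Longrightarrow> (f has_derivative FD f x) (at x)"
  unfolding smooth_on_def by (metis Ck_on_has_derivative)

lemma smooth_on_frechet: "smooth_on S f \<Longrightarrow> smooth_on S (\<lambda>x. FD f x v)"
  unfolding smooth_on_def by (metis Ck_on.simps(2))

lemma smooth_on_continuous: "smooth_on S f \<Longrightarrow> continuous_on S f"
  unfolding smooth_on_def by (metis Ck_on.simps(1))

lemma smooth_on_cong: "open S \<Longrightarrow> (\<And>x. x \<in> S \<Longrightarrow> f x = g x) \<Longrightarrow> smooth_on S f \<Longrightarrow> smooth_on S g"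
  unfolding smooth_on_def using Ck_on_cong by blast

lemma smooth_on_subset: "T \<subseteq> S \<Longrightarrow> smooth_on S f \<Longrightarrow> smooth_on T f"
  unfolding smooth_on_def using Ck_on_subset by blast

lemma smooth_on_union: "(\<And>x. x \<in> S \<Longrightarrow> \<exists>T. open T \<and> x \<in> T \<and> smooth_on T f) \<Longrightarrow> smooth_on S f"
  unfolding smooth_on_def by (intro allI Ck_on_union) blast

lemma smooth_on_const [simp]: "smooth_on S (\<lambda>x. c)"
  by (simp add: smooth_on_def)

lemma smooth_on_linear_comp:
  "open S \<Longrightarrow> bounded_linear L \<Longrightarrow> smooth_on S f \<Longrightarrow> smooth_on S (\<lambda>x. L (f x))"
  by (simp add: smooth_on_def Ck_on_linear_comp)

lemma smooth_on_id: "open S \<Longrightarrow> smooth_on S (\<lambda>x. x)"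
  by (simp add: smooth_on_def Ck_on_linear bounded_linear_ident)

lemma smooth_on_nth: "open S \<Longrightarrow> smooth_on S f \<Longrightarrow> smooth_on S (\<lambda>x. f x $ i)"
  by (rule smooth_on_linear_comp[OF _ bounded_linear_vec_nth])

lemma smooth_on_add: "open S \<Longrightarrow> smooth_on S f \<Longrightarrow> smooth_on S g \<Longrightarrow> smooth_on S (\<lambda>x. f x + g x)"
  by (simp add: smooth_on_def Ck_on_add)

lemma smooth_on_sum:
  "open S \<Longrightarrow> (\<And>i. i \<in> I \<Longrightarrow> smooth_on S (f i)) \<Longrightarrow> smooth_on S (\<lambda>x. \<Sum>i\<in>I. f i x)"
  by (simp add: smooth_on_def Ck_on_sum)

lemma smooth_on_mult:
  fixes f g :: "'a::real_normed_vector \<Rightarrow> real"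
  shows "open S \<Longrightarrow> smooth_on S f \<Longrightarrow> smooth_on S g \<Longrightarrow> smooth_on S (\<lambda>x. f x * g x)"
  by (simp add: smooth_on_def Ck_on_mult)

lemma smooth_on_minus: "open S \<Longrightarrow> smooth_on S f \<Longrightarrow> smooth_on S (\<lambda>x. - f x)"
  by (rule smooth_on_linear_comp[OF _ bounded_linear_minus[OF bounded_linear_ident]])

lemma smooth_on_diff: "open S \<Longrightarrow> smooth_on S f \<Longrightarrow> smooth_on S g \<Longrightarrow> smooth_on S (\<lambda>x. f x - g x)"
  using smooth_on_add[OF _ _ smooth_on_minus, of S f g] by simp

lemma smooth_on_compose:
  fixes f :: "'a::real_normed_vector \<Rightarrow> 'b::euclidean_space"
  shows "open S \<Longrightarrow> open T \<Longrightarrow> f ` S \<subseteq> T \<Longrightarrow> smooth_on S f \<Longrightarrow> smooth_on T g \<Longrightarrow> smooth_on S (\<lambda>x. g (f x))"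
  unfolding smooth_on_def using Ck_on_compose by blast

lemma smooth_on_inverse:
  fixes f :: "'a::real_normed_vector \<Rightarrow> real"
  shows "open S \<Longrightarrow> smooth_on S f \<Longrightarrow> (\<And>x. x \<in> S \<Longrightarrow> f x \<noteq> 0) \<Longrightarrow> smooth_on S (\<lambda>x. inverse (f x))"
  by (simp add: smooth_on_def Ck_on_inverse)

lemma smooth_on_divide:
  fixes f g :: "'a::real_normed_vector \<Rightarrow> real"
  shows "open S \<Longrightarrow> smooth_on S f \<Longrightarrow> smooth_on S g \<Longrightarrow> (\<And>x. x \<in> S \<Longrightarrow> g x \<noteq> 0) \<Longrightarrow> smooth_on S (\<lambda>x. f x / g x)"
  unfolding divide_inverse by (intro smooth_on_mult smooth_on_inverse)

lemma smooth_on_det: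
  fixes M :: "'a::real_normed_vector \<Rightarrow> real^'n^'n"
  shows "open S \<Longrightarrow> (\<And>i j. smooth_on S (\<lambda>x. M x $ i $ j)) \<Longrightarrow> smooth_on S (\<lambda>x. det (M x))"
  by (simp add: smooth_on_def Ck_on_det)

lemma smooth_on_vec:
  fixes f :: "'a::real_normed_vector \<Rightarrow> real^'n"
  shows "open S \<Longrightarrow> (\<And>i. smooth_on S (\<lambda>x. f x $ i)) \<Longrightarrow> smooth_on S f"
  by (simp add: smooth_on_def Ck_on_vec)

lemma smooth_on_exp:
  fixes f :: "'a::real_normed_vector \<Rightarrow> real"
  assumes "open S" "smooth_on S f"
  shows "smooth_on S (\<lambda>x. exp (f x))"
proof -
  have "Ck_on k UNIV (exp :: real \<Rightarrow> real)" for k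
  proof (induction k)
    case 0
    then show ?case by (auto intro: continuous_intros)
  next
    case (Suc k)
    then show ?case
      by (intro Ck_on_SucI[where f'="\<lambda>x v. exp x * v"] Ck_on_mult)
        (auto intro!: derivative_eq_intros)
  qed
  then have "smooth_on UNIV (exp :: real \<Rightarrow> real)" by (simp add: smooth_on_def)
  then show ?thesis using smooth_on_compose[OF assms(1) open_UNIV _ assms(2)] by blast
qed

subsection \<open>Integrals along segments\<close>

text \<open>For \<open>Q = id\<close> the curve runs from \<open>p\<close> to \<open>x\<close>; for the projection \<open>Q\<close> onto a coordinate axis
  only that coordinate moves.\<close>

definition seg :: "('a::real_vector \<Rightarrow> 'a) \<Rightarrow> 'a \<Rightarrow> real \<Rightarrow> 'a \<Rightarrow> 'a"
  where "seg Q p t x = x + (1 - t) *\<^sub>R Q (p - x)"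

lemma seg_integrand_continuous:
  fixes h :: "'a::euclidean_space \<Rightarrow> 'b::real_normed_vector"
  assumes "bounded_linear Q" "continuous_on S h" "T \<subseteq> {(x, t). seg Q p t x \<in> S}"
  shows "continuous_on T (\<lambda>(x, t). h (seg Q p t x))"
proof -
  have "continuous_on T (\<lambda>z. seg Q p (snd z) (fst z))"
    unfolding seg_def
    by (intro continuous_intros bounded_linear.continuous_on[OF assms(1)])
  then have "continuous_on T (\<lambda>z. h (seg Q p (snd z) (fst z)))"
    by (rule continuous_on_compose2[OF assms(2)]) (use assms(3) in auto)
  then show ?thesis by (simp add: case_prod_beta)
qed

lemma seg_integrable:
  fixes h :: "'a::euclidean_space \<Rightarrow> real"
  assumes "bounded_linear Q" "continuous_on S h" "\<And>t. t \<in> {0..1} \<Longrightarrow> seg Q p t x \<in> S"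
    and "continuous_on {0..1} w"
  shows "(\<lambda>t. w t * h (seg Q p t x)) integrable_on {0..1}"
proof -
  have "continuous_on ({x} \<times> {0..1}) (\<lambda>(x, t). h (seg Q p t x))"
    by (rule seg_integrand_continuous[OF assms(1,2)]) (use assms(3) in auto)
  then have "continuous_on {0..1} (\<lambda>t. (\<lambda>(x, t). h (seg Q p t x)) (x, t))"
    by (rule continuous_on_compose2) (auto intro: continuous_intros)
  then show ?thesis
    by (intro integrable_continuous_real continuous_on_mult assms(4)) simp
qed

text \<open>Differentiation under the integral sign. The derivative of \<open>seg Q p t\<close> in
  direction v is v - (1 - t) Q v; splitting it yields two integrals of the original shape, with
  weights \<open>w t\<close> and \<open>w t * (1 - t)\<close>. The weight \<open>w\<close> is
  carried along so that this family is stable under differentiation.\<close>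

lemma seg_integral_has_derivative:
  fixes h :: "'a::euclidean_space \<Rightarrow> real"
  assumes S: "open S" and Q: "bounded_linear Q"
    and seg: "\<And>x t. x \<in> S \<Longrightarrow> t \<in> {0..1} \<Longrightarrow> seg Q p t x \<in> S"
    and h: "Ck_on (Suc 0) S h" and w: "continuous_on {0..1} w" and x0: "x0 \<in> S"
  shows "((\<lambda>x. integral {0..1} (\<lambda>t. w t * h (seg Q p t x))) has_derivative
    (\<lambda>v. integral {0..1} (\<lambda>t. w t * FD h (seg Q p t x0) v)
       - integral {0..1} (\<lambda>t. (w t * (1 - t)) * FD h (seg Q p t x0) (Q v)))) (at x0)"
proof -
  obtain r where r: "r > 0" "ball x0 r \<subseteq> S" using S x0 open_contains_ball by blast
  let ?U = "ball x0 r"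
  define D where "D x t = (\<lambda>v. w t * FD h (seg Q p t x) (v - (1 - t) *\<^sub>R Q v))" for x t
  define B where "B x t = Blinfun (D x t)" for x t
  have hder: "(h has_derivative FD h y) (at y)" if "y \<in> S" for y
    using Ck_on_has_derivative[OF h that] .
  have lin: "linear (FD h y)" if "y \<in> S" for y
    using hder[OF that] has_derivative_linear by blast
  have segder: "((\<lambda>x. seg Q p t x) has_derivative (\<lambda>v. v - (1 - t) *\<^sub>R Q v)) (at x)" for t x
    unfolding seg_def
    by (rule derivative_eq_intros bounded_linear.has_derivative[OF Q] | simp)+
       (simp add: bounded_linear.linear[OF Q] linear_neg)
  have Dder: "((\<lambda>x. w t * h (seg Q p t x)) has_derivative D x t) (at x)" if "x \<in> S" "t \<in> {0..1}" for x t
    unfolding D_def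
    by (rule has_derivative_mult_right)
      (rule has_derivative_compose[OF segder hder[OF seg[OF that]]])
  have BD: "blinfun_apply (B x t) = D x t" if "x \<in> S" "t \<in> {0..1}" for x t
    unfolding B_def using Dder[OF that] bounded_linear_Blinfun_apply has_derivative_bounded_linear by blast
  have contd: "continuous_on (S \<times> {0..1}) (\<lambda>(x, t). FD h (seg Q p t x) v)" for v
    by (rule seg_integrand_continuous[OF Q, where h="\<lambda>y. FD h y v" and S=S])
       (use h seg in auto)
  have Dexp: "D x t v = w t * (FD h (seg Q p t x) v - (1 - t) * FD h (seg Q p t x) (Q v))"
    if "x \<in> S" "t \<in> {0..1}" for x t v
    using lin[OF seg[OF that]] by (simp add: D_def linear_diff linear_scale)
  \<comment> \<open>Continuity in operator norm reduces to continuity on basis vectors, which is all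
    that \<open>Ck_on\<close> provides.\<close>
  have contB: "continuous_on (?U \<times> {0..1}) (\<lambda>(x, t). B x t)"
  proof (rule continuous_on_blinfun_componentwise)
    fix i :: 'a assume "i \<in> Basis"
    have "continuous_on (S \<times> {0..1}) (\<lambda>z. w (snd z))"
      by (rule continuous_on_compose2[OF w]) (auto intro: continuous_intros)
    then have "continuous_on (S \<times> {0..1}) (\<lambda>z. w (snd z) * (FD h (seg Q p (snd z) (fst z)) i
          - (1 - snd z) * FD h (seg Q p (snd z) (fst z)) (Q i)))"
      using contd[of i] contd[of "Q i"] by (intro continuous_intros) (simp_all add: case_prod_beta)
    then have "continuous_on (?U \<times> {0..1}) (\<lambda>z. w (snd z) * (FD h (seg Q p (snd z) (fst z)) i
          - (1 - snd z) * FD h (seg Q p (snd z) (fst z)) (Q i)))"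
      by (rule continuous_on_subset) (use r in auto)
    then show "continuous_on (?U \<times> {0..1}) (\<lambda>z. blinfun_apply (case z of (x, t) \<Rightarrow> B x t) i)"
      by (rule continuous_on_eq) (use r in \<open>auto simp: BD Dexp subset_iff\<close>)
  qed
  have "((\<lambda>x. integral (cbox 0 1) (\<lambda>t. w t * h (seg Q p t x))) has_derivative integral (cbox 0 1) (B x0)) (at x0 within ?U)"
  proof (rule leibniz_rule)
    show "((\<lambda>x. w t * h (seg Q p t x)) has_derivative blinfun_apply (B x t)) (at x within ?U)"
      if "x \<in> ?U" "t \<in> cbox 0 1" for x t
    proof -
      have "x \<in> S" "t \<in> {0..1}" using that r by auto
      then show ?thesis using Dder[of x t] BD[of x t] by (simp add: has_derivative_at_withinI)
    qed
    show "(\<lambda>t. w t * h (seg Q p t x)) integrable_on cbox 0 1" if "x \<in> ?U" for x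
      using seg_integrable[OF Q _ _ w, of S h p x] h that r seg Ck_on_lower[OF h] by (auto simp: subset_iff)
    show "continuous_on (?U \<times> cbox 0 1) (\<lambda>(x, t). B x t)" using contB by simp
  qed (use r in auto)
  then have main: "((\<lambda>x. integral {0..1} (\<lambda>t. w t * h (seg Q p t x))) has_derivative integral {0..1} (B x0)) (at x0)"
    using at_within_open[of x0 ?U] r by simp
  have Bint: "B x0 integrable_on {0..1}"
  proof (rule integrable_continuous_real)
    have "continuous_on {0..1} (\<lambda>t. (\<lambda>(x, t). B x t) (x0, t))"
      by (rule continuous_on_compose2[OF contB]) (use r in \<open>auto intro: continuous_intros\<close>)
    then show "continuous_on {0..1} (B x0)" by simp
  qed
  have "integral {0..1} (B x0) v = integral {0..1} (\<lambda>t. w t * FD h (seg Q p t x0) v)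
       - integral {0..1} (\<lambda>t. (w t * (1 - t)) * FD h (seg Q p t x0) (Q v))" for v
  proof -
    have i1: "(\<lambda>t. w t * FD h (seg Q p t x0) v) integrable_on {0..1}" for v
      by (rule seg_integrable[OF Q _ _ w, of S "\<lambda>y. FD h y v"]) (use h seg x0 in auto)
    have i2: "(\<lambda>t. (w t * (1 - t)) * FD h (seg Q p t x0) v) integrable_on {0..1}" for v
      by (rule seg_integrable[OF Q, of S "\<lambda>y. FD h y v"])
         (use h seg x0 w in \<open>auto intro!: continuous_intros\<close>)
    have "integral {0..1} (B x0) v = integral {0..1} (\<lambda>t. B x0 t v)"
      using integral_linear[OF Bint bounded_bilinear.bounded_linear_left[OF bounded_bilinear_blinfun_apply, of v]] by (simp add: o_def)
    also have "\<dots> = integral {0..1} (\<lambda>t. w t * FD h (seg Q p t x0) v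
       - (w t * (1 - t)) * FD h (seg Q p t x0) (Q v))"
      by (rule Henstock_Kurzweil_Integration.integral_cong) (simp add: BD Dexp x0 algebra_simps)
    finally show ?thesis by (simp add: integral_diff i1 i2)
  qed
  then show ?thesis using main by presburger
qed

text \<open>A directional derivative of such an integral is a difference of two such integrals, so
  the induction on k works once integrand and weight are both generalized.\<close>

lemma smooth_on_seg_integral:
  fixes h :: "'a::euclidean_space \<Rightarrow> real"
  assumes S: "open S" and Q: "bounded_linear Q"
    and seg: "\<And>x t. x \<in> S \<Longrightarrow> t \<in> {0..1} \<Longrightarrow> seg Q p t x \<in> S"
    and h: "smooth_on S h" and w: "continuous_on {0..1} w"
  shows "smooth_on S (\<lambda>x. integral {0..1} (\<lambda>t. w t * h (seg Q p t x)))"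
proof -
  let ?I = "\<lambda>w (h :: 'a \<Rightarrow> real) x. integral {0..1} (\<lambda>t. w t * h (seg Q p t x))"
  have der: "(?I w h has_derivative (\<lambda>v. ?I w (\<lambda>y. FD h y v) x
      - ?I (\<lambda>t. w t * (1 - t)) (\<lambda>y. FD h y (Q v)) x)) (at x)"
    if "smooth_on S h" "continuous_on {0..1} w" "x \<in> S" for h w x
    using seg_integral_has_derivative[OF S Q seg _ that(2,3)] that(1) by (simp only: smooth_on_def)
  have "Ck_on k S (?I w h)" for k
    using h w
  proof (induction k arbitrary: h w)
    case 0
    then show ?case
      unfolding Ck_on.simps
      by (intro continuous_at_imp_continuous_on ballI) (rule has_derivative_continuous[OF der[OF 0]])
  next
    case (Suc k)
    note h' = smooth_on_frechet[OF Suc.prems(1)]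
    show ?case
    proof (rule Ck_on_SucI[OF S der[OF Suc.prems]])
      fix v
      have w': "continuous_on {0..1} (\<lambda>t. w t * (1 - t))"
        using Suc.prems(2) by (intro continuous_intros)
      have "Ck_on k S (\<lambda>x. f x - g x)" if "Ck_on k S f" "Ck_on k S g" for f g :: "'a \<Rightarrow> real"
        using Ck_on_add[OF S that(1) Ck_on_linear_comp[OF S bounded_linear_minus[OF bounded_linear_ident] that(2)]] by simp
      then show "Ck_on k S (\<lambda>x. ?I w (\<lambda>y. FD h y v) x
          - ?I (\<lambda>t. w t * (1 - t)) (\<lambda>y. FD h y (Q v)) x)"
        using Suc.IH[OF h' Suc.prems(2)] Suc.IH[OF h' w'] by blast
    qed
  qed
  then show ?thesis by (simp add: smooth_on_def)
qed

lemma seg_id_ball: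
  fixes x :: "'a::real_normed_vector"
  assumes "x \<in> ball p r" "t \<in> {0..1}"
  shows "seg (\<lambda>v. v) p t x \<in> ball p r"
proof -
  have "p - seg (\<lambda>v. v) p t x = t *\<^sub>R (p - x)"
    by (simp add: seg_def algebra_simps)
  then have "norm (p - seg (\<lambda>v. v) p t x) \<le> norm (p - x)"
    using assms(2) by (simp add: mult_left_le_one_le)
  then show ?thesis using assms(1) by (simp add: dist_norm)
qed

lemma seg_has_vector_derivative:
  assumes "bounded_linear Q"
  shows "((\<lambda>t. seg Q p t x) has_vector_derivative Q (x - p)) (at t within T)"
  unfolding seg_def
  by (rule derivative_eq_intros | simp)+
     (metis bounded_linear.linear[OF assms] linear_neg minus_diff_eq)

lemma seg_comp_derivative:
  fixes h :: "'a::euclidean_space \<Rightarrow> real"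
  assumes Q: "bounded_linear Q" and h: "smooth_on S h" and s: "seg Q p t x \<in> S"
  shows "((\<lambda>t. h (seg Q p t x)) has_vector_derivative FD h (seg Q p t x) (Q (x - p))) (at t within T)"
  using vector_derivative_diff_chain_within[OF seg_has_vector_derivative[OF Q]
      has_derivative_at_withinI[OF smooth_on_has_derivative[OF h s]]] by (simp add: o_def)

lemma seg_ftc:
  fixes h :: "'a::euclidean_space \<Rightarrow> real"
  assumes Q: "bounded_linear Q" and h: "smooth_on S h" and s: "\<And>t. t \<in> {0..1} \<Longrightarrow> seg Q p t x \<in> S"
  shows "h x = h (seg Q p 0 x) + integral {0..1} (\<lambda>t. FD h (seg Q p t x) (Q (x - p)))"
proof -
  have "((\<lambda>t. FD h (seg Q p t x) (Q (x - p))) has_integral h (seg Q p 1 x) - h (seg Q p 0 x)) {0..1}"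
    by (rule fundamental_theorem_of_calculus[OF _ seg_comp_derivative[OF Q h s]]) simp_all
  then show ?thesis by (simp add: integral_unique seg_def)
qed

text \<open>This integrates the derivative of t h(seg Q p t x) over [0,1]. The factor t removes the
  value at the starting point, and the value at t = 1 is h x.\<close>

lemma seg_radial_identity:
  fixes h :: "'a::euclidean_space \<Rightarrow> real"
  assumes Q: "bounded_linear Q" and h: "smooth_on S h" and s: "\<And>t. t \<in> {0..1} \<Longrightarrow> seg Q p t x \<in> S"
  shows "h x = integral {0..1} (\<lambda>t. h (seg Q p t x)) + integral {0..1} (\<lambda>t. t * FD h (seg Q p t x) (Q (x - p)))"
proof -
  have "((\<lambda>t. t *\<^sub>R h (seg Q p t x)) has_vector_derivative
      (t *\<^sub>R FD h (seg Q p t x) (Q (x - p)) + 1 *\<^sub>R h (seg Q p t x))) (at t within {0..1})"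
    if "t \<in> {0..1}" for t
    by (rule has_vector_derivative_scaleR[OF _ seg_comp_derivative[OF Q h s[OF that]]]) (rule derivative_intros)
  then have "((\<lambda>t. t *\<^sub>R FD h (seg Q p t x) (Q (x - p)) + 1 *\<^sub>R h (seg Q p t x))
      has_integral 1 *\<^sub>R h (seg Q p 1 x) - 0 *\<^sub>R h (seg Q p 0 x)) {0..1}"
    by (intro fundamental_theorem_of_calculus[where f="\<lambda>t. t *\<^sub>R h (seg Q p t x)"]) simp_all
  then have "h x = integral {0..1} (\<lambda>t. t * FD h (seg Q p t x) (Q (x - p)) + h (seg Q p t x))"
    by (simp add: integral_unique seg_def)
  also have "\<dots> = integral {0..1} (\<lambda>t. t * FD h (seg Q p t x) (Q (x - p))) + integral {0..1} (\<lambda>t. h (seg Q p t x))"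
    using seg_integrable[OF Q smooth_on_continuous[OF smooth_on_frechet[OF h]] s, where w="\<lambda>t. t"]
      seg_integrable[OF Q smooth_on_continuous[OF h] s, where w="\<lambda>t. 1"]
    by (intro Henstock_Kurzweil_Integration.integral_add) (auto intro: continuous_intros)
  finally show ?thesis by simp
qed

lemma linear_axis_expansion:
  fixes D :: "real^'n \<Rightarrow> 'b::real_vector"
  assumes "linear D"
  shows "D v = (\<Sum>j\<in>UNIV. v $ j *\<^sub>R D (axis j 1))"
proof -
  interpret linear D by fact
  have "D v = D (\<Sum>j\<in>UNIV. v $ j *\<^sub>R (axis j 1 :: real^'n))"
    by (simp add: basis_expansion flip: scalar_mult_eq_scaleR)
  then show ?thesis by (simp add: sum scaleR)
qed

text \<open>Each g j is the mean of the j-th partial derivative along the segment from p to x, so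
  the expansion is the fundamental theorem of calculus along that segment. It is needed to see that
  derivations of germs are combinations of partial derivatives.\<close>

lemma hadamard:
  fixes h :: "real^'n \<Rightarrow> real"
  assumes h: "smooth_on (ball p r) h"
  obtains g where "\<And>j. smooth_on (ball p r) (g j)"
    "\<And>x. x \<in> ball p r \<Longrightarrow> h x = h p + (\<Sum>j\<in>UNIV. (x $ j - p $ j) * g j x)"
    "\<And>j. g j p = FD h p (axis j 1)"
proof
  let ?Q = "\<lambda>v::real^'n. v"
  define g where "g j x = integral {0..1} (\<lambda>t. 1 * FD h (seg ?Q p t x) (axis j 1))" for j x
  show "smooth_on (ball p r) (g j)" for j
    unfolding g_def
    by (rule smooth_on_seg_integral[OF _ bounded_linear_ident seg_id_ball smooth_on_frechet[OF h]]) auto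
  show "g j p = FD h p (axis j 1)" for j
    by (simp add: g_def seg_def)
  fix x assume x: "x \<in> ball p r"
  have lin: "linear (FD h (seg ?Q p t x))" if "t \<in> {0..1}" for t
    using smooth_on_has_derivative[OF h seg_id_ball[OF x that]] has_derivative_linear by blast
  have int: "(\<lambda>t. 1 * FD h (seg ?Q p t x) (axis j 1)) integrable_on {0..1}" for j
    by (rule seg_integrable[OF bounded_linear_ident smooth_on_continuous[OF smooth_on_frechet[OF h]] seg_id_ball[OF x]]) auto
  have "h x = h p + integral {0..1} (\<lambda>t. FD h (seg ?Q p t x) (x - p))"
    using seg_ftc[OF bounded_linear_ident h seg_id_ball[OF x]] by (simp add: seg_def)
  also have "integral {0..1} (\<lambda>t. FD h (seg ?Q p t x) (x - p))
     = integral {0..1} (\<lambda>t. \<Sum>j\<in>UNIV. (x $ j - p $ j) * (1 * FD h (seg ?Q p t x) (axis j 1)))"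
  proof (rule Henstock_Kurzweil_Integration.integral_cong)
    fix t :: real assume "t \<in> {0..1}"
    from linear_axis_expansion[OF lin[OF this], of "x - p"]
    show "FD h (seg ?Q p t x) (x - p) =
        (\<Sum>j\<in>UNIV. (x $ j - p $ j) * (1 * FD h (seg ?Q p t x) (axis j 1)))"
      by simp
  qed
  also have "\<dots> = (\<Sum>j\<in>UNIV. (x $ j - p $ j) * g j x)"
    unfolding g_def by (subst integral_sum) (use int in \<open>auto intro: integrable_on_mult_right\<close>)
  finally show "h x = h p + (\<Sum>j\<in>UNIV. (x $ j - p $ j) * g j x)" .
qed

text \<open>If Q v = v, then v - (1 - t) Q v = t v, and the two integrals of the general formula
  merge into one with weight t, the weight that occurs in
  \<open>seg_radial_identity\<close>.\<close>

lemma seg_integral_derivative_fixed: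
  fixes h :: "'a::euclidean_space \<Rightarrow> real"
  assumes S: "open S" and Q: "bounded_linear Q"
    and seg: "\<And>x t. x \<in> S \<Longrightarrow> t \<in> {0..1} \<Longrightarrow> seg Q p t x \<in> S"
    and h: "smooth_on S h" and x: "x \<in> S"
  obtains D where "((\<lambda>x. integral {0..1} (\<lambda>t. 1 * h (seg Q p t x))) has_derivative D) (at x)"
    "\<And>v. Q v = v \<Longrightarrow> D v = integral {0..1} (\<lambda>t. t * FD h (seg Q p t x) v)"
proof
  let ?D = "\<lambda>v. integral {0..1} (\<lambda>t. 1 * FD h (seg Q p t x) v)
    - integral {0..1} (\<lambda>t. (1 * (1 - t)) * FD h (seg Q p t x) (Q v))"
  show "((\<lambda>x. integral {0..1} (\<lambda>t. 1 * h (seg Q p t x))) has_derivative ?D) (at x)"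
    by (rule seg_integral_has_derivative[OF S Q seg])
       (use h x in \<open>auto simp: smooth_on_def simp del: Ck_on.simps\<close>)
  fix v assume v: "Q v = v"
  have int: "(\<lambda>t. w t * FD h (seg Q p t x) v) integrable_on {0..1}" if "continuous_on {0..1} w" for w
    by (rule seg_integrable[OF Q smooth_on_continuous[OF smooth_on_frechet[OF h]] seg[OF x] that]) auto
  show "?D v = integral {0..1} (\<lambda>t. t * FD h (seg Q p t x) v)"
    unfolding v
    by (subst integral_diff[symmetric], rule int, simp, rule int, intro continuous_intros)
       (simp add: algebra_simps)
qed

text \<open>The primitive is the integral of the form along the segment from p to x, that is, the
  sum of (x_i - p_i) times the mean of a_i.\<close>

lemma poincare_one_form:
  fixes a :: "'n::finite \<Rightarrow> real^'n \<Rightarrow> real"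
  assumes a: "\<And>i. smooth_on (ball p r) (a i)"
    and closed: "\<And>x i j. x \<in> ball p r \<Longrightarrow>
      FD (a i) x (axis j 1) = FD (a j) x (axis i 1)"
  obtains F where "smooth_on (ball p r) F"
    "\<And>x. x \<in> ball p r \<Longrightarrow> (F has_derivative (\<lambda>v. \<Sum>i\<in>UNIV. v $ i * a i x)) (at x)"
proof -
  let ?Q = "\<lambda>v::real^'n. v" and ?B = "ball p r"
  define I where "I i x = integral {0..1} (\<lambda>t. 1 * a i (seg ?Q p t x))" for i x
  define F where "F x = (\<Sum>i\<in>UNIV. (x $ i - p $ i) * I i x)" for x
  define D where "D i x t = FD (a i) (seg ?Q p t x)" for i x t
  have der: "(F has_derivative (\<lambda>v. \<Sum>i\<in>UNIV. v $ i * a i x)) (at x)" if x: "x \<in> ?B" for x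
  proof -
    have int: "(\<lambda>t. w t * D i x t v) integrable_on {0..1}" if "continuous_on {0..1} w" for w i v
      unfolding D_def
      by (rule seg_integrable[OF bounded_linear_ident smooth_on_continuous[OF smooth_on_frechet[OF a]] seg_id_ball[OF x] that]) auto
    have I': "(I i has_derivative (\<lambda>v. integral {0..1} (\<lambda>t. t * D i x t v))) (at x)" for i
    proof -
      obtain D' where "(I i has_derivative D') (at x)" "\<And>v. D' v = integral {0..1} (\<lambda>t. t * D i x t v)"
        using seg_integral_derivative_fixed[OF open_ball bounded_linear_ident seg_id_ball a x, of i, folded I_def D_def]
        by auto
      moreover from this(2) have "D' = (\<lambda>v. integral {0..1} (\<lambda>t. t * D i x t v))" by blast
      ultimately show ?thesis by simp
    qed
    have lin: "linear (D i x t)" if "t \<in> {0..1}" for i t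
      unfolding D_def using smooth_on_has_derivative[OF a seg_id_ball[OF x that]] has_derivative_linear by blast
    \<comment> \<open>Here closedness enters: it trades the derivative of the coefficients in
      direction v for their radial derivative, and only the latter is accessible to
      \<open>seg_radial_identity\<close>.\<close>
    have swap: "(\<Sum>i\<in>UNIV. (x $ i - p $ i) * D i x t v) = (\<Sum>i\<in>UNIV. v $ i * D i x t (x - p))"
      if "t \<in> {0..1}" for t v
    proof -
      have "(\<Sum>i\<in>UNIV. (x $ i - p $ i) * D i x t v)
          = (\<Sum>i\<in>UNIV. \<Sum>j\<in>UNIV. (x $ i - p $ i) * (v $ j * D i x t (axis j 1)))"
        by (subst linear_axis_expansion[OF lin[OF that], of _ v]) (simp add: sum_distrib_left)
      also have "\<dots> = (\<Sum>i\<in>UNIV. \<Sum>j\<in>UNIV. (x $ i - p $ i) * (v $ j * D j x t (axis i 1)))"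
        unfolding D_def using closed[OF seg_id_ball[OF x that]] by simp
      also have "\<dots> = (\<Sum>j\<in>UNIV. \<Sum>i\<in>UNIV. (x $ i - p $ i) * (v $ j * D j x t (axis i 1)))"
        by (rule sum.swap)
      also have "\<dots> = (\<Sum>j\<in>UNIV. v $ j * D j x t (x - p))"
        by (subst linear_axis_expansion[OF lin[OF that], of _ "x - p"])
           (simp add: sum_distrib_left mult.left_commute)
      finally show ?thesis .
    qed
    have "(\<Sum>i\<in>UNIV. (x $ i - p $ i) * integral {0..1} (\<lambda>t. t * D i x t v) + v $ i * I i x)
        = (\<Sum>i\<in>UNIV. v $ i * a i x)" for v
    proof -
      have ci: "(\<lambda>t. c * (t * D i x t w)) integrable_on {0..1}" for i w c
        by (intro integrable_on_mult_right int continuous_intros)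
      have "(\<Sum>i\<in>UNIV. (x $ i - p $ i) * integral {0..1} (\<lambda>t. t * D i x t v))
          = integral {0..1} (\<lambda>t. \<Sum>i\<in>UNIV. (x $ i - p $ i) * (t * D i x t v))"
        by (subst integral_sum) (auto intro: ci)
      also have "\<dots> = integral {0..1} (\<lambda>t. \<Sum>i\<in>UNIV. v $ i * (t * D i x t (x - p)))"
      proof (rule Henstock_Kurzweil_Integration.integral_cong)
        fix t :: real assume "t \<in> {0..1}"
        from arg_cong[OF swap[OF this, of v], of "\<lambda>s. t * s"]
        show "(\<Sum>i\<in>UNIV. (x $ i - p $ i) * (t * D i x t v)) = (\<Sum>i\<in>UNIV. v $ i * (t * D i x t (x - p)))"
          by (simp add: sum_distrib_left mult.left_commute)
      qed
      also have "\<dots> = (\<Sum>i\<in>UNIV. v $ i * integral {0..1} (\<lambda>t. t * D i x t (x - p)))"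
        by (subst integral_sum) (auto intro: ci)
      finally have "(\<Sum>i\<in>UNIV. (x $ i - p $ i) * integral {0..1} (\<lambda>t. t * D i x t v) + v $ i * I i x)
        = (\<Sum>i\<in>UNIV. v $ i * (I i x + integral {0..1} (\<lambda>t. t * D i x t (x - p))))"
        by (simp add: sum.distrib distrib_left)
      also have "\<dots> = (\<Sum>i\<in>UNIV. v $ i * a i x)"
        using seg_radial_identity[OF bounded_linear_ident a seg_id_ball[OF x]] by (simp add: I_def D_def)
      finally show ?thesis .
    qed
    moreover have "(F has_derivative (\<lambda>v. \<Sum>i\<in>UNIV. (x $ i - p $ i) * integral {0..1} (\<lambda>t. t * D i x t v) + v $ i * I i x)) (at x)"
      unfolding F_def
    proof (rule has_derivative_sum, rule has_derivative_mult[OF _ I'])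
      show "((\<lambda>x. x $ i - p $ i) has_derivative (\<lambda>v. v $ i)) (at x)" for i
        by (rule derivative_eq_intros bounded_linear.has_derivative[OF bounded_linear_vec_nth] | simp)+
    qed
    ultimately show ?thesis by simp
  qed
  moreover have "smooth_on ?B F"
    by (rule smooth_onI[OF _ der]) (auto intro!: smooth_on_sum smooth_on_mult a)
  ultimately show ?thesis using that by blast
qed

text \<open>G is the integral of h in the m-th variable from p_m to x_m, written as x_m - p_m times
  a mean value. The path varies only coordinate m, moving it towards the centre, and so stays in the
  ball.\<close>

lemma coordinate_primitive:
  fixes h :: "real^'n \<Rightarrow> real"
  assumes h: "smooth_on (ball p r) h"
  obtains G where "smooth_on (ball p r) G"
    "\<And>x. x \<in> ball p r \<Longrightarrow> FD G x (axis m 1) = h x"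
proof -
  let ?B = "ball p r"
  define Q where "Q v = v $ m *\<^sub>R (axis m 1 :: real^'n)" for v :: "real^'n"
  have Q: "bounded_linear Q"
    unfolding Q_def by (rule bounded_linear_scaleR_const[OF bounded_linear_vec_nth])
  have seg: "seg Q p t x \<in> ?B" if "x \<in> ?B" "t \<in> {0..1}" for x t
  proof -
    have "(p - seg Q p t x) $ i = (if i = m then t else 1) * (p - x) $ i" for i
      by (simp add: seg_def Q_def axis_def algebra_simps)
    then have "norm (p - seg Q p t x) \<le> norm (p - x)"
      using that(2) by (intro norm_le_componentwise_cart) (auto simp: abs_mult mult_left_le_one_le)
    then show ?thesis using that(1) by (simp add: dist_norm)
  qed
  define I where "I x = integral {0..1} (\<lambda>t. 1 * h (seg Q p t x))" for x
  define G where "G x = (x $ m - p $ m) * I x" for x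
  have I: "smooth_on ?B I"
    unfolding I_def by (rule smooth_on_seg_integral[OF _ Q seg h]) auto
  have G: "smooth_on ?B G"
    unfolding G_def by (intro smooth_on_mult I smooth_on_diff smooth_on_nth smooth_on_id) auto
  moreover have "FD G x (axis m 1) = h x" if x: "x \<in> ?B" for x
  proof -
    define D where "D t = FD h (seg Q p t x)" for t
    have lin: "linear (D t)" if "t \<in> {0..1}" for t
      unfolding D_def using smooth_on_has_derivative[OF h seg[OF x that]] has_derivative_linear by blast
    obtain D' where I': "(I has_derivative D') (at x)"
      and D': "\<And>v. Q v = v \<Longrightarrow> D' v = integral {0..1} (\<lambda>t. t * D t v)"
      using seg_integral_derivative_fixed[OF open_ball Q seg h x, folded I_def D_def] by blast
    have "((\<lambda>x. x $ m - p $ m) has_derivative (\<lambda>v. v $ m)) (at x)"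
      by (rule derivative_eq_intros bounded_linear.has_derivative[OF bounded_linear_vec_nth] | simp)+
    from has_derivative_mult[OF this I', folded G_def]
    have "FD G x (axis m 1) = (x $ m - p $ m) * D' (axis m 1) + (axis m 1 :: real^'n) $ m * I x"
      by (rule fun_cong[OF frechet_derivative_at[symmetric]])
    also have "\<dots> = (x $ m - p $ m) * integral {0..1} (\<lambda>t. t * D t (axis m 1)) + I x"
      by (simp add: D' Q_def)
    also have "(x $ m - p $ m) * integral {0..1} (\<lambda>t. t * D t (axis m 1)) = integral {0..1} (\<lambda>t. t * D t (Q (x - p)))"
      unfolding integral_mult_right[symmetric]
      by (rule Henstock_Kurzweil_Integration.integral_cong) (simp add: Q_def linear_scale[OF lin])
    also have "\<dots> + I x = h x"
      using seg_radial_identity[OF Q h seg[OF x]] by (simp add: I_def D_def)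
    finally show ?thesis .
  qed
  ultimately show ?thesis using that by blast
qed

subsection \<open>Bump functions\<close>

text \<open>The powers of \<open>1/x\<close> make the family closed under differentiation.\<close>

definition flat_exp :: "nat \<Rightarrow> real \<Rightarrow> real"
  where "flat_exp m x = (if x > 0 then inverse x ^ m * exp (- inverse x) else 0)"

text \<open>Under y = 1/x the right-hand limit becomes that of y^m / exp y at infinity.\<close>

lemma flat_exp_tendsto_0: "(flat_exp m \<longlongrightarrow> 0) (at 0)"
proof -
  have "((\<lambda>y::real. y ^ m / exp y) \<longlongrightarrow> 0) at_top"
    by (rule tendsto_power_div_exp_0)
  then have "((\<lambda>x::real. inverse x ^ m / exp (inverse x)) \<longlongrightarrow> 0) (at_right 0)"
    by (rule filterlim_compose) (rule filterlim_inverse_at_top_right)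
  then have R: "(flat_exp m \<longlongrightarrow> 0) (at_right 0)"
    by (rule Lim_transform_eventually)
       (auto simp: flat_exp_def eventually_at_filter exp_minus divide_inverse)
  have L: "(flat_exp m \<longlongrightarrow> 0) (at_left 0)"
    by (rule tendsto_eventually) (auto simp: flat_exp_def eventually_at_filter)
  show ?thesis using L R by (simp add: filterlim_split_at)
qed

lemma flat_exp_deriv:
  "(flat_exp m has_real_derivative (flat_exp (m + 2) x - real m * flat_exp (Suc m) x)) (at x)"
proof -
  consider "x > 0" | "x < 0" | "x = 0" by linarith
  then show ?thesis
  proof cases
    case 1
    have "((\<lambda>x. inverse x ^ m) has_real_derivative real m * (- (inverse x ^ 2) * inverse x ^ (m - 1))) (at x)"
      using DERIV_power[OF DERIV_inverse[of x], of m] 1 by (simp add: numeral_2_eq_2)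
    moreover have "((\<lambda>x. exp (- inverse x)) has_real_derivative exp (- inverse x) * inverse x ^ 2) (at x)"
      using 1 by (auto intro!: derivative_eq_intros simp: power2_eq_square)
    ultimately have "((\<lambda>x. inverse x ^ m * exp (- inverse x)) has_real_derivative
        real m * (- (inverse x ^ 2) * inverse x ^ (m - 1)) * exp (- inverse x)
          + exp (- inverse x) * inverse x ^ 2 * inverse x ^ m) (at x)"
      by (rule DERIV_mult)
    moreover have "real m * (- (inverse x ^ 2) * inverse x ^ (m - 1)) * exp (- inverse x)
          + exp (- inverse x) * inverse x ^ 2 * inverse x ^ m = flat_exp (m + 2) x - real m * flat_exp (Suc m) x"
      using 1 by (cases m) (simp_all add: flat_exp_def power_add power2_eq_square)
    ultimately have "((\<lambda>x. inverse x ^ m * exp (- inverse x)) has_real_derivative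
        (flat_exp (m + 2) x - real m * flat_exp (Suc m) x)) (at x)"
      by simp
    then show ?thesis
      by (rule has_field_derivative_transform_within_open[OF _ open_greaterThan[of 0]]) (use 1 in \<open>auto simp: flat_exp_def\<close>)
  next
    case 2
    have "((\<lambda>x. 0) has_real_derivative (flat_exp (m + 2) x - real m * flat_exp (Suc m) x)) (at x)"
      using 2 by (simp add: flat_exp_def)
    then show ?thesis
      by (rule has_field_derivative_transform_within_open[OF _ open_lessThan[of 0]]) (use 2 in \<open>auto simp: flat_exp_def\<close>)
  next
    case 3
    \<comment> \<open>At the origin the difference quotient of \<open>flat_exp m\<close> is
      \<open>flat_exp (Suc m)\<close>, whose limit is known.\<close>
    have "((\<lambda>h. (flat_exp m (0 + h) - flat_exp m 0) / h) \<longlongrightarrow> 0) (at 0)"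
      using flat_exp_tendsto_0[of "Suc m"]
      by (rule Lim_transform_eventually) (auto simp: flat_exp_def divide_inverse)
    then show ?thesis using 3 by (simp add: DERIV_def flat_exp_def)
  qed
qed

lemma smooth_on_flat_exp: "smooth_on UNIV (flat_exp m)"
proof -
  have "Ck_on k UNIV (flat_exp m)" for k
  proof (induction k arbitrary: m)
    case 0
    then show ?case
      using flat_exp_deriv DERIV_isCont by (auto intro!: continuous_at_imp_continuous_on) blast
  next
    case (Suc k)
    show ?case
    proof (rule Ck_on_SucI)
      show "(flat_exp m has_derivative (\<lambda>v. (flat_exp (m + 2) x + (- real m) * flat_exp (Suc m) x) * v)) (at x)" for x
        using flat_exp_deriv[of m x] by (simp add: has_field_derivative_def)
      show "Ck_on k UNIV (\<lambda>x. (flat_exp (m + 2) x + (- real m) * flat_exp (Suc m) x) * v)" for v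
        by (intro Ck_on_mult Ck_on_add Suc.IH Ck_on_const open_UNIV)
    qed simp
  qed
  then show ?thesis by (simp add: smooth_on_def)
qed

text \<open>The quotient a / (a + b) works because a is positive exactly at distance less than 2r
  and b exactly at distance greater than r, so that their sum never vanishes. Squared distances are
  used because they are smooth at p as well.\<close>

lemma smooth_bump:
  fixes p :: "'a::euclidean_space"
  assumes "r > 0"
  obtains \<rho> :: "'a \<Rightarrow> real" where "smooth_on UNIV \<rho>" "\<And>x. dist p x \<le> r \<Longrightarrow> \<rho> x = 1" "\<And>x. dist p x \<ge> 2 * r \<Longrightarrow> \<rho> x = 0"
proof
  define a where "a x = flat_exp 0 (4 * r\<^sup>2 + - ((x - p) \<bullet> (x - p)))" for x
  define b where "b x = flat_exp 0 ((x - p) \<bullet> (x - p) + - r\<^sup>2)" for x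
  let ?\<rho> = "\<lambda>x. a x / (a x + b x)"
  have ip: "(x - p) \<bullet> (x - p) = (dist p x)\<^sup>2" for x
    by (simp add: dist_norm power2_norm_eq_inner inner_diff_left inner_diff_right)
  have nz: "a x + b x \<noteq> 0" for x
  proof (cases "dist p x < 2 * r")
    case True
    then have "(dist p x)\<^sup>2 < (2 * r)\<^sup>2" by (intro power_strict_mono) auto
    then have "a x > 0" "b x \<ge> 0" by (auto simp: a_def b_def flat_exp_def ip)
    then show ?thesis by simp
  next
    case False
    then have "dist p x > r" using assms by simp
    then have "(dist p x)\<^sup>2 > r\<^sup>2" using assms by (intro power_strict_mono) auto
    then have "a x \<ge> 0" "b x > 0" by (auto simp: a_def b_def flat_exp_def ip)
    then show ?thesis by simp
  qed
  have q: "smooth_on UNIV (\<lambda>x. (x - p) \<bullet> (x - p))"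
  proof -
    have "smooth_on UNIV (\<lambda>x::'a. \<Sum>i\<in>Basis. ((x - p) \<bullet> i) * ((x - p) \<bullet> i))"
      by (intro smooth_on_sum smooth_on_mult smooth_on_linear_comp[OF _ bounded_linear_inner_left]
          smooth_on_diff smooth_on_id smooth_on_const) auto
    then show ?thesis by (simp only: euclidean_inner[symmetric])
  qed
  have "smooth_on UNIV a" "smooth_on UNIV b"
    unfolding a_def b_def
    by (rule smooth_on_compose[OF open_UNIV open_UNIV _ _ smooth_on_flat_exp];
        (intro smooth_on_add smooth_on_minus q smooth_on_const open_UNIV)?; simp)+
  then show "smooth_on UNIV ?\<rho>"
    by (intro smooth_on_divide smooth_on_add nz open_UNIV)
  show "?\<rho> x = 1" if "dist p x \<le> r" for x
  proof -
    have "(dist p x)\<^sup>2 \<le> r\<^sup>2" using that by (intro power_mono) auto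
    then have "b x = 0" by (simp add: b_def flat_exp_def ip)
    then show ?thesis using nz[of x] by simp
  qed
  show "?\<rho> x = 0" if "dist p x \<ge> 2 * r" for x
  proof -
    have "(dist p x)\<^sup>2 \<ge> (2 * r)\<^sup>2" using that assms by (intro power_mono) auto
    then have "a x = 0" by (simp add: a_def flat_exp_def ip)
    then show ?thesis by simp
  qed
qed

subsection \<open>Local diffeomorphisms\<close>

lemma matrix_nth: "matrix f $ i $ j = f (axis j 1) $ i"
  by (simp add: matrix_def)

text \<open>The smoothness of the inverse is a bootstrap. By Cramer's rule the derivative of g at y
  has entries rational in the entries of Df(g y); if g is of class C^k, so is its derivative, and g
  is of class C^(k+1).\<close>

lemma smooth_inverse_function:
  fixes f :: "real^'n \<Rightarrow> real^'n"
  assumes S: "open S" and f: "smooth_on S f" and p: "p \<in> S"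
    and d: "det (matrix (FD f p)) \<noteq> 0"
  obtains T g where "open T" "p \<in> T" "T \<subseteq> S" "open (f ` T)" "homeomorphism T (f ` T) f g" "smooth_on (f ` T) g"
proof -
  let ?D = "\<lambda>x. FD f x"
  have der: "(f has_derivative ?D x) (at x)" if "x \<in> S" for x
    using smooth_on_has_derivative[OF f that] .
  define f' where "f' x = Blinfun (?D x)" for x
  have f': "blinfun_apply (f' x) = ?D x" if "x \<in> S" for x
    unfolding f'_def using der[OF that] bounded_linear_Blinfun_apply has_derivative_bounded_linear by blast
  have contf': "continuous_on S f'"
  proof (rule continuous_on_blinfun_componentwise)
    fix i :: "real^'n"
    show "continuous_on S (\<lambda>x. blinfun_apply (f' x) i)"
      by (rule continuous_on_eq[OF smooth_on_continuous[OF smooth_on_frechet[OF f, of i]]]) (simp add: f')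
  qed
  obtain N where N: "N ** matrix (?D p) = mat 1"
    using d unfolding invertible_det_nz[symmetric] invertible_def by blast
  have blN: "bounded_linear ((*v) N)" by (rule matrix_vector_mul_bounded_linear)
  have linD: "linear (?D x)" if "x \<in> S" for x
    using der[OF that] has_derivative_linear by blast
  have "Blinfun ((*v) N) o\<^sub>L f' p = id_blinfun"
  proof (rule blinfun_eqI)
    fix v
    have "N *v ?D p v = N *v (matrix (?D p) *v v)"
      by (simp add: matrix_works linD[OF p])
    also have "\<dots> = v" by (simp add: matrix_vector_mul_assoc N)
    finally show "blinfun_apply (Blinfun ((*v) N) o\<^sub>L f' p) v = blinfun_apply id_blinfun v"
      by (simp add: bounded_linear_Blinfun_apply[OF blN] f'[OF p])
  qed
  then obtain T V g g' where T: "open T" "T \<subseteq> S" "p \<in> T" and V: "open V" and hom: "homeomorphism T V f g"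
    and g: "\<And>y. y \<in> V \<Longrightarrow> (g has_derivative (g' y)) (at y)"
      "\<And>y. y \<in> V \<Longrightarrow> g' y = inv (blinfun_apply (f'(g y)))"
      "\<And>y. y \<in> V \<Longrightarrow> bij (blinfun_apply (f'(g y)))"
    using inverse_function_theorem[OF S _ contf' p] der f' by metis
  have VT: "V = f ` T" using hom by (simp add: homeomorphism_def)
  have gS: "g y \<in> S" if "y \<in> V" for y using hom T that by (auto simp: homeomorphism_def)
  define M where "M y = matrix (?D (g y))" for y
  have g'eq: "g' y v = (\<chi> k. det (\<chi> i j. if j = k then v $ i else M y $ i $ j) / det (M y))"
    and dM: "det (M y) \<noteq> 0" if "y \<in> V" for y v
  proof -
    have bij: "bij (?D (g y))" and gi: "g' y = inv (?D (g y))" using g(2,3)[OF that] f' gS that by auto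
    show dM: "det (M y) \<noteq> 0"
      unfolding M_def using bij linD[OF gS[OF that]] by (simp add: det_nz_iff_inj bij_is_inj)
    have "M y *v g' y v = v"
      using bij by (simp add: M_def matrix_works linD[OF gS[OF that]] gi bij_is_surj surj_f_inv_f)
    then show "g' y v = (\<chi> k. det (\<chi> i j. if j = k then v $ i else M y $ i $ j) / det (M y))"
      using cramer[OF dM] by blast
  qed
  have "Ck_on k V g" for k
  proof (induction k)
    case 0
    then show ?case using hom by (simp add: homeomorphism_def)
  next
    case (Suc k)
    have Mij: "Ck_on k V (\<lambda>y. M y $ i $ j)" for i j
    proof -
      have "Ck_on k V (\<lambda>y. ?D (g y) (axis j 1))"
        by (rule Ck_on_compose[OF V S _ Suc, where g="\<lambda>x. ?D x (axis j 1)"])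
           (use gS smooth_on_frechet[OF f] in \<open>auto simp: smooth_on_def\<close>)
      then show ?thesis
        by (simp add: M_def matrix_nth Ck_on_linear_comp[OF V bounded_linear_vec_nth])
    qed
    show ?case
    proof (rule Ck_on_SucI[OF V g(1)])
      fix v
      have "Ck_on k V (\<lambda>y. \<chi> k. det (\<chi> i j. if j = k then v $ i else M y $ i $ j) / det (M y))"
      proof (rule Ck_on_vec[OF V])
        fix c
        have "Ck_on k V (\<lambda>y. if j = c then v $ i else M y $ i $ j)" for i j
          using Mij by (cases "j = c") auto
        then have "Ck_on k V (\<lambda>y. det (\<chi> i j. if j = c then v $ i else M y $ i $ j))"
          by (intro Ck_on_det V) simp
        moreover have "Ck_on k V (\<lambda>y. inverse (det (M y)))"
          by (intro Ck_on_inverse Ck_on_det V Mij dM)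
        ultimately show "Ck_on k V (\<lambda>y. (\<chi> k. det (\<chi> i j. if j = k then v $ i else M y $ i $ j) / det (M y)) $ c)"
          by (simp add: divide_inverse Ck_on_mult[OF V])
      qed
      then show "Ck_on k V (\<lambda>y. g' y v)"
        by (rule Ck_on_cong[OF V, rotated]) (simp add: g'eq)
    qed
  qed
  then have "smooth_on V g" by (simp add: smooth_on_def)
  then show ?thesis using that T V hom unfolding VT by blast
qed

text \<open>The row c is the combination of the rows of the unit matrix with coefficients c_i, so
  the transposed Cramer lemma picks out c_k.\<close>

lemma det_replace_row:
  fixes c :: "real^'n"
  shows "det (\<chi> i. if i = k then c else axis i 1 :: real^'n^'n) = c $ k"
proof -
  have "(\<chi> i. if i = k then c else axis i 1 :: real^'n^'n)
      = (\<chi> i. if i = k then (\<Sum>i\<in>UNIV. c $ i *s row i (mat 1 :: real^'n^'n)) else row i (mat 1))"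
    by (auto simp: vec_eq_iff row_def mat_def axis_def if_distrib[of "(*) _"] cong: if_cong)
  then show ?thesis using cramer_lemma_transpose[of k c "mat 1"] by simp
qed

text \<open>All rows of the Jacobian matrix except the k-th are unit vectors, hence its determinant
  is the k-th partial derivative of y.\<close>

lemma replace_coordinate_derivative:
  fixes y :: "real^'n \<Rightarrow> real" and q :: "real^'n" and c :: real and k :: 'n
  assumes S: "open S" and y: "smooth_on S y"
  defines "\<alpha> \<equiv> \<lambda>x. \<chi> i. if i = k then y x - c else x $ i - q $ i"
  shows "smooth_on S \<alpha>"
    and "x \<in> S \<Longrightarrow> det (matrix (FD \<alpha> x)) = FD y x (axis k 1)"
proof -
  show "smooth_on S \<alpha>"
  proof (rule smooth_on_vec[OF S])
    show "smooth_on S (\<lambda>x. \<alpha> x $ i)" for i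
      using y S by (cases "i = k") (auto simp: \<alpha>_def intro!: smooth_on_diff smooth_on_nth smooth_on_id)
  qed
  assume x: "x \<in> S"
  let ?D = "\<lambda>v. \<chi> i. if i = k then FD y x v else v $ i"
  have "((\<lambda>x. \<alpha> x) has_derivative ?D) (at x)"
  proof (subst has_derivative_componentwise_within, intro ballI)
    fix b :: "real^'n" assume "b \<in> Basis"
    then obtain i where b: "b = axis i 1" by (auto simp: Basis_vec_def)
    have "((\<lambda>x. x $ i - q $ i) has_derivative (\<lambda>v. v $ i)) (at x)"
      by (rule derivative_eq_intros bounded_linear.has_derivative[OF bounded_linear_vec_nth] | simp)+
    moreover have "((\<lambda>x. y x - c) has_derivative FD y x) (at x)"
      using has_derivative_diff[OF smooth_on_has_derivative[OF y x] has_derivative_const[of c]] by simp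
    ultimately show "((\<lambda>x. \<alpha> x \<bullet> b) has_derivative (\<lambda>v. ?D v \<bullet> b)) (at x)"
      by (cases "i = k") (simp_all add: b \<alpha>_def inner_axis)
  qed
  then have "FD \<alpha> x = ?D" by (rule frechet_derivative_at[symmetric])
  then have "matrix (FD \<alpha> x)
     = (\<chi> i. if i = k then (\<chi> j. FD y x (axis j 1)) else axis i 1)"
    by (auto simp: vec_eq_iff matrix_nth axis_def)
  then show "det (matrix (FD \<alpha> x)) = FD y x (axis k 1)"
    by (simp add: det_replace_row)
qed

text \<open>The map \<phi> is a composition of two changes of a single coordinate. The first,
  \<alpha>, installs y as coordinate k and has Jacobian d = dy/dx_k; the second, \<psi>, replaces
  another coordinate m by a function G whose m-th partial derivative is \<mu>/d. The product of the
  two Jacobians is \<mu>, and since m differs from k the coordinate y survives.\<close>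

lemma unimodular_coordinates:
  fixes y \<mu> :: "real^'n \<Rightarrow> real"
  assumes n: "CARD('n) \<ge> 2" and S: "open S" and p: "p \<in> S"
    and y: "smooth_on S y" and \<mu>: "smooth_on S \<mu>" and \<mu>0: "\<And>x. x \<in> S \<Longrightarrow> \<mu> x \<noteq> 0"
    and k: "FD y p (axis k 1) \<noteq> 0"
  obtains T \<phi> g where "open T" "p \<in> T" "T \<subseteq> S" "smooth_on T \<phi>" "open (\<phi> ` T)"
    "homeomorphism T (\<phi> ` T) \<phi> g" "smooth_on (\<phi> ` T) g" "\<phi> p = 0"
    "\<And>x. x \<in> T \<Longrightarrow> \<phi> x $ k = y x - y p"
    "\<And>x. x \<in> T \<Longrightarrow> det (matrix (FD \<phi> x)) = \<mu> x"
proof -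
  let ?d = "\<lambda>x. FD y x (axis k 1)"
  have cd: "continuous_on S ?d" by (rule smooth_on_continuous[OF smooth_on_frechet[OF y]])
  define S1 where "S1 = S \<inter> ?d -` (- {0})"
  have S1: "open S1" "S1 \<subseteq> S" "p \<in> S1" "\<And>x. x \<in> S1 \<Longrightarrow> ?d x \<noteq> 0"
    unfolding S1_def using continuous_open_preimage[OF cd S, of "- {0}"] p k by auto
  define \<alpha> :: "real^'n \<Rightarrow> real^'n" where "\<alpha> = (\<lambda>x. \<chi> i. if i = k then y x - y p else x $ i - p $ i)"
  have \<alpha>s: "smooth_on S1 \<alpha>" and \<alpha>d: "\<And>x. x \<in> S1 \<Longrightarrow> det (matrix (FD \<alpha> x)) = ?d x"
    unfolding \<alpha>_def
    using replace_coordinate_derivative[OF S1(1) smooth_on_subset[OF S1(2) y], where k=k and c="y p" and q=p] by auto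
  have \<alpha>p: "\<alpha> p = 0" by (simp add: \<alpha>_def vec_eq_iff)
  have "det (matrix (FD \<alpha> p)) \<noteq> 0" using \<alpha>d S1(3) k by simp
  from smooth_inverse_function[OF S1(1) \<alpha>s S1(3) this]
  obtain T1 g1 where T1: "open T1" "p \<in> T1" "T1 \<subseteq> S1" "open (\<alpha> ` T1)" and h1: "homeomorphism T1 (\<alpha> ` T1) \<alpha> g1"
    and g1: "smooth_on (\<alpha> ` T1) g1" by blast
  have "0 \<in> \<alpha> ` T1" using T1(2) \<alpha>p by force
  then obtain r where r: "r > 0" "ball 0 r \<subseteq> \<alpha> ` T1" using T1(4) open_contains_ball by blast
  let ?B = "ball (0::real^'n) r"
  have g1B: "smooth_on ?B g1" by (rule smooth_on_subset[OF r(2) g1])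
  have g1\<alpha>: "g1 (\<alpha> x) = x" if "x \<in> T1" for x using h1 that by (simp add: homeomorphism_def)
  have g1S: "g1 z \<in> S1" if "z \<in> ?B" for z
  proof -
    obtain x where "x \<in> T1" "z = \<alpha> x" using \<open>z \<in> ?B\<close> r(2) by blast
    then show ?thesis using g1\<alpha> T1(3) by auto
  qed
  \<comment> \<open>The Jacobian still missing after \<alpha>, expressed in the coordinates
    \<alpha>; \<open>g1\<close> inverts \<alpha>.\<close>
  have hs: "smooth_on ?B (\<lambda>z. \<mu> (g1 z) / ?d (g1 z))"
  proof (rule smooth_on_divide)
    show "smooth_on ?B (\<lambda>z. \<mu> (g1 z))"
      by (rule smooth_on_compose[OF _ S1(1) _ g1B smooth_on_subset[OF S1(2) \<mu>]]) (use g1S in auto)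
    show "smooth_on ?B (\<lambda>z. ?d (g1 z))"
      by (rule smooth_on_compose[OF _ S1(1) _ g1B smooth_on_subset[OF S1(2) smooth_on_frechet[OF y]]]) (use g1S in auto)
  qed (use g1S S1 in auto)
  obtain m where m: "m \<noteq> k"
  proof -
    have "\<not> UNIV \<subseteq> {k}"
      using n card_mono[of "{k}" UNIV] by auto
    then show ?thesis using that by blast
  qed
  obtain G where G: "smooth_on ?B G"
    and G': "\<And>z. z \<in> ?B \<Longrightarrow> FD G z (axis m 1) = \<mu> (g1 z) / ?d (g1 z)"
    using coordinate_primitive[OF hs] by blast
  \<comment> \<open>Subtracting G 0 makes \<psi> fix the origin, so that the final coordinates are
    centred at p.\<close>
  define \<psi> :: "real^'n \<Rightarrow> real^'n" where "\<psi> = (\<lambda>z. \<chi> i. if i = m then G z - G 0 else z $ i - (0::real^'n) $ i)"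
  have \<psi>s: "smooth_on ?B \<psi>" and \<psi>d: "\<And>z. z \<in> ?B \<Longrightarrow> det (matrix (FD \<psi> z)) = \<mu> (g1 z) / ?d (g1 z)"
    unfolding \<psi>_def using replace_coordinate_derivative[OF open_ball G, where k=m and c="G 0" and q=0] G' by auto
  have B0: "0 \<in> ?B" using r by simp
  have "det (matrix (FD \<psi> 0)) \<noteq> 0"
    using \<psi>d[OF B0] g1S[OF B0] S1 \<mu>0 by auto
  from smooth_inverse_function[OF open_ball \<psi>s B0 this]
  obtain T2 g2 where T2: "open T2" "0 \<in> T2" "T2 \<subseteq> ?B" "open (\<psi> ` T2)" and h2: "homeomorphism T2 (\<psi> ` T2) \<psi> g2"
    and g2: "smooth_on (\<psi> ` T2) g2" by blast
  define T where "T = T1 \<inter> \<alpha> -` T2"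
  define \<phi> where "\<phi> = (\<lambda>x. \<psi> (\<alpha> x))"
  define g where "g = (\<lambda>w. g1 (g2 w))"
  have TT: "T \<subseteq> T1" "T \<subseteq> S1" "T \<subseteq> S" using T1 S1 by (auto simp: T_def)
  have oT: "open T"
    unfolding T_def using smooth_on_continuous[OF smooth_on_subset[OF T1(3) \<alpha>s]] T1(1) T2(1)
    by (intro continuous_open_preimage) auto
  have \<alpha>T: "\<alpha> ` T = T2"
  proof
    show "T2 \<subseteq> \<alpha> ` T"
    proof
      fix z assume z: "z \<in> T2"
      then obtain x where "x \<in> T1" "z = \<alpha> x" using T2(3) r(2) by blast
      then show "z \<in> \<alpha> ` T" using z by (auto simp: T_def)
    qed
  qed (auto simp: T_def)
  then have \<phi>T: "\<phi> ` T = \<psi> ` T2" by (simp add: \<phi>_def image_image flip: image_image)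
  show ?thesis
  proof
    show "open T" "T \<subseteq> S" using oT TT by auto
    show "p \<in> T" using T1(2) T2(2) \<alpha>p by (simp add: T_def)
    show s\<phi>: "smooth_on T \<phi>"
      unfolding \<phi>_def
      by (rule smooth_on_compose[OF oT open_ball _ smooth_on_subset[OF TT(2) \<alpha>s] \<psi>s]) (use \<alpha>T T2 in auto)
    show "open (\<phi> ` T)" using \<phi>T T2 by simp
    have g2T: "g2 w \<in> T2" if "w \<in> \<psi> ` T2" for w using h2 that by (auto simp: homeomorphism_def)
    have T2\<alpha>: "T2 \<subseteq> \<alpha> ` T1" using T2(3) r(2) by blast
    show sg: "smooth_on (\<phi> ` T) g"
      unfolding \<phi>T g_def
      by (rule smooth_on_compose[OF T2(4) T1(4) _ g2 g1]) (use g2T T2\<alpha> in blast)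
    show "homeomorphism T (\<phi> ` T) \<phi> g"
    proof (rule homeomorphismI)
      show "continuous_on T \<phi>" "continuous_on (\<phi> ` T) g"
        using s\<phi> sg by (simp_all add: smooth_on_continuous)
      show g\<phi>: "g (\<phi> x) = x" if "x \<in> T" for x
        using that h2 g1\<alpha> by (simp add: g_def \<phi>_def homeomorphism_def T_def)
      show "\<phi> (g w) = w" if "w \<in> \<phi> ` T" for w using that g\<phi> by auto
      show "g ` \<phi> ` T \<subseteq> T" using g\<phi> by auto
    qed auto
    show "\<phi> p = 0" by (simp add: \<phi>_def \<alpha>p) (simp add: \<psi>_def vec_eq_iff)
    show "\<phi> x $ k = y x - y p" if "x \<in> T" for x
      using m by (simp add: \<phi>_def \<psi>_def \<alpha>_def)
    show "det (matrix (FD \<phi> x)) = \<mu> x" if x: "x \<in> T" for x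
    proof -
      have xB: "\<alpha> x \<in> ?B" using \<alpha>T x T2 by auto
      have da: "(\<alpha> has_derivative FD \<alpha> x) (at x)"
        using smooth_on_has_derivative[OF \<alpha>s] x TT by auto
      have dp: "(\<psi> has_derivative FD \<psi> (\<alpha> x)) (at (\<alpha> x))"
        using smooth_on_has_derivative[OF \<psi>s xB] .
      have "FD \<phi> x = (\<lambda>v. FD \<psi> (\<alpha> x) (FD \<alpha> x v))"
        unfolding \<phi>_def by (rule frechet_derivative_at[OF has_derivative_compose[OF da dp], symmetric])
      then have "matrix (FD \<phi> x) = matrix (FD \<psi> (\<alpha> x)) ** matrix (FD \<alpha> x)"
        using matrix_compose[of "FD \<alpha> x" "FD \<psi> (\<alpha> x)"]
          has_derivative_linear[OF da] has_derivative_linear[OF dp] by (simp add: o_def)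
      then show ?thesis
        using \<psi>d[OF xB] \<alpha>d[of x] x TT g1\<alpha>[of x] S1(4)[of x] by (auto simp: det_mul subset_iff)
    qed
  qed
qed

section \<open>Alternating multilinear functions\<close>

lemma scaleR_fun_apply: "(c *\<^sub>R f) x = c *\<^sub>R f x"
  by (simp add: scaleR_fun_def)

lemma sum_fun_apply: "(\<Sum>i\<in>I. f i) x = (\<Sum>i\<in>I. f i x)"
  by (induction I rule: infinite_finite_induct) simp_all

text \<open>F and the determinant respond alike to the operations that reduce a matrix to a diagonal
  one, and on a diagonal matrix linearity extracts the product of the entries. Linearity is required
  on a subspace C only, because multivectors are linear only on lists of covectors at the given
  point.\<close>

lemma alternating_det:
  fixes F :: "('n::finite \<Rightarrow> 'v::real_vector) \<Rightarrow> real"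
  assumes C: "subspace C"
    and lin: "\<And>g i w w' a b. range g \<subseteq> C \<Longrightarrow> w \<in> C \<Longrightarrow> w' \<in> C \<Longrightarrow>
      F (g(i := a *\<^sub>R w + b *\<^sub>R w')) = a * F (g(i := w)) + b * F (g(i := w'))"
    and alt: "\<And>g i j. range g \<subseteq> C \<Longrightarrow> i \<noteq> j \<Longrightarrow> g i = g j \<Longrightarrow> F g = 0"
    and d: "range d \<subseteq> C"
  shows "F (\<lambda>i. \<Sum>j\<in>UNIV. M $ i $ j *\<^sub>R d j) = det M * F d"
proof -
  have add: "F (g(i := w + w')) = F (g(i := w)) + F (g(i := w'))"
    if "range g \<subseteq> C" "w \<in> C" "w' \<in> C" for g i w w'
    using lin[OF that, of i 1 1] by simp
  have scale: "F (g(i := a *\<^sub>R w)) = a * F (g(i := w))" if "range g \<subseteq> C" "w \<in> C" for g i w a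
    using lin[OF that that(2), of i a 0] by simp
  have upd: "range (g(i := w)) \<subseteq> C" if "range g \<subseteq> C" "w \<in> C" for g :: "'n \<Rightarrow> 'v" and i w
    using that by auto
  \<comment> \<open>Polarization: F vanishes with \<open>d m + d n\<close> in both slots, and
    expanding leaves the two mixed terms, which must cancel.\<close>
  have swap: "F (d \<circ> Transposition.transpose m n) = - F d" if d: "range d \<subseteq> C" and mn: "m \<noteq> n" for d m n
  proof -
    let ?G = "\<lambda>x y. F (d(m := x, n := y))"
    have diag: "?G x x = 0" if "x \<in> C" for x
      by (rule alt[of _ m n]) (use d that mn upd in auto)
    have dm: "d m \<in> C" "d n \<in> C" using d by auto
    then have s: "d m + d n \<in> C" using C subspace_add by blast
    have 1: "?G (d m + d n) (d m + d n) = ?G (d m + d n) (d m) + ?G (d m + d n) (d n)"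
      by (rule add[OF upd[OF d s] dm])
    have 2: "?G (d m + d n) x = ?G (d m) x + ?G (d n) x" if "x \<in> C" for x
      using add[OF upd[OF d that, of n] dm, of m] by (simp only: fun_upd_twist[OF mn])
    have "?G (d m) (d n) + ?G (d n) (d m) = 0"
      using 1 2[OF dm(1)] 2[OF dm(2)] diag[OF s] diag[OF dm(1)] diag[OF dm(2)] by linarith
    moreover have "d \<circ> Transposition.transpose m n = d(m := d n, n := d m)"
      by (auto simp: fun_eq_iff Transposition.transpose_def)
    ultimately show ?thesis by (simp add: add_eq_0_iff)
  qed
  have comb: "range (\<lambda>i. \<Sum>j\<in>UNIV. M $ i $ j *\<^sub>R d j) \<subseteq> C" if "range d \<subseteq> C" for M :: "real^'n^'n" and d
    using that by (auto intro!: subspace_sum[OF C] subspace_scale[OF C])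
  \<comment> \<open>The induction over elementary operations swaps columns, that is, permutes \<open>d\<close>, so \<open>d\<close> is generalized.\<close>
  have "\<forall>d. range d \<subseteq> C \<longrightarrow> F (\<lambda>i. \<Sum>j\<in>UNIV. M $ i $ j *\<^sub>R d j) = det M * F d"
  proof (induction M rule: induct_matrix_row_operations)
    case (1 M i)
    show ?case
    proof (intro allI impI)
      fix d :: "'n \<Rightarrow> 'v" assume d: "range d \<subseteq> C"
      let ?g = "\<lambda>i. \<Sum>j\<in>UNIV. M $ i $ j *\<^sub>R d j"
      have "?g i = 0" using 1 by (simp add: row_def vec_eq_iff)
      then have "?g = ?g(i := 0 *\<^sub>R d i)" by (simp add: fun_eq_iff)
      then have "F ?g = 0" using scale[OF comb[OF d], of "d i" M i 0] d by auto
      then show "F ?g = det M * F d" using det_zero_row(1)[OF 1] by simp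
    qed
  next
    case (2 M)
    show ?case
    proof (intro allI impI)
      fix d :: "'n \<Rightarrow> 'v" assume d: "range d \<subseteq> C"
      have *: "F (\<lambda>i. if i \<in> S then c i *\<^sub>R d i else d i) = (\<Prod>i\<in>S. c i) * F d" if "finite S" for S c
        using that
      proof (induction S rule: finite_induct)
        case (insert k S)
        let ?h = "\<lambda>i. if i \<in> S then c i *\<^sub>R d i else d i"
        have h: "range ?h \<subseteq> C" using d by (auto intro: subspace_scale[OF C])
        have "(\<lambda>i. if i \<in> insert k S then c i *\<^sub>R d i else d i) = ?h(k := c k *\<^sub>R d k)"
          by (auto simp: fun_eq_iff)
        moreover have "?h(k := d k) = ?h" using insert by (auto simp: fun_eq_iff)
        ultimately show ?case using scale[OF h, of "d k" k "c k"] d insert by (auto simp: mult.assoc)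
      qed simp
      have "(\<Sum>j\<in>UNIV. M $ i $ j *\<^sub>R d j) = M $ i $ i *\<^sub>R d i" for i
      proof -
        have "(\<Sum>j\<in>UNIV. M $ i $ j *\<^sub>R d j) = (\<Sum>j\<in>UNIV. if i = j then M $ i $ j *\<^sub>R d j else 0)"
          by (rule sum.cong) (use 2[of i] in auto)
        then show ?thesis by simp
      qed
      then show "F (\<lambda>i. \<Sum>j\<in>UNIV. M $ i $ j *\<^sub>R d j) = det M * F d"
        using *[of UNIV "\<lambda>i. M $ i $ i"] by (simp add: det_diagonal[OF 2])
    qed
  next
    case (3 M m n)
    show ?case
    proof (intro allI impI)
      fix d :: "'n \<Rightarrow> 'v" assume d: "range d \<subseteq> C"
      let ?\<tau> = "Transposition.transpose m n"
      have d': "range (d \<circ> ?\<tau>) \<subseteq> C" using d by auto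
      have "(\<Sum>j\<in>UNIV. M $ i $ ?\<tau> j *\<^sub>R d j) = (\<Sum>j\<in>UNIV. M $ i $ j *\<^sub>R (d \<circ> ?\<tau>) j)" for i
        by (rule sum.reindex_bij_witness[of _ ?\<tau> ?\<tau>]) auto
      then have "F (\<lambda>i. \<Sum>j\<in>UNIV. (\<chi> i j. M $ i $ ?\<tau> j) $ i $ j *\<^sub>R d j) = det M * F (d \<circ> ?\<tau>)"
        using 3(1) d' by (simp del: o_apply)
      moreover have "det (\<chi> i j. M $ i $ ?\<tau> j) = - det M"
        using det_permute_columns[of ?\<tau> M] 3(2) by (simp add: permutes_swap_id sign_swap_id)
      ultimately show "F (\<lambda>i. \<Sum>j\<in>UNIV. (\<chi> i j. M $ i $ ?\<tau> j) $ i $ j *\<^sub>R d j) = det (\<chi> i j. M $ i $ ?\<tau> j) * F d"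
        using swap[OF d 3(2)] by simp
    qed
  next
    case (4 M m n c)
    show ?case
    proof (intro allI impI)
      fix d :: "'n \<Rightarrow> 'v" assume d: "range d \<subseteq> C"
      let ?M = "\<chi> i. if i = m then row m M + c *\<^sub>R row n M else row i M"
      let ?g = "\<lambda>i. \<Sum>j\<in>UNIV. M $ i $ j *\<^sub>R d j"
      have g: "range ?g \<subseteq> C" by (rule comb[OF d])
      then have gC: "?g i \<in> C" for i by auto
      have "(\<lambda>i. \<Sum>j\<in>UNIV. ?M $ i $ j *\<^sub>R d j) = ?g(m := 1 *\<^sub>R ?g m + c *\<^sub>R ?g n)"
        by (auto simp: fun_eq_iff row_def scaleR_add_left sum.distrib scaleR_sum_right)
      moreover have "F (?g(m := ?g n)) = 0"
        by (rule alt[OF upd[OF g gC], of m n]) (use 4(2) in auto)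
      moreover have "F (?g(m := ?g m)) = F ?g"
        by (rule arg_cong[of _ _ F]) (auto simp: fun_eq_iff)
      ultimately have "F (\<lambda>i. \<Sum>j\<in>UNIV. ?M $ i $ j *\<^sub>R d j) = F ?g"
        using lin[OF g gC[of m] gC[of n], of m 1 c] by simp
      moreover have "det ?M = det M"
        using det_row_operation[OF 4(2), of M c] unfolding scalar_mult_eq_scaleR .
      ultimately show "F (\<lambda>i. \<Sum>j\<in>UNIV. ?M $ i $ j *\<^sub>R d j) = det ?M * F d"
        using 4(1) d by simp
    qed
  qed
  then show ?thesis using d by blast
qed

text \<open>Vanishing on equal neighbours forces a sign change when neighbours are exchanged; such
  exchanges bring two equal entries next to each other. In the wedge formula only the case of equal
  neighbours can be checked without bookkeeping.\<close>

lemma adjacent_alternating: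
  fixes B :: "'v::real_vector list \<Rightarrow> real"
  assumes C: "subspace C"
    and lin: "\<And>ws w w' a b i. length ws = q \<Longrightarrow> set ws \<subseteq> C \<Longrightarrow> w \<in> C \<Longrightarrow> w' \<in> C \<Longrightarrow> i < q \<Longrightarrow>
      B (ws[i := a *\<^sub>R w + b *\<^sub>R w']) = a * B (ws[i := w]) + b * B (ws[i := w'])"
    and adj: "\<And>ws i. length ws = q \<Longrightarrow> set ws \<subseteq> C \<Longrightarrow> Suc i < q \<Longrightarrow> ws ! i = ws ! Suc i \<Longrightarrow> B ws = 0"
    and ws: "length ws = q" "set ws \<subseteq> C" "i < j" "j < q" "ws ! i = ws ! j"
  shows "B ws = 0"
proof -
  have add: "B (ws[i := w + w']) = B (ws[i := w]) + B (ws[i := w'])"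
    if "length ws = q" "set ws \<subseteq> C" "w \<in> C" "w' \<in> C" "i < q" for ws w w' i
    using lin[OF that, of 1 1] by simp
  have upd: "set (ws[i := w]) \<subseteq> C" if "set ws \<subseteq> C" "w \<in> C" for ws :: "'v list" and i w
    using that set_update_subset_insert[of ws i w] by blast
  have swap: "B (ws[i := ws ! Suc i, Suc i := ws ! i]) = - B ws"
    if ws: "length ws = q" "set ws \<subseteq> C" and i: "Suc i < q" for ws i
  proof -
    let ?G = "\<lambda>x y. B (ws[i := x, Suc i := y])"
    let ?x = "ws ! i" and ?y = "ws ! Suc i"
    have xy: "?x \<in> C" "?y \<in> C" using ws i by (auto intro!: subsetD[OF ws(2)] nth_mem)
    then have s: "?x + ?y \<in> C" using C subspace_add by blast
    have diag: "?G z z = 0" if "z \<in> C" for z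
      by (rule adj[of _ i]) (use ws i that upd in auto)
    have 1: "?G (?x + ?y) (?x + ?y) = ?G (?x + ?y) ?x + ?G (?x + ?y) ?y"
      by (rule add[OF _ upd[OF ws(2) s] xy i]) (use ws in simp)
    have 2: "?G (?x + ?y) z = ?G ?x z + ?G ?y z" if "z \<in> C" for z
    proof -
      have "B (ws[Suc i := z, i := ?x + ?y]) = B (ws[Suc i := z, i := ?x]) + B (ws[Suc i := z, i := ?y])"
        using add[OF _ upd[OF ws(2) that] xy] ws(1) i by (metis Suc_lessD length_list_update)
      then show ?thesis by (simp only: list_update_swap[of i "Suc i", OF n_not_Suc_n])
    qed
    have "?G ?x ?y + ?G ?y ?x = 0"
      using 1 2[OF xy(1)] 2[OF xy(2)] diag[OF s] diag[OF xy(1)] diag[OF xy(2)] by linarith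
    then show ?thesis by simp
  qed
  show ?thesis using ws
  proof (induction "j - Suc i" arbitrary: ws j)
    case 0
    then have "j = Suc i" by simp
    then show ?case using adj 0 by blast
  next
    case (Suc d)
    then obtain k where k: "j = Suc k" "i < k" by (cases j) auto
    let ?ws = "ws[k := ws ! Suc k, Suc k := ws ! k]"
    have "B ?ws = 0"
    proof (rule Suc.hyps(1)[of k])
      show "set ?ws \<subseteq> C"
        using Suc.prems k by (intro upd) (auto intro!: subsetD[OF Suc.prems(2)] nth_mem)
    qed (use Suc k in auto)
    then show ?case using swap[OF Suc.prems(1,2), of k] k Suc.prems by simp
  qed
qed

lemma det_row_linear:
  fixes x y :: "real^'n"
  shows "det (\<chi> i. if i = k then a *\<^sub>R x + b *\<^sub>R y else c i)
    = a * det (\<chi> i. if i = k then x else c i) + b * det (\<chi> i. if i = k then y else c i)"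
  by (simp only: det_row_add det_row_mul scalar_mult_eq_scaleR[symmetric])

subsection \<open>Tangent vectors and multivectors at a point\<close>

lemma tangent_space_subspace: "subspace (tangent_space A x)"
  by (auto simp: subspace_def tangent_space_def scaleR_fun_apply algebra_simps)

lemma cotangent_space_subspace: "subspace (cotangent_space A x)"
  by (auto simp: subspace_def cotangent_space_def scaleR_fun_apply algebra_simps)

lemma cotangent_linear:
  "w \<in> cotangent_space A x \<Longrightarrow> v \<in> tangent_space A x \<Longrightarrow> v' \<in> tangent_space A x \<Longrightarrow>
    w (a *\<^sub>R v + b *\<^sub>R v') = a * w v + b * w v'"
  by (simp add: cotangent_space_def)

lemma cotangent_zero: "w \<in> cotangent_space A x \<Longrightarrow> w 0 = 0"
  using cotangent_linear[of w A x 0 0 0 0] subspace_0[OF tangent_space_subspace, of A x] by simp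

lemma cotangent_sum:
  assumes w: "w \<in> cotangent_space A x" and v: "\<And>i. i \<in> I \<Longrightarrow> v i \<in> tangent_space A x"
  shows "w (\<Sum>i\<in>I. c i *\<^sub>R v i) = (\<Sum>i\<in>I. c i * w (v i))"
  using v
proof (induction I rule: infinite_finite_induct)
  case (insert i I)
  have "(\<Sum>i\<in>I. c i *\<^sub>R v i) \<in> tangent_space A x"
    using insert by (intro subspace_sum[OF tangent_space_subspace] subspace_scale[OF tangent_space_subspace]) auto
  then have "w (c i *\<^sub>R v i + (\<Sum>i\<in>I. c i *\<^sub>R v i)) = c i * w (v i) + w (\<Sum>i\<in>I. c i *\<^sub>R v i)"
    using insert(4)[of i] cotangent_linear[OF w, of "v i" "\<Sum>i\<in>I. c i *\<^sub>R v i" "c i" 1] by simp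
  then show ?case
    using insert by (simp only: sum.insert[OF insert.hyps(1,2)]) simp
qed (simp_all add: cotangent_zero[OF w])

lemma differential_apply: "v \<in> tangent_space A x \<Longrightarrow> differential A f x v = v f"
  by (simp add: differential_def)

lemma differential_cotangent: "differential A f x \<in> cotangent_space A x"
proof -
  have "a *\<^sub>R v + b *\<^sub>R v' \<in> tangent_space A x" if "v \<in> tangent_space A x" "v' \<in> tangent_space A x" for v v' a b
    using that by (intro subspace_add[OF tangent_space_subspace] subspace_scale[OF tangent_space_subspace])
  then show ?thesis by (simp add: cotangent_space_def differential_def scaleR_fun_apply)
qed

lemma multivectors_linear:
  "B \<in> multivectors A q x \<Longrightarrow> length ws = q \<Longrightarrow> set ws \<subseteq> cotangent_space A x \<Longrightarrow> w \<in> cotangent_space A x \<Longrightarrow>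
    w' \<in> cotangent_space A x \<Longrightarrow> i < q \<Longrightarrow> B (ws[i := a *\<^sub>R w + b *\<^sub>R w']) = a * B (ws[i := w]) + b * B (ws[i := w'])"
  by (simp add: multivectors_def)

lemma multivectors_alternating:
  "B \<in> multivectors A q x \<Longrightarrow> length ws = q \<Longrightarrow> set ws \<subseteq> cotangent_space A x \<Longrightarrow> i < j \<Longrightarrow> j < q \<Longrightarrow>
    ws ! i = ws ! j \<Longrightarrow> B ws = 0"
  unfolding multivectors_def by blast

lemma multivectors_outside:
  "B \<in> multivectors A q x \<Longrightarrow> \<not> (length ws = q \<and> set ws \<subseteq> cotangent_space A x) \<Longrightarrow> B ws = 0"
  unfolding multivectors_def by blast

lemma multivectors_subspace: "subspace (multivectors A q x)"
  by (auto simp: subspace_def multivectors_def scaleR_fun_apply algebra_simps)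

lemma wedge_zero: "wedge A q x 0 B = 0"
  unfolding wedge_def by (auto simp: fun_eq_iff cotangent_zero[OF subsetD[OF _ nth_mem]] intro!: sum.neutral)

text \<open>If two neighbouring arguments agree, the terms that omit neither of them vanish since B
  is alternating. The two remaining terms have the same covector and the same remaining list but
  opposite signs.\<close>

lemma wedge_multivectors:
  assumes B: "B \<in> multivectors A q x" and v: "v \<in> tangent_space A x"
  shows "wedge A q x v B \<in> multivectors A (Suc q) x"
proof -
  let ?C = "cotangent_space A x"
  let ?W = "wedge A q x v B"
  let ?t = "\<lambda>ws k. (- 1) ^ k * (ws ! k) v * B (take k ws @ drop (Suc k) ws)"
  have W: "?W ws = (\<Sum>k<Suc q. ?t ws k)" if "length ws = Suc q" "set ws \<subseteq> ?C" for ws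
    using that by (simp add: wedge_def)
  have upd: "set (ws[i := w]) \<subseteq> ?C" if "set ws \<subseteq> ?C" "w \<in> ?C" for ws i w
    using that set_update_subset_insert[of ws i w] by blast
  have rem: "set (take k ws @ drop (Suc k) ws) \<subseteq> ?C" if "set ws \<subseteq> ?C" for ws k
    using that by (auto dest: in_set_takeD in_set_dropD)
  have sub: "subspace ?C" by (rule cotangent_space_subspace)
  have lin: "?W (ws[i := a *\<^sub>R w + b *\<^sub>R w']) = a * ?W (ws[i := w]) + b * ?W (ws[i := w'])"
    if ws: "length ws = Suc q" "set ws \<subseteq> ?C" and w: "w \<in> ?C" "w' \<in> ?C" and i: "i < Suc q" for ws w w' a b i
  proof -
    have s: "a *\<^sub>R w + b *\<^sub>R w' \<in> ?C" using w sub by (simp add: subspace_add subspace_scale)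
    have "?t (ws[i := a *\<^sub>R w + b *\<^sub>R w']) k = a * ?t (ws[i := w]) k + b * ?t (ws[i := w']) k" if k: "k < Suc q" for k
    proof (cases "k = i")
      case True
      then show ?thesis using ws i by (simp add: scaleR_fun_apply algebra_simps)
    next
      case False
      \<comment> \<open>The position of entry i once entry k has been removed.\<close>
      define l where "l = (if i < k then i else i - 1)"
      have l: "l < q" using i k False by (auto simp: l_def)
      have r: "take k (ws[i := z]) @ drop (Suc k) (ws[i := z]) = (take k ws @ drop (Suc k) ws)[l := z]" for z
      proof (cases "i < k")
        case True
        then show ?thesis using ws k by (simp add: l_def take_update_swap list_update_append)
      next
        case F: False
        then have "drop (Suc k) (ws[i := z]) = (drop (Suc k) ws)[i - Suc k := z]"
          using False by (simp add: drop_update_swap)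
        then show ?thesis using F False ws k by (auto simp: l_def list_update_append)
      qed
      show ?thesis
        using False multivectors_linear[OF B _ rem[OF ws(2)] w l, of k a b] ws k
        by (simp add: r algebra_simps)
    qed
    then show ?thesis
      using W[of "ws[i := a *\<^sub>R w + b *\<^sub>R w']"] W[of "ws[i := w]"] W[of "ws[i := w']"] ws upd s w
      by (simp add: sum.distrib sum_distrib_left del: sum.lessThan_Suc)
  qed
  have adj: "?W ws = 0" if ws: "length ws = Suc q" "set ws \<subseteq> ?C" and i: "Suc i < Suc q" and eq: "ws ! i = ws ! Suc i" for ws i
  proof -
    have z: "?t ws k = 0" if "k < Suc q" "k \<noteq> i" "k \<noteq> Suc i" for k
    proof -
      \<comment> \<open>After the removal of entry k the equal pair is still adjacent and starts at
        l.\<close>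
      define l where "l = (if i < k then i else i - 1)"
      have "B (take k ws @ drop (Suc k) ws) = 0"
        by (rule multivectors_alternating[OF B _ rem[OF ws(2)], of _ l "Suc l"])
           (use that i ws eq in \<open>auto simp: l_def nth_append\<close>)
      then show ?thesis by simp
    qed
    have "take i ws @ drop (Suc i) ws = take (Suc i) ws @ drop (Suc (Suc i)) ws"
      using ws i eq by (simp add: take_Suc_conv_app_nth Cons_nth_drop_Suc[symmetric])
    then have p: "?t ws i + ?t ws (Suc i) = 0" using eq by simp
    have "(\<Sum>k<Suc q. ?t ws k) = (\<Sum>k\<in>{i, Suc i}. ?t ws k)"
      by (rule sum.mono_neutral_right) (use i z in auto)
    also have "\<dots> = 0" using p by simp
    finally show ?thesis using W[OF ws] by simp
  qed
  have alt: "?W ws = 0" if "length ws = Suc q" "set ws \<subseteq> ?C" "i < j" "j < Suc q" "ws ! i = ws ! j" for ws i j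
    by (rule adjacent_alternating[OF sub lin adj that])
  show ?thesis
    unfolding multivectors_def
  proof (intro CollectI conjI allI impI)
    fix ws assume "\<not> (length ws = Suc q \<and> set ws \<subseteq> ?C)"
    then show "?W ws = 0" unfolding wedge_def by (rule if_not_P)
  qed (rule lin alt; assumption)+
qed

subsection \<open>Increasing enumeration of the indices\<close>

definition index_list :: "'n::{finite, linorder} list"
  where "index_list = sorted_list_of_set UNIV"

text \<open>Inverse of the enumeration \<open>index_list\<close>. It translates between matrix
  indices of type \<open>'n\<close> and positions in argument lists, which carry the signs.\<close>

definition index_pos :: "'n::{finite, linorder} \<Rightarrow> nat"
  where "index_pos i = inv_into {..<CARD('n)} ((!) index_list) i"

lemma index_list_simps [simp]:
  "length (index_list :: 'n::{finite, linorder} list) = CARD('n)"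
  "distinct (index_list :: 'n list)" "set (index_list :: 'n list) = UNIV"
  "sorted (index_list :: 'n list)"
  by (simp_all add: index_list_def)

lemma bij_index_list: "bij_betw ((!) (index_list :: 'n::{finite, linorder} list)) {..<CARD('n)} UNIV"
  using bij_betw_nth[of "index_list :: 'n list" "{..<CARD('n)}" UNIV] by simp

lemma index_pos_less [simp]: "index_pos (i::'n::{finite, linorder}) < CARD('n)"
  unfolding index_pos_def using inv_into_into[of i "(!) (index_list :: 'n list)" "{..<CARD('n)}"] bij_index_list[where 'n='n]
  by (auto simp: bij_betw_def)

lemma index_list_pos [simp]: "index_list ! index_pos i = i"
  unfolding index_pos_def using f_inv_into_f bij_index_list by (metis UNIV_I bij_betw_imp_surj_on)

lemma index_pos_list [simp]: "k < CARD('n) \<Longrightarrow> index_pos (index_list ! k :: 'n::{finite, linorder}) = k"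
  unfolding index_pos_def using bij_betw_imp_inj_on[OF bij_index_list[where 'n='n]] by (simp add: inv_into_f_f)

lemma list_as_map_index:
  fixes ws :: "'b list"
  assumes "length ws = CARD('n::{finite, linorder})"
  shows "map (\<lambda>i::'n. ws ! index_pos i) index_list = ws"
  by (rule nth_equalityI) (use assms in auto)

lemma map_index_update:
  assumes "k < CARD('n::{finite, linorder})"
  shows "(map g (index_list :: 'n list))[k := w] = map (g(index_list ! k := w)) index_list"
  by (rule nth_equalityI) (use assms in \<open>auto simp: nth_list_update nth_eq_iff_index_eq\<close>)

text \<open>An increasing multi-index of length n - 1 misses exactly one index. Hence the
  coefficients of an (n-1)-vector are labelled by single indices, like the components of a
  covector.\<close>

lemma index_list_remove:
  fixes ks :: "'n::{finite, linorder} list"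
  assumes len: "length ks = CARD('n) - 1" and s: "sorted_wrt (<) ks"
  obtains k where "k < CARD('n)" "ks = take k index_list @ drop (Suc k) index_list"
proof -
  have d: "distinct ks" and so: "sorted ks" using s by (simp_all add: strict_sorted_iff)
  have c: "card (set ks) = CARD('n) - 1" using d len distinct_card by metis
  have "CARD('n) > 0" by simp
  then have "card (set ks) < CARD('n)" using c by linarith
  then have "set ks \<noteq> UNIV" by auto
  then obtain i where i: "i \<notin> set ks" by blast
  have "set ks = UNIV - {i}"
    by (rule card_subset_eq) (use i c in auto)
  define k where "k = index_pos i"
  have k: "k < CARD('n)" "index_list ! k = i" by (simp_all add: k_def)
  let ?l = "take k index_list @ drop (Suc k) index_list :: 'n list"
  have "index_list = take k index_list @ i # drop (Suc k) index_list"
    using id_take_nth_drop[of k "index_list :: 'n list"] k by simp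
  then have dd: "distinct (take k index_list @ i # drop (Suc k) index_list)"
    and ss: "sorted (take k index_list @ i # drop (Suc k) index_list)"
    and uu: "set (take k index_list @ i # drop (Suc k) index_list) = UNIV"
    using index_list_simps[where 'n='n] by metis+
  have "set ?l = UNIV - {i}" using dd uu by auto
  moreover have "sorted ?l" "distinct ?l" using dd ss by (auto simp: sorted_append)
  ultimately have "ks = ?l"
    using sorted_distinct_set_unique[OF so d] \<open>set ks = UNIV - {i}\<close> by simp
  then show ?thesis using that k by blast
qed

lemma index_list_remove_sorted:
  "sorted_wrt (<) (take k index_list @ drop (Suc k) index_list :: 'n::{finite, linorder} list)"
proof -
  have "sorted_wrt (<) (index_list :: 'n list)" by (simp add: strict_sorted_iff)
  then have "sorted_wrt (<) (take k index_list @ drop k index_list :: 'n list)"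
    by (simp only: append_take_drop_id)
  then have "sorted_wrt (<) (take k (index_list :: 'n list))"
    "\<forall>x\<in>set (take k index_list). \<forall>y\<in>set (drop k index_list). x < (y :: 'n)"
    unfolding sorted_wrt_append by blast+
  moreover have "set (drop (Suc k) index_list) \<subseteq> set (drop k (index_list :: 'n list))"
    by (rule set_drop_subset_set_drop) simp
  moreover have "sorted_wrt (<) (drop (Suc k) index_list :: 'n list)"
    using \<open>sorted_wrt (<) index_list\<close> by (rule sorted_wrt_drop)
  ultimately show ?thesis unfolding sorted_wrt_append by blast
qed

text \<open>Implements the convention that fields over W vanish outside W; without it the frame of a
  chart would not be an element of \<open>vector_fields A W\<close>.\<close>

definition restrict_field :: "'m set \<Rightarrow> ('m \<Rightarrow> 'v::zero) \<Rightarrow> 'm \<Rightarrow> 'v"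
  where "restrict_field W X = (\<lambda>x. if x \<in> W then X x else 0)"

lemma restrict_field_simps [simp]:
  "x \<in> W \<Longrightarrow> restrict_field W X x = X x" "x \<notin> W \<Longrightarrow> restrict_field W X x = 0"
  by (simp_all add: restrict_field_def)

section \<open>Charts and smooth functions\<close>

text \<open>\<open>is_chart\<close> only asserts that some continuous inverse exists; on the image
  it coincides with \<open>inv_into U u\<close>, the inverse used in \<open>compatible\<close> and
  \<open>smooth_fun\<close>.\<close>

lemma is_chart_D:
  assumes "is_chart (U, u)"
  shows "open U" "open (u ` U)" "inj_on u U" "continuous_on U u" "continuous_on (u ` U) (inv_into U u)"
proof -
  obtain g where g: "homeomorphism U (u ` U) u g" and o: "open U" "open (u ` U)"
    using assms by (auto simp: is_chart_def)
  show "open U" "open (u ` U)" using o by auto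
  show inj: "inj_on u U" using g by (metis homeomorphism_def inj_on_inverseI)
  show "continuous_on U u" using g by (simp add: homeomorphism_def)
  have "continuous_on (u ` U) g" using g by (simp add: homeomorphism_def)
  then show "continuous_on (u ` U) (inv_into U u)"
    by (rule continuous_on_eq) (use g inj in \<open>auto simp: homeomorphism_def\<close>)
qed

lemma is_chart_open_image:
  assumes "is_chart (U, u)" "open W" "W \<subseteq> U"
  shows "open (u ` W)"
proof -
  note c = is_chart_D[OF assms(1)]
  have "u ` W = u ` U \<inter> inv_into U u -` W"
    using assms(3) c(3) by (force simp: inv_into_f_f)
  then show ?thesis
    using continuous_open_preimage[OF c(5) c(2) assms(2)] by simp
qed

lemma is_chart_open_preimage:
  assumes "is_chart (U, u)" "open S"
  shows "open (U \<inter> u -` S)"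
  using continuous_open_preimage[OF is_chart_D(4,1)[OF assms(1)] assms(2)] .

lemma is_chart_inv_into: "is_chart (U, u) \<Longrightarrow> x \<in> U \<Longrightarrow> inv_into U u (u x) = x"
  using is_chart_D(3) inv_into_f_f by metis

locale manifold =
  fixes A :: "('m::{t2_space, second_countable_topology}, 'n::{finite, linorder}) chart set"
  assumes mfd: "smooth_manifold A"
begin

lemma atlas_chart: "(C, v) \<in> A \<Longrightarrow> is_chart (C, v)"
  using mfd by (auto simp: smooth_manifold_def)

lemma atlas_cover: obtains C v where "(C, v) \<in> A" "x \<in> C"
proof -
  have "x \<in> (\<Union>(C, v)\<in>A. C)" using mfd by (simp add: smooth_manifold_def)
  then show ?thesis using that by auto
qed

lemma smooth_fun_D:
  "smooth_fun A W f \<Longrightarrow> (C, v) \<in> A \<Longrightarrow> smooth_on (v ` (C \<inter> W)) (f \<circ> inv_into C v)"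
  by (auto simp: smooth_fun_def)

lemma smooth_fun_I:
  "(\<And>C v. (C, v) \<in> A \<Longrightarrow> smooth_on (v ` (C \<inter> W)) (f \<circ> inv_into C v)) \<Longrightarrow> smooth_fun A W f"
  by (auto simp: smooth_fun_def)

lemma open_chart_image: "(C, v) \<in> A \<Longrightarrow> open W \<Longrightarrow> open (v ` (C \<inter> W))"
  by (metis Int_lower1 atlas_chart is_chart_D(1) is_chart_open_image open_Int)

lemma smooth_fun_subset: "smooth_fun A W f \<Longrightarrow> W' \<subseteq> W \<Longrightarrow> smooth_fun A W' f"
  by (rule smooth_fun_I, rule smooth_on_subset[OF _ smooth_fun_D]) auto

lemma smooth_fun_cong:
  assumes "open W" "\<And>x. x \<in> W \<Longrightarrow> f x = g x" "smooth_fun A W f"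
  shows "smooth_fun A W g"
proof (rule smooth_fun_I)
  fix C v assume c: "(C, v) \<in> A"
  show "smooth_on (v ` (C \<inter> W)) (g \<circ> inv_into C v)"
    by (rule smooth_on_cong[OF open_chart_image[OF c assms(1)] _ smooth_fun_D[OF assms(3) c]])
       (use assms(2) is_chart_inv_into[OF atlas_chart[OF c]] in auto)
qed

lemma smooth_fun_union:
  assumes "\<And>x. x \<in> W \<Longrightarrow> \<exists>N. open N \<and> x \<in> N \<and> smooth_fun A N f"
  shows "smooth_fun A W f"
proof (rule smooth_fun_I)
  fix C v assume c: "(C, v) \<in> A"
  show "smooth_on (v ` (C \<inter> W)) (f \<circ> inv_into C v)"
  proof (rule smooth_on_union)
    fix y assume "y \<in> v ` (C \<inter> W)"
    then obtain x where x: "x \<in> C" "x \<in> W" "y = v x" by auto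
    obtain N where N: "open N" "x \<in> N" "smooth_fun A N f" using assms[OF x(2)] by blast
    then show "\<exists>T. open T \<and> y \<in> T \<and> smooth_on T (f \<circ> inv_into C v)"
      using open_chart_image[OF c N(1)] x smooth_fun_D[OF N(3) c] by blast
  qed
qed

lemma smooth_fun_const [simp]: "smooth_fun A W (\<lambda>x. c)"
  by (rule smooth_fun_I) (simp add: o_def)

lemma smooth_fun_add:
  "open W \<Longrightarrow> smooth_fun A W f \<Longrightarrow> smooth_fun A W g \<Longrightarrow> smooth_fun A W (\<lambda>x. f x + g x)"
  by (rule smooth_fun_I) (use smooth_on_add[OF open_chart_image smooth_fun_D smooth_fun_D] in \<open>simp add: o_def\<close>)

lemma smooth_fun_mult:
  "open W \<Longrightarrow> smooth_fun A W f \<Longrightarrow> smooth_fun A W g \<Longrightarrow> smooth_fun A W (\<lambda>x. f x * g x)"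
  by (rule smooth_fun_I) (use smooth_on_mult[OF open_chart_image smooth_fun_D smooth_fun_D] in \<open>simp add: o_def\<close>)

lemma smooth_fun_cmult: "open W \<Longrightarrow> smooth_fun A W f \<Longrightarrow> smooth_fun A W (\<lambda>x. c * f x)"
  by (simp add: smooth_fun_mult)

lemma smooth_fun_sum:
  "open W \<Longrightarrow> (\<And>i. i \<in> I \<Longrightarrow> smooth_fun A W (f i)) \<Longrightarrow> smooth_fun A W (\<lambda>x. \<Sum>i\<in>I. f i x)"
  by (induction I rule: infinite_finite_induct) (auto intro: smooth_fun_add)

lemma smooth_fun_det:
  fixes M :: "'m \<Rightarrow> real^'k^'k"
  assumes W: "open W" and M: "\<And>i j. smooth_fun A W (\<lambda>x. M x $ i $ j)"
  shows "smooth_fun A W (\<lambda>x. det (M x))"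
proof (rule smooth_fun_I)
  fix C v assume c: "(C, v) \<in> A"
  have "smooth_on (v ` (C \<inter> W)) (\<lambda>q. det (M (inv_into C v q)))"
    by (rule smooth_on_det[OF open_chart_image[OF c W]]) (use smooth_fun_D[OF M c] in \<open>simp add: o_def\<close>)
  then show "smooth_on (v ` (C \<inter> W)) ((\<lambda>x. det (M x)) \<circ> inv_into C v)" by (simp add: o_def)
qed

lemma smooth_atI: "open W \<Longrightarrow> x \<in> W \<Longrightarrow> smooth_fun A W f \<Longrightarrow> smooth_at A x f"
  by (auto simp: smooth_at_def)

lemma smooth_at_const [simp]: "smooth_at A x (\<lambda>y. c)"
  by (rule smooth_atI[of UNIV]) auto

lemma smooth_at_add: assumes "smooth_at A x f" "smooth_at A x g" shows "smooth_at A x (\<lambda>y. f y + g y)"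
proof -
  obtain V W where *: "open V" "x \<in> V" "smooth_fun A V f" "open W" "x \<in> W" "smooth_fun A W g"
    using assms by (auto simp: smooth_at_def)
  show ?thesis
    by (rule smooth_atI[of "V \<inter> W"]) (use * in \<open>auto intro!: smooth_fun_add intro: smooth_fun_subset\<close>)
qed

lemma smooth_at_mult: assumes "smooth_at A x f" "smooth_at A x g" shows "smooth_at A x (\<lambda>y. f y * g y)"
proof -
  obtain V W where *: "open V" "x \<in> V" "smooth_fun A V f" "open W" "x \<in> W" "smooth_fun A W g"
    using assms by (auto simp: smooth_at_def)
  show ?thesis
    by (rule smooth_atI[of "V \<inter> W"]) (use * in \<open>auto intro!: smooth_fun_mult intro: smooth_fun_subset\<close>)
qed

lemma smooth_at_sum: "(\<And>i. i \<in> I \<Longrightarrow> smooth_at A x (f i)) \<Longrightarrow> smooth_at A x (\<lambda>y. \<Sum>i\<in>I. f i y)"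
  by (induction I rule: infinite_finite_induct) (auto intro: smooth_at_add)

lemma smooth_at_cong:
  assumes "smooth_at A x f" "open W" "x \<in> W" "\<And>y. y \<in> W \<Longrightarrow> f y = g y"
  shows "smooth_at A x g"
proof -
  obtain V where *: "open V" "x \<in> V" "smooth_fun A V f"
    using assms by (auto simp: smooth_at_def)
  show ?thesis
    by (rule smooth_atI[of "V \<inter> W"])
       (use * assms in \<open>auto intro!: smooth_fun_cong[of "V \<inter> W" f g] smooth_fun_subset[of V f]\<close>)
qed

section \<open>Tangent vectors as derivations of germs\<close>

lemma tangent_linear:
  "v \<in> tangent_space A x \<Longrightarrow> smooth_at A x f \<Longrightarrow> smooth_at A x g \<Longrightarrow>
    v (\<lambda>y. a * f y + b * g y) = a * v f + b * v g"
  by (simp add: tangent_space_def)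

lemma tangent_leibniz:
  "v \<in> tangent_space A x \<Longrightarrow> smooth_at A x f \<Longrightarrow> smooth_at A x g \<Longrightarrow>
    v (\<lambda>y. f y * g y) = f x * v g + g x * v f"
  by (simp add: tangent_space_def)

text \<open>Being smooth around x depends on the germ only. Functions with the same germ are thus
  both smooth, where the germ axiom applies, or both not smooth, where v has the default value
  0.\<close>

lemma tangent_cong:
  assumes v: "v \<in> tangent_space A x" and W: "open W" "x \<in> W" "\<And>y. y \<in> W \<Longrightarrow> f y = g y"
  shows "v f = v g"
proof (cases "smooth_at A x f")
  case True
  moreover have "smooth_at A x g" using smooth_at_cong[OF True W] .
  moreover have "\<forall>f g. smooth_at A x f \<longrightarrow> smooth_at A x g \<longrightarrow>
       (\<exists>W. open W \<and> x \<in> W \<and> (\<forall>y\<in>W. f y = g y)) \<longrightarrow> v f = v g"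
    using v by (simp add: tangent_space_def)
  ultimately show ?thesis using W by blast
next
  case False
  moreover have "\<not> smooth_at A x g" using smooth_at_cong[of x g W f] W False by auto
  ultimately show ?thesis using v by (simp add: tangent_space_def)
qed

lemma tangent_nonsmooth: "v \<in> tangent_space A x \<Longrightarrow> \<not> smooth_at A x f \<Longrightarrow> v f = 0"
  by (simp add: tangent_space_def)

text \<open>The Leibniz rule for 1 = 1 * 1 gives v 1 = 2 v 1.\<close>

lemma tangent_const:
  assumes v: "v \<in> tangent_space A x"
  shows "v (\<lambda>y. c) = 0"
proof -
  have "v (\<lambda>y. 1) = 0" using tangent_leibniz[OF v, of "\<lambda>y. 1" "\<lambda>y. 1"] by simp
  then show ?thesis using tangent_linear[OF v, of "\<lambda>y. 1" "\<lambda>y. 1" c 0] by simp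
qed

lemma tangent_add:
  "v \<in> tangent_space A x \<Longrightarrow> smooth_at A x f \<Longrightarrow> smooth_at A x g \<Longrightarrow> v (\<lambda>y. f y + g y) = v f + v g"
  using tangent_linear[of v x f g 1 1] by simp

lemma tangent_diff:
  "v \<in> tangent_space A x \<Longrightarrow> smooth_at A x f \<Longrightarrow> smooth_at A x g \<Longrightarrow> v (\<lambda>y. f y - g y) = v f - v g"
  using tangent_linear[of v x f g 1 "-1"] by simp

lemma tangent_cmult: "v \<in> tangent_space A x \<Longrightarrow> smooth_at A x f \<Longrightarrow> v (\<lambda>y. c * f y) = c * v f"
  using tangent_linear[of v x f f c 0] by simp

lemma tangent_sum:
  "v \<in> tangent_space A x \<Longrightarrow> (\<And>i. i \<in> I \<Longrightarrow> smooth_at A x (f i)) \<Longrightarrow> v (\<lambda>y. \<Sum>i\<in>I. f i y) = (\<Sum>i\<in>I. v (f i))"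
proof (induction I rule: infinite_finite_induct)
  case (insert i I)
  then show ?case
    using tangent_add[of v x "f i" "\<lambda>y. \<Sum>i\<in>I. f i y"] smooth_at_sum[of I x f] by simp
qed (simp_all add: tangent_const)

lemma vector_field_tangent: "X \<in> vector_fields A W \<Longrightarrow> x \<in> W \<Longrightarrow> X x \<in> tangent_space A x"
  by (simp add: vector_fields_def)

lemma vector_field_outside: "X \<in> vector_fields A W \<Longrightarrow> x \<notin> W \<Longrightarrow> X x = 0"
  by (simp add: vector_fields_def)

lemma vector_field_smooth:
  "X \<in> vector_fields A W \<Longrightarrow> open N \<Longrightarrow> N \<subseteq> W \<Longrightarrow> smooth_fun A N f \<Longrightarrow> smooth_fun A N (\<lambda>x. X x f)"
  by (simp add: vector_fields_def)

lemma coordinate_system_atlas: "c \<in> A \<Longrightarrow> coordinate_system A c"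
  using mfd by (auto simp: coordinate_system_def smooth_manifold_def)

text \<open>Transition maps of the new chart are those of the old one composed with \<phi> or with
  its smooth inverse g. This serves both to shrink a chart, with \<phi> the identity, and to install
  the coordinates found at the end.\<close>

lemma coordinate_system_compose:
  assumes cs: "coordinate_system A (U, u)" and S: "open S" "S \<subseteq> u ` U" "open (\<phi> ` S)"
    and hom: "homeomorphism S (\<phi> ` S) \<phi> g" and sm: "smooth_on S \<phi>" "smooth_on (\<phi> ` S) g"
  shows "coordinate_system A (U \<inter> u -` S, \<phi> \<circ> u)"
proof -
  let ?W = "U \<inter> u -` S" and ?w = "\<phi> \<circ> u"
  have ch: "is_chart (U, u)" using cs by (simp add: coordinate_system_def)
  note c = is_chart_D[OF ch]
  have oW: "open ?W" by (rule is_chart_open_preimage[OF ch S(1)])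
  have uW: "u ` ?W = S" using S(2) by auto
  have img: "?w ` ?W = \<phi> ` S" using uW by (metis image_comp)
  have gS: "g q \<in> S" if "q \<in> \<phi> ` S" for q using hom that by (auto simp: homeomorphism_def)
  have g\<phi>: "g (\<phi> q) = q" if "q \<in> S" for q using hom that by (simp add: homeomorphism_def)
  have "homeomorphism ?W (?w ` ?W) ?w (inv_into U u \<circ> g)"
  proof (rule homeomorphismI)
    show "continuous_on ?W ?w"
      by (rule continuous_on_compose)
         (use continuous_on_subset[OF c(4)] uW hom in \<open>auto simp: homeomorphism_def\<close>)
    have "continuous_on (g ` \<phi> ` S) (inv_into U u)"
      by (rule continuous_on_subset[OF c(5)]) (use gS S(2) in auto)
    then show "continuous_on (?w ` ?W) (inv_into U u \<circ> g)"
      unfolding img using hom by (intro continuous_on_compose) (auto simp: homeomorphism_def)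
    show inv: "(inv_into U u \<circ> g) (?w x) = x" if "x \<in> ?W" for x
      using that g\<phi> is_chart_inv_into[OF ch] by simp
    show "?w ((inv_into U u \<circ> g) y) = y" if "y \<in> ?w ` ?W" for y
      using that inv by fastforce
    show "(inv_into U u \<circ> g) ` ?w ` ?W \<subseteq> ?W" using inv by auto
  qed auto
  then have chW: "is_chart (?W, ?w)"
    unfolding is_chart_def using oW S(3) img by auto
  have invW: "inv_into ?W ?w q = inv_into U u (g q)" if "q \<in> \<phi> ` S" for q
  proof -
    have "q \<in> ?w ` ?W" using that unfolding img .
    then obtain x where x: "q = ?w x" "x \<in> ?W" by (rule imageE)
    have "inv_into ?W ?w q = x" unfolding x(1) by (rule is_chart_inv_into[OF chW x(2)])
    moreover have "inv_into U u (g q) = x"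
      using g\<phi>[of "u x"] x(2) is_chart_inv_into[OF ch, of x] by (simp add: x(1))
    ultimately show ?thesis by simp
  qed
  have "compatible (?W, ?w) (C, v)" if c: "(C, v) \<in> A" for C v
  proof -
    have comp: "smooth_on (u ` (U \<inter> C)) (v \<circ> inv_into U u)" "smooth_on (v ` (U \<inter> C)) (u \<circ> inv_into C v)"
      using cs c by (auto simp: coordinate_system_def compatible_def)
    have chC: "is_chart (C, v)" by (rule atlas_chart[OF c])
    have o1: "open (?w ` (?W \<inter> C))"
      by (rule is_chart_open_image[OF chW]) (use oW is_chart_D(1)[OF chC] in auto)
    have o2: "open (u ` (U \<inter> C))"
      by (rule is_chart_open_image[OF ch]) (use is_chart_D(1)[OF chC] is_chart_D(1)[OF ch] in auto)
    have o3: "open (v ` (?W \<inter> C))"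
      by (rule is_chart_open_image[OF chC]) (use is_chart_D(1)[OF chC] oW in auto)
    have "smooth_on (?w ` (?W \<inter> C)) (\<lambda>q. (v \<circ> inv_into U u) (g q))"
    proof (rule smooth_on_compose[OF o1 o2 _ _ comp(1)])
      show "smooth_on (?w ` (?W \<inter> C)) g" by (rule smooth_on_subset[OF _ sm(2)]) (use img in auto)
      show "g ` ?w ` (?W \<inter> C) \<subseteq> u ` (U \<inter> C)" using g\<phi> by auto
    qed
    then have s1: "smooth_on (?w ` (?W \<inter> C)) (v \<circ> inv_into ?W ?w)"
      by (rule smooth_on_cong[OF o1, rotated]) (auto simp: invW)
    have "smooth_on (v ` (?W \<inter> C)) (\<lambda>q. \<phi> ((u \<circ> inv_into C v) q))"
    proof (rule smooth_on_compose[OF o3 S(1) _ _ sm(1)])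
      show "smooth_on (v ` (?W \<inter> C)) (u \<circ> inv_into C v)"
        by (rule smooth_on_subset[OF _ comp(2)]) auto
      show "(u \<circ> inv_into C v) ` v ` (?W \<inter> C) \<subseteq> S"
        using is_chart_inv_into[OF chC] by auto
    qed
    then have s2: "smooth_on (v ` (?W \<inter> C)) (?w \<circ> inv_into C v)" by (simp add: o_def)
    show ?thesis using s1 s2 by (simp add: compatible_def)
  qed
  then show ?thesis using chW by (auto simp: coordinate_system_def)
qed

section \<open>Iterated Lie derivatives and the bracket\<close>

lemma lie_deriv_smooth_at:
  assumes W: "open W" and X: "X \<in> vector_fields A W" and x: "x \<in> W" and f: "smooth_at A x f"
  shows "smooth_at A x (lie_deriv X f)"
proof -
  obtain N where N: "open N" "x \<in> N" "smooth_fun A N f" using f by (auto simp: smooth_at_def)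
  have "smooth_fun A (N \<inter> W) (\<lambda>y. X y f)"
    by (rule vector_field_smooth[OF X]) (use N W in \<open>auto intro: smooth_fun_subset\<close>)
  then show ?thesis unfolding lie_deriv_def using N W x by (intro smooth_atI[of "N \<inter> W"]) auto
qed

lemma smooth_at_eventually:
  assumes "smooth_at A x f"
  obtains N where "open N" "x \<in> N" "\<And>y. y \<in> N \<Longrightarrow> smooth_at A y f"
  using assms unfolding smooth_at_def by blast

context
  fixes W X Y x
  assumes W: "open W" and X: "X \<in> vector_fields A W" and Y: "Y \<in> vector_fields A W" and x: "x \<in> W"
begin

text \<open>Smoothness at x spreads to a neighbourhood, on which Y is linear at every point; X then
  sees only the germ of the result.\<close>

lemma lie_deriv_linear:
  assumes f: "smooth_at A x f" and g: "smooth_at A x g"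
  shows "X x (lie_deriv Y (\<lambda>y. a * f y + b * g y)) = a * X x (lie_deriv Y f) + b * X x (lie_deriv Y g)"
proof -
  note Xx = vector_field_tangent[OF X x]
  obtain N where N: "open N" "x \<in> N" "\<And>y. y \<in> N \<Longrightarrow> smooth_at A y f" using that by (rule smooth_at_eventually[OF f])
  obtain N' where N': "open N'" "x \<in> N'" "\<And>y. y \<in> N' \<Longrightarrow> smooth_at A y g" using that by (rule smooth_at_eventually[OF g])
  have "X x (lie_deriv Y (\<lambda>y. a * f y + b * g y)) = X x (\<lambda>y. a * lie_deriv Y f y + b * lie_deriv Y g y)"
  proof (rule tangent_cong[OF Xx])
    show "open (N \<inter> N' \<inter> W)" "x \<in> N \<inter> N' \<inter> W" using N N' W x by auto
    show "lie_deriv Y (\<lambda>y. a * f y + b * g y) y = a * lie_deriv Y f y + b * lie_deriv Y g y" if "y \<in> N \<inter> N' \<inter> W" for y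
      using that tangent_linear[OF vector_field_tangent[OF Y], of y f g a b] N(3) N'(3) by (simp add: lie_deriv_def)
  qed
  also have "\<dots> = a * X x (lie_deriv Y f) + b * X x (lie_deriv Y g)"
    by (rule tangent_linear[OF Xx]) (rule lie_deriv_smooth_at[OF W Y x] f g)+
  finally show ?thesis .
qed

text \<open>X Y is not a derivation, but its defect Y g X f + Y f X g is symmetric in X and Y and
  cancels in the bracket.\<close>

lemma lie_deriv_leibniz:
  assumes f: "smooth_at A x f" and g: "smooth_at A x g"
  shows "X x (lie_deriv Y (\<lambda>y. f y * g y))
    = f x * X x (lie_deriv Y g) + Y x g * X x f + (g x * X x (lie_deriv Y f) + Y x f * X x g)"
proof -
  note Xx = vector_field_tangent[OF X x]
  note sf = lie_deriv_smooth_at[OF W Y x f] and sg = lie_deriv_smooth_at[OF W Y x g]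
  obtain N where N: "open N" "x \<in> N" "\<And>y. y \<in> N \<Longrightarrow> smooth_at A y f" using that by (rule smooth_at_eventually[OF f])
  obtain N' where N': "open N'" "x \<in> N'" "\<And>y. y \<in> N' \<Longrightarrow> smooth_at A y g" using that by (rule smooth_at_eventually[OF g])
  have "X x (lie_deriv Y (\<lambda>y. f y * g y)) = X x (\<lambda>y. f y * lie_deriv Y g y + g y * lie_deriv Y f y)"
  proof (rule tangent_cong[OF Xx])
    show "open (N \<inter> N' \<inter> W)" "x \<in> N \<inter> N' \<inter> W" using N N' W x by auto
    show "lie_deriv Y (\<lambda>y. f y * g y) y = f y * lie_deriv Y g y + g y * lie_deriv Y f y" if "y \<in> N \<inter> N' \<inter> W" for y
      using that tangent_leibniz[OF vector_field_tangent[OF Y], of y f g] N(3) N'(3) by (simp add: lie_deriv_def)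
  qed
  also have "\<dots> = X x (\<lambda>y. f y * lie_deriv Y g y) + X x (\<lambda>y. g y * lie_deriv Y f y)"
    by (rule tangent_add[OF Xx smooth_at_mult[OF f sg] smooth_at_mult[OF g sf]])
  also have "X x (\<lambda>y. f y * lie_deriv Y g y) = f x * X x (lie_deriv Y g) + Y x g * X x f"
    using tangent_leibniz[OF Xx f sg] by (simp add: lie_deriv_def)
  also have "X x (\<lambda>y. g y * lie_deriv Y f y) = g x * X x (lie_deriv Y f) + Y x f * X x g"
    using tangent_leibniz[OF Xx g sf] by (simp add: lie_deriv_def)
  finally show ?thesis .
qed

lemma lie_deriv_cong:
  assumes N: "open N" "x \<in> N" "\<And>y. y \<in> N \<Longrightarrow> f y = g y"
  shows "X x (lie_deriv Y f) = X x (lie_deriv Y g)"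
proof (rule tangent_cong[OF vector_field_tangent[OF X x]])
  show "open (N \<inter> W)" "x \<in> N \<inter> W" using N W x by auto
  show "lie_deriv Y f y = lie_deriv Y g y" if "y \<in> N \<inter> W" for y
    unfolding lie_deriv_def
    by (rule tangent_cong[OF vector_field_tangent[OF Y] N(1)]) (use that N(3) in auto)
qed

end

lemma lie_bracket_smooth:
  "smooth_at A x f \<Longrightarrow> lie_bracket A X Y x f = X x (lie_deriv Y f) - Y x (lie_deriv X f)"
  by (simp add: lie_bracket_def)

lemma lie_bracket_tangent:
  assumes W: "open W" and X: "X \<in> vector_fields A W" and Y: "Y \<in> vector_fields A W" and x: "x \<in> W"
  shows "lie_bracket A X Y x \<in> tangent_space A x"
proof -
  have 1: "lie_bracket A X Y x (\<lambda>y. a * f y + b * g y) = a * lie_bracket A X Y x f + b * lie_bracket A X Y x g"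
    if "smooth_at A x f" "smooth_at A x g" for f g a b
    using that lie_deriv_linear[OF W X Y x that] lie_deriv_linear[OF W Y X x that]
    by (simp add: lie_bracket_smooth smooth_at_add smooth_at_mult algebra_simps)
  have 2: "lie_bracket A X Y x (\<lambda>y. f y * g y) = f x * lie_bracket A X Y x g + g x * lie_bracket A X Y x f"
    if "smooth_at A x f" "smooth_at A x g" for f g
    using that lie_deriv_leibniz[OF W X Y x that] lie_deriv_leibniz[OF W Y X x that]
    by (simp add: lie_bracket_smooth smooth_at_mult algebra_simps)
  have 3: "lie_bracket A X Y x f = lie_bracket A X Y x g"
    if "smooth_at A x f" "smooth_at A x g" "\<exists>N. open N \<and> x \<in> N \<and> (\<forall>y\<in>N. f y = g y)" for f g
    using that lie_deriv_cong[OF W X Y x, of _ f g] lie_deriv_cong[OF W Y X x, of _ f g]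
    by (auto simp: lie_bracket_smooth)
  have 4: "lie_bracket A X Y x f = 0" if "\<not> smooth_at A x f" for f
    using that by (simp add: lie_bracket_def)
  show ?thesis
    unfolding tangent_space_def using 1 2 3 4 by (intro CollectI conjI allI impI)
qed

lemma lie_bracket_outside:
  "X \<in> vector_fields A W \<Longrightarrow> Y \<in> vector_fields A W \<Longrightarrow> x \<notin> W \<Longrightarrow> lie_bracket A X Y x = 0"
  by (simp add: lie_bracket_def vector_field_outside fun_eq_iff)

lemma lie_bracket_field:
  assumes W: "open W" and X: "X \<in> vector_fields A W" and Y: "Y \<in> vector_fields A W"
  shows "lie_bracket A X Y \<in> vector_fields A W"
proof -
  have sm: "smooth_fun A N (\<lambda>x. lie_bracket A X Y x f)" if N: "open N" "N \<subseteq> W" "smooth_fun A N f" for N f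
  proof -
    have *: "smooth_fun A N (\<lambda>x. X x (lie_deriv Y f))" if X: "X \<in> vector_fields A W" and Y: "Y \<in> vector_fields A W" for X Y
      unfolding lie_deriv_def by (intro vector_field_smooth[OF X] vector_field_smooth[OF Y] N)
    have "smooth_fun A N (\<lambda>x. X x (lie_deriv Y f) + (- 1) * Y x (lie_deriv X f))"
      by (intro smooth_fun_add smooth_fun_cmult N * X Y)
    then show ?thesis
      by (rule smooth_fun_cong[OF N(1), rotated]) (simp add: lie_bracket_smooth smooth_atI[OF N(1) _ N(3)])
  qed
  show ?thesis
    unfolding vector_fields_def
    by (intro CollectI conjI ballI allI impI)
      (rule lie_bracket_tangent[OF W X Y] lie_bracket_outside[OF X Y] sm; assumption)+
qed

end

text \<open>The coordinate system is only required to be compatible with the atlas, not to belong to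
  it. All results are therefore available for the newly built coordinates too, and two charts can be
  compared by a second interpretation.\<close>

locale chart = manifold A for A :: "('m::{t2_space, second_countable_topology}, 'n::{finite, linorder}) chart set" +
  fixes U :: "'m set" and u :: "'m \<Rightarrow> (real, 'n) vec"
  assumes cs: "coordinate_system A (U, u)"
begin

abbreviation \<iota> :: "(real, 'n) vec \<Rightarrow> 'm" where "\<iota> \<equiv> inv_into U u"

abbreviation coord :: "'n \<Rightarrow> 'm \<Rightarrow> real" where "coord j \<equiv> \<lambda>y. u y $ j"

lemma ch: "is_chart (U, u)" using cs by (simp add: coordinate_system_def)

lemma openU: "open U" by (rule is_chart_D(1)[OF ch])

lemma open_image: "open W \<Longrightarrow> W \<subseteq> U \<Longrightarrow> open (u ` W)" by (rule is_chart_open_image[OF ch])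

lemma \<iota>_u [simp]: "x \<in> U \<Longrightarrow> \<iota> (u x) = x" by (rule is_chart_inv_into[OF ch])

text \<open>Smoothness is defined through all charts of the atlas; the transition maps reduce it to
  the single chart u.\<close>

lemma smooth_fun_iff:
  assumes W: "open W" "W \<subseteq> U"
  shows "smooth_fun A W f \<longleftrightarrow> smooth_on (u ` W) (f \<circ> \<iota>)"
proof
  assume f: "smooth_fun A W f"
  show "smooth_on (u ` W) (f \<circ> \<iota>)"
  proof (rule smooth_on_union)
    fix p assume "p \<in> u ` W"
    then obtain x where x: "x \<in> W" "p = u x" by auto
    obtain C v where c: "(C, v) \<in> A" "x \<in> C" by (rule atlas_cover)
    have comp: "smooth_on (u ` (U \<inter> C)) (v \<circ> \<iota>)"
      using cs c by (auto simp: coordinate_system_def compatible_def)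
    have o: "open (u ` (W \<inter> C))"
      by (rule open_image) (use W is_chart_D(1)[OF atlas_chart[OF c(1)]] in auto)
    have "smooth_on (u ` (W \<inter> C)) (\<lambda>q. (f \<circ> inv_into C v) ((v \<circ> \<iota>) q))"
    proof (rule smooth_on_compose[OF o open_chart_image[OF c(1) W(1)] _ _ smooth_fun_D[OF f c(1)]])
      show "(v \<circ> \<iota>) ` u ` (W \<inter> C) \<subseteq> v ` (C \<inter> W)" using W(2) by auto
      show "smooth_on (u ` (W \<inter> C)) (v \<circ> \<iota>)" by (rule smooth_on_subset[OF _ comp]) (use W in auto)
    qed
    then have "smooth_on (u ` (W \<inter> C)) (f \<circ> \<iota>)"
      by (rule smooth_on_cong[OF o, rotated]) (use W is_chart_inv_into[OF atlas_chart[OF c(1)]] in auto)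
    then show "\<exists>T. open T \<and> p \<in> T \<and> smooth_on T (f \<circ> \<iota>)" using o x c by blast
  qed
next
  assume f: "smooth_on (u ` W) (f \<circ> \<iota>)"
  show "smooth_fun A W f"
  proof (rule smooth_fun_I)
    fix C v assume c: "(C, v) \<in> A"
    note chC = atlas_chart[OF c]
    have comp: "smooth_on (v ` (U \<inter> C)) (u \<circ> inv_into C v)"
      using cs c by (auto simp: coordinate_system_def compatible_def)
    have "smooth_on (v ` (C \<inter> W)) (\<lambda>q. (f \<circ> \<iota>) ((u \<circ> inv_into C v) q))"
    proof (rule smooth_on_compose[OF open_chart_image[OF c W(1)] open_image[OF W] _ _ f])
      show "(u \<circ> inv_into C v) ` v ` (C \<inter> W) \<subseteq> u ` W" using is_chart_inv_into[OF chC] by auto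
      show "smooth_on (v ` (C \<inter> W)) (u \<circ> inv_into C v)" by (rule smooth_on_subset[OF _ comp]) (use W in auto)
    qed
    then show "smooth_on (v ` (C \<inter> W)) (f \<circ> inv_into C v)"
      by (rule smooth_on_cong[OF open_chart_image[OF c W(1)], rotated])
         (use W is_chart_inv_into[OF chC] in auto)
  qed
qed

lemma smooth_fun_pullback:
  assumes S: "open S" and h: "smooth_on S h"
  shows "smooth_fun A (U \<inter> u -` S) (\<lambda>x. h (u x))"
proof -
  let ?W = "U \<inter> u -` S"
  have oW: "open ?W" by (rule is_chart_open_preimage[OF ch S])
  have "smooth_on (u ` ?W) h" by (rule smooth_on_subset[OF _ h]) auto
  then have "smooth_on (u ` ?W) ((\<lambda>x. h (u x)) \<circ> \<iota>)"
    by (rule smooth_on_cong[OF open_image[OF oW Int_lower1], rotated]) auto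
  then show ?thesis using smooth_fun_iff[OF oW] by auto
qed

lemma smooth_fun_coord: "W \<subseteq> U \<Longrightarrow> smooth_fun A W (coord j)"
  using smooth_fun_pullback[OF open_UNIV smooth_on_nth[OF open_UNIV smooth_on_id[OF open_UNIV]]]
  by (auto intro: smooth_fun_subset)

lemma smooth_at_coord: "x \<in> U \<Longrightarrow> smooth_at A x (coord j)"
  by (rule smooth_atI[OF openU _ smooth_fun_coord]) auto

lemma smooth_atE:
  assumes "smooth_at A x f" "x \<in> U"
  obtains W where "open W" "x \<in> W" "W \<subseteq> U" "smooth_fun A W f" "smooth_on (u ` W) (f \<circ> \<iota>)"
proof -
  obtain V where V: "open V" "x \<in> V" "smooth_fun A V f" using assms by (auto simp: smooth_at_def)
  have W: "open (V \<inter> U)" "smooth_fun A (V \<inter> U) f"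
    using V openU by (auto intro: smooth_fun_subset)
  then show ?thesis using that[of "V \<inter> U"] V assms(2) smooth_fun_iff[OF W(1)] by auto
qed

section \<open>Coordinate frame and coframe\<close>

definition partial :: "'n \<Rightarrow> ('m \<Rightarrow> real) \<Rightarrow> 'm \<Rightarrow> real"
  where "partial j f x = FD (f \<circ> \<iota>) (u x) (axis j 1)"

text \<open>The j-th coordinate vector. The case distinction is needed because
  \<open>partial\<close> need not be zero on functions that are not smooth around x, as membership
  in \<open>tangent_space\<close> demands.\<close>

definition frame :: "'n \<Rightarrow> 'm \<Rightarrow> 'm tvec"
  where "frame j x = (\<lambda>f. if smooth_at A x f then partial j f x else 0)"

abbreviation coframe :: "'n \<Rightarrow> 'm \<Rightarrow> 'm covec"
  where "coframe j x \<equiv> differential A (coord j) x"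

lemma smooth_at_has_derivative:
  assumes "smooth_at A x f" "x \<in> U"
  shows "((f \<circ> \<iota>) has_derivative FD (f \<circ> \<iota>) (u x)) (at (u x))"
  using smooth_atE[OF assms] smooth_on_has_derivative by (metis imageI)

lemma smooth_fun_partial:
  assumes W: "open W" "W \<subseteq> U" and f: "smooth_fun A W f"
  shows "smooth_fun A W (partial j f)"
proof -
  have "smooth_on (u ` W) (\<lambda>q. FD (f \<circ> \<iota>) q (axis j 1))"
    using f smooth_fun_iff[OF W] smooth_on_frechet by blast
  then have "smooth_on (u ` W) (partial j f \<circ> \<iota>)"
    by (rule smooth_on_cong[OF open_image[OF W], rotated]) (use W in \<open>auto simp: partial_def\<close>)
  then show ?thesis using smooth_fun_iff[OF W] by simp
qed

lemma frame_smooth: "smooth_at A x f \<Longrightarrow> frame j x f = partial j f x"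
  by (simp add: frame_def)

lemma partial_coord: "x \<in> U \<Longrightarrow> partial i (coord j) x = (if i = j then 1 else 0)"
proof -
  assume x: "x \<in> U"
  have "((\<lambda>q. q $ j) has_derivative (\<lambda>v. v $ j)) (at (u x))"
    by (rule bounded_linear.has_derivative[OF bounded_linear_vec_nth has_derivative_ident])
  then have "((coord j \<circ> \<iota>) has_derivative (\<lambda>v. v $ j)) (at (u x))"
    by (rule has_derivative_transform_within_open[OF _ open_image[OF openU]]) (use x in auto)
  then have "FD (coord j \<circ> \<iota>) (u x) = (\<lambda>v. v $ j)"
    by (rule frechet_derivative_at[symmetric])
  then show ?thesis by (simp add: partial_def axis_def)
qed

lemma frame_coord: "x \<in> U \<Longrightarrow> frame i x (coord j) = (if i = j then 1 else 0)"
  by (simp add: frame_smooth smooth_at_coord partial_coord)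

lemma frame_tangent:
  assumes x: "x \<in> U"
  shows "frame j x \<in> tangent_space A x"
proof -
  let ?D = "\<lambda>f. FD (f \<circ> \<iota>) (u x)"
  have "partial j (\<lambda>y. a * f y + b * g y) x = a * partial j f x + b * partial j g x"
    if "smooth_at A x f" "smooth_at A x g" for f g a b
  proof -
    have "((\<lambda>q. a * (f \<circ> \<iota>) q + b * (g \<circ> \<iota>) q) has_derivative (\<lambda>v. a * ?D f v + b * ?D g v)) (at (u x))"
      by (intro has_derivative_add has_derivative_mult_right smooth_at_has_derivative that x)
    then have "((\<lambda>y. a * f y + b * g y) \<circ> \<iota> has_derivative (\<lambda>v. a * ?D f v + b * ?D g v)) (at (u x))"
      by (simp add: o_def)
    from fun_cong[OF frechet_derivative_at[OF this], of "axis j 1"] show ?thesis by (simp add: partial_def)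
  qed
  moreover have "partial j (\<lambda>y. f y * g y) x = f x * partial j g x + g x * partial j f x"
    if "smooth_at A x f" "smooth_at A x g" for f g
  proof -
    have "((\<lambda>q. (f \<circ> \<iota>) q * (g \<circ> \<iota>) q) has_derivative
        (\<lambda>v. (f \<circ> \<iota>) (u x) * ?D g v + ?D f v * (g \<circ> \<iota>) (u x))) (at (u x))"
      by (intro has_derivative_mult smooth_at_has_derivative that x)
    then have "((\<lambda>y. f y * g y) \<circ> \<iota> has_derivative (\<lambda>v. f x * ?D g v + ?D f v * g x)) (at (u x))"
      using x by (simp add: o_def)
    from fun_cong[OF frechet_derivative_at[OF this], of "axis j 1"] show ?thesis by (simp add: partial_def algebra_simps)
  qed
  moreover have "partial j f x = partial j g x"
    if "smooth_at A x f" "smooth_at A x g" "open W" "x \<in> W" "\<forall>y\<in>W. f y = g y" for f g W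
  proof -
    have "((g \<circ> \<iota>) has_derivative ?D f) (at (u x))"
      by (rule has_derivative_transform_within_open[OF smooth_at_has_derivative[OF that(1) x] open_image[of "W \<inter> U"]])
         (use that x openU in auto)
    from frechet_derivative_at[OF this] show ?thesis by (simp add: partial_def)
  qed
  ultimately show ?thesis
    unfolding tangent_space_def mem_Collect_eq
    by (intro conjI allI impI) (simp_all only: frame_def smooth_at_add smooth_at_mult smooth_at_const if_True if_False, blast)
qed

text \<open>By Hadamard's lemma f is a constant plus a sum of products of u_j - u_j(x) with smooth
  g_j. A derivation kills the constant, and in the Leibniz rule the factor vanishing at x leaves
  only g_j(u x) v(u_j).\<close>

lemma tangent_coord_apply:
  assumes v: "v \<in> tangent_space A x" and x: "x \<in> U" and f: "smooth_at A x f"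
  shows "v f = (\<Sum>j\<in>UNIV. v (coord j) * partial j f x)"
proof -
  obtain W where W: "open W" "x \<in> W" "W \<subseteq> U" "smooth_on (u ` W) (f \<circ> \<iota>)"
    using smooth_atE[OF f x] by metis
  have "u x \<in> u ` W" using W by auto
  then obtain r where r: "r > 0" "ball (u x) r \<subseteq> u ` W"
    using open_image[OF W(1,3)] open_contains_ball by blast
  obtain g where g: "\<And>j. smooth_on (ball (u x) r) (g j)"
    "\<And>q. q \<in> ball (u x) r \<Longrightarrow> (f \<circ> \<iota>) q = (f \<circ> \<iota>) (u x) + (\<Sum>j\<in>UNIV. (q $ j - u x $ j) * g j q)"
    "\<And>j. g j (u x) = FD (f \<circ> \<iota>) (u x) (axis j 1)"
    using that by (rule hadamard[OF smooth_on_subset[OF r(2) W(4)]])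
  let ?N = "U \<inter> u -` ball (u x) r"
  have N: "open ?N" "x \<in> ?N" using is_chart_open_preimage[OF ch] x r by auto
  have sg: "smooth_at A x (\<lambda>y. g j (u y))" for j
    by (rule smooth_atI[OF N smooth_fun_pullback[OF open_ball g(1)]])
  have sc: "smooth_at A x (\<lambda>y. u y $ j - u x $ j)" for j
    using smooth_at_add[OF smooth_at_coord[OF x] smooth_at_const, of j "- (u x $ j)"] by simp
  have ss: "smooth_at A x (\<lambda>y. \<Sum>j\<in>UNIV. (u y $ j - u x $ j) * g j (u y))"
    by (intro smooth_at_sum smooth_at_mult sg sc)
  have "v f = v (\<lambda>y. f x + (\<Sum>j\<in>UNIV. (u y $ j - u x $ j) * g j (u y)))"
  proof (rule tangent_cong[OF v N])
    fix y assume "y \<in> ?N"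
    then show "f y = f x + (\<Sum>j\<in>UNIV. (u y $ j - u x $ j) * g j (u y))"
      using g(2)[of "u y"] x by simp
  qed
  also have "\<dots> = v (\<lambda>y. \<Sum>j\<in>UNIV. (u y $ j - u x $ j) * g j (u y))"
    using tangent_add[OF v smooth_at_const ss] tangent_const[OF v] by simp
  also have "\<dots> = (\<Sum>j\<in>UNIV. v (\<lambda>y. (u y $ j - u x $ j) * g j (u y)))"
    by (rule tangent_sum[OF v smooth_at_mult[OF sc sg]])
  also have "\<dots> = (\<Sum>j\<in>UNIV. v (coord j) * partial j f x)"
  proof (rule sum.cong[OF refl])
    fix j
    have "v (\<lambda>y. (u y $ j - u x $ j) * g j (u y)) = g j (u x) * v (\<lambda>y. u y $ j - u x $ j)"
      using tangent_leibniz[OF v sc sg] by simp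
    also have "v (\<lambda>y. u y $ j - u x $ j) = v (coord j)"
      using tangent_diff[OF v smooth_at_coord[OF x] smooth_at_const] tangent_const[OF v] by simp
    finally show "v (\<lambda>y. (u y $ j - u x $ j) * g j (u y)) = v (coord j) * partial j f x"
      by (simp add: g(3) partial_def)
  qed
  finally show ?thesis .
qed

lemma tangent_expand:
  assumes v: "v \<in> tangent_space A x" and x: "x \<in> U"
  shows "v = (\<Sum>j\<in>UNIV. v (coord j) *\<^sub>R frame j x)"
proof
  fix f
  show "v f = (\<Sum>j\<in>UNIV. v (coord j) *\<^sub>R frame j x) f"
    using tangent_coord_apply[OF v x] tangent_nonsmooth[OF v]
    by (cases "smooth_at A x f") (simp_all add: sum_fun_apply scaleR_fun_apply frame_def)
qed

lemma cotangent_apply: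
  assumes w: "w \<in> cotangent_space A x" and v: "v \<in> tangent_space A x" and x: "x \<in> U"
  shows "w v = (\<Sum>j\<in>UNIV. v (coord j) * w (frame j x))"
proof -
  have "w v = w (\<Sum>j\<in>UNIV. v (coord j) *\<^sub>R frame j x)"
    by (rule arg_cong[OF tangent_expand[OF v x]])
  also have "\<dots> = (\<Sum>j\<in>UNIV. v (coord j) * w (frame j x))"
    by (rule cotangent_sum[OF w frame_tangent[OF x]])
  finally show ?thesis .
qed

lemma cotangent_expand:
  assumes w: "w \<in> cotangent_space A x" and x: "x \<in> U"
  shows "w = (\<Sum>j\<in>UNIV. w (frame j x) *\<^sub>R coframe j x)"
proof
  fix v
  show "w v = (\<Sum>j\<in>UNIV. w (frame j x) *\<^sub>R coframe j x) v"
  proof (cases "v \<in> tangent_space A x")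
    case True
    then show ?thesis
      using cotangent_apply[OF w True x]
      by (simp add: sum_fun_apply scaleR_fun_apply differential_apply mult.commute)
  next
    case False
    then show ?thesis
      using w by (simp add: sum_fun_apply scaleR_fun_apply differential_def cotangent_space_def)
  qed
qed

lemma coframe_frame: "x \<in> U \<Longrightarrow> coframe j x (frame i x) = (if i = j then 1 else 0)"
  by (simp add: differential_apply frame_tangent frame_coord)

text \<open>The set \<open>W\<close> need not lie in \<open>U\<close>: the alternative \<open>X y = 0\<close> serves for fields cut off by bump functions.\<close>

lemma vector_fieldsI:
  assumes X: "\<And>x. x \<in> W \<Longrightarrow> X x \<in> tangent_space A x" "\<And>x. x \<notin> W \<Longrightarrow> X x = 0"
    and loc: "\<And>x. x \<in> W \<Longrightarrow> \<exists>N. open N \<and> x \<in> N \<and>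
      ((\<forall>y\<in>N. X y = 0) \<or> (N \<subseteq> U \<and> (\<forall>j. smooth_fun A N (\<lambda>y. X y (coord j)))))"
  shows "X \<in> vector_fields A W"
proof -
  have "smooth_fun A W' (\<lambda>x. X x f)" if W': "open W'" "W' \<subseteq> W" "smooth_fun A W' f" for W' f
  proof (rule smooth_fun_union)
    fix x assume x: "x \<in> W'"
    then obtain N where N: "open N" "x \<in> N"
      and alt: "(\<forall>y\<in>N. X y = 0) \<or> (N \<subseteq> U \<and> (\<forall>j. smooth_fun A N (\<lambda>y. X y (coord j))))"
      using loc[OF subsetD[OF W'(2) x]] by blast
    let ?N = "N \<inter> W'"
    have oN: "open ?N" using N W' by auto
    from alt have "smooth_fun A ?N (\<lambda>x. X x f)"
    proof
      assume "\<forall>y\<in>N. X y = 0"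
      then show ?thesis using smooth_fun_cong[OF oN _ smooth_fun_const, of 0 "\<lambda>x. X x f"] by simp
    next
      assume c: "N \<subseteq> U \<and> (\<forall>j. smooth_fun A N (\<lambda>y. X y (coord j)))"
      have f: "smooth_fun A ?N f" by (rule smooth_fun_subset[OF W'(3)]) auto
      have "smooth_fun A ?N (\<lambda>y. \<Sum>j\<in>UNIV. X y (coord j) * partial j f y)"
        by (intro smooth_fun_sum smooth_fun_mult oN smooth_fun_partial f smooth_fun_subset[OF conjunct2[OF c, rule_format]])
          (use c in auto)
      then show ?thesis
      proof (rule smooth_fun_cong[OF oN, rotated])
        fix y assume y: "y \<in> ?N"
        then have "y \<in> W" "y \<in> U" "y \<in> W'" using c W'(2) by auto
        then show "(\<Sum>j\<in>UNIV. X y (coord j) * partial j f y) = X y f"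
          using tangent_coord_apply[OF X(1), of y f] smooth_atI[OF W'(1) _ W'(3), of y] by simp
      qed
    qed
    then show "\<exists>N. open N \<and> x \<in> N \<and> smooth_fun A N (\<lambda>x. X x f)" using oN N x by blast
  qed
  then show ?thesis using X by (auto simp: vector_fields_def)
qed

lemma frame_field:
  assumes W: "open W" "W \<subseteq> U"
  shows "restrict_field W (frame j) \<in> vector_fields A W"
proof (rule vector_fieldsI)
  have "smooth_fun A W (\<lambda>y. restrict_field W (frame j) y (coord i))" for i
    by (rule smooth_fun_cong[OF W(1) _ smooth_fun_const[of _ "if j = i then 1 else 0"]])
       (use W in \<open>auto simp: frame_coord\<close>)
  then show "\<exists>N. open N \<and> x \<in> N \<and> ((\<forall>y\<in>N. restrict_field W (frame j) y = 0) \<or>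
      (N \<subseteq> U \<and> (\<forall>i. smooth_fun A N (\<lambda>y. restrict_field W (frame j) y (coord i)))))" if "x \<in> W" for x
    using that W by blast
qed (use W frame_tangent in auto)

lemma one_forms_frame_smooth:
  assumes W: "open W" "W \<subseteq> U" "W \<subseteq> G" and w: "w \<in> one_forms A G"
  shows "smooth_fun A W (\<lambda>x. w x (frame j x))"
proof -
  have "smooth_fun A W (\<lambda>x. w x (restrict_field W (frame j) x))"
    using w frame_field[OF W(1,2)] W by (auto simp: one_forms_def)
  then show ?thesis by (rule smooth_fun_cong[OF W(1), rotated]) auto
qed

lemma one_formsI:
  assumes W: "open W" "W \<subseteq> U" and w: "\<And>x. x \<in> W \<Longrightarrow> w x \<in> cotangent_space A x" "\<And>x. x \<notin> W \<Longrightarrow> w x = 0"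
    and sm: "\<And>j. smooth_fun A W (\<lambda>x. w x (frame j x))"
  shows "w \<in> one_forms A W"
proof -
  have "smooth_fun A N (\<lambda>x. w x (X x))" if N: "open N" "N \<subseteq> W" and X: "X \<in> vector_fields A N" for N X
  proof -
    have "smooth_fun A N (\<lambda>x. \<Sum>j\<in>UNIV. X x (coord j) * w x (frame j x))"
      by (intro smooth_fun_sum smooth_fun_mult N vector_field_smooth[OF X] order_refl smooth_fun_coord
          smooth_fun_subset[OF sm]) (use N W in auto)
    then show ?thesis
    proof (rule smooth_fun_cong[OF N(1), rotated])
      fix x assume x: "x \<in> N"
      then have "x \<in> W" "x \<in> U" using N W by auto
      then show "(\<Sum>j\<in>UNIV. X x (coord j) * w x (frame j x)) = w x (X x)"
        using cotangent_apply[OF w(1) vector_field_tangent[OF X x]] by simp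
    qed
  qed
  then show ?thesis using w by (auto simp: one_forms_def)
qed

lemma coframe_field:
  assumes W: "open W" "W \<subseteq> U"
  shows "restrict_field W (coframe j) \<in> one_forms A W"
proof (rule one_formsI[OF W])
  show "smooth_fun A W (\<lambda>x. restrict_field W (coframe j) x (frame i x))" for i
    by (rule smooth_fun_cong[OF W(1) _ smooth_fun_const[of _ "if i = j then 1 else 0"]])
       (use W in \<open>auto simp: coframe_frame\<close>)
qed (use differential_cotangent in auto)

subsection \<open>Top multivectors\<close>

text \<open>The wedge product of the frame vectors in increasing order, evaluated as the determinant
  of the pairings of the arguments with the frame.\<close>

definition vol :: "'m \<Rightarrow> 'm mvec"
  where "vol x = (\<lambda>ws. if length ws = CARD('n) \<and> set ws \<subseteq> cotangent_space A x
    then det (\<chi> i j. (ws ! index_pos i) (frame j x) :: ((real, 'n) vec, 'n) vec) else 0)"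

abbreviation coframe_list :: "'m \<Rightarrow> 'm covec list"
  where "coframe_list x \<equiv> map (\<lambda>i. coframe i x) index_list"

lemma vol_coframe: "x \<in> U \<Longrightarrow> vol x (coframe_list x) = 1"
proof -
  assume x: "x \<in> U"
  have "(\<chi> i j. (coframe_list x ! index_pos i) (frame j x)) = (mat 1 :: ((real, 'n) vec, 'n) vec)"
    using x by (auto simp: vec_eq_iff mat_def coframe_frame)
  then show ?thesis by (auto simp: vol_def differential_cotangent)
qed

lemma vol_multivector: "vol x \<in> multivectors A CARD('n) x"
proof -
  let ?C = "cotangent_space A x"
  let ?row = "\<lambda>w. \<chi> j. w (frame j x) :: (real, 'n) vec"
  have v: "vol x ws = det (\<chi> i. ?row (ws ! index_pos i) :: ((real, 'n) vec, 'n) vec)" if "length ws = CARD('n)" "set ws \<subseteq> ?C" for ws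
    using that by (simp add: vol_def)
  have upd: "set (ws[i := w]) \<subseteq> ?C" if "set ws \<subseteq> ?C" "w \<in> ?C" for ws i w
    using that set_update_subset_insert[of ws i w] by blast
  have vu: "vol x (ws[k := w]) = det (\<chi> i. if i = index_list ! k then ?row w else ?row (ws ! index_pos i) :: ((real, 'n) vec, 'n) vec)"
    if "length ws = CARD('n)" "set ws \<subseteq> ?C" "w \<in> ?C" "k < CARD('n)" for ws w k
  proof -
    have "ws[k := w] ! index_pos i = (if i = index_list ! k then w else ws ! index_pos i)" for i :: 'n
      using that by (auto simp: nth_list_update)
    then have "(\<chi> i. ?row (ws[k := w] ! index_pos i)) = (\<chi> i. if i = index_list ! k then ?row w else ?row (ws ! index_pos i) :: ((real, 'n) vec, 'n) vec)"
      by (simp add: vec_eq_iff)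
    then show ?thesis using v[of "ws[k := w]"] upd that by simp
  qed
  have "vol x (ws[k := a *\<^sub>R w + b *\<^sub>R w']) = a * vol x (ws[k := w]) + b * vol x (ws[k := w'])"
    if "length ws = CARD('n)" "set ws \<subseteq> ?C" "w \<in> ?C" "w' \<in> ?C" "k < CARD('n)" for ws w w' a b k
  proof -
    have "a *\<^sub>R w + b *\<^sub>R w' \<in> ?C"
      using that by (intro subspace_add subspace_scale cotangent_space_subspace)
    moreover have "?row (a *\<^sub>R w + b *\<^sub>R w') = a *\<^sub>R ?row w + b *\<^sub>R ?row w'"
      by (simp add: vec_eq_iff scaleR_fun_apply)
    ultimately show ?thesis using that by (simp only: vu det_row_linear)
  qed
  moreover have "vol x ws = 0"
    if "length ws = CARD('n)" "set ws \<subseteq> ?C" "i < j" "j < CARD('n)" "ws ! i = ws ! j" for ws i j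
  proof -
    have "det (\<chi> i. ?row (ws ! index_pos i) :: ((real, 'n) vec, 'n) vec) = 0"
    proof (rule det_identical_rows)
      show "index_list ! i \<noteq> (index_list ! j :: 'n)" using that by (simp add: nth_eq_iff_index_eq)
      have "i < CARD('n)" using that by simp
      then show "row (index_list ! i :: 'n) (\<chi> i. ?row (ws ! index_pos i)) = row (index_list ! j :: 'n) (\<chi> i. ?row (ws ! index_pos i))"
        using that by (simp add: row_def)
    qed
    then show ?thesis using v that by simp
  qed
  moreover have "vol x ws = 0" if "\<not> (length ws = CARD('n) \<and> set ws \<subseteq> ?C)" for ws
    unfolding vol_def using that by (rule if_not_P)
  ultimately show ?thesis unfolding multivectors_def by (intro CollectI conjI allI impI)
qed

text \<open>Expressing the arguments in the coframe turns B into the determinant of their components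
  times its value on the coframe, by \<open>alternating_det\<close>: the top exterior power is a
  line.\<close>

lemma top_expand:
  assumes B: "B \<in> multivectors A CARD('n) x" and x: "x \<in> U"
  shows "B = B (coframe_list x) *\<^sub>R vol x"
proof
  fix ws
  let ?C = "cotangent_space A x"
  show "B ws = (B (coframe_list x) *\<^sub>R vol x) ws"
  proof (cases "length ws = CARD('n) \<and> set ws \<subseteq> ?C")
    case False
    then show ?thesis
      using multivectors_outside[OF B False] multivectors_outside[OF vol_multivector False] by (simp add: scaleR_fun_apply)
  next
    case True
    let ?M = "\<chi> i j. (ws ! index_pos i) (frame j x) :: ((real, 'n) vec, 'n) vec"
    let ?F = "\<lambda>g. B (map g (index_list :: 'n list))"
    have wsC: "ws ! index_pos i \<in> ?C" for i :: 'n using True by (auto intro!: subsetD[OF conjunct2[OF True]] nth_mem)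
    have "?F (\<lambda>i. \<Sum>j\<in>UNIV. ?M $ i $ j *\<^sub>R coframe j x) = det ?M * ?F (\<lambda>i. coframe i x)"
    proof (rule alternating_det[OF cotangent_space_subspace[of A x]])
      fix g :: "'n \<Rightarrow> 'm covec" and i w w' a b
      assume g: "range g \<subseteq> ?C" and w: "w \<in> ?C" "w' \<in> ?C"
      have gs: "set (map g index_list) \<subseteq> ?C" using g by auto
      show "?F (g(i := a *\<^sub>R w + b *\<^sub>R w')) = a * ?F (g(i := w)) + b * ?F (g(i := w'))"
        using multivectors_linear[OF B _ gs w, of "index_pos i" a b]
        by (simp add: map_index_update)
    next
      fix g :: "'n \<Rightarrow> 'm covec" and i j :: 'n
      assume g: "range g \<subseteq> ?C" and ij: "i \<noteq> j" "g i = g j"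
      have gs: "set (map g index_list) \<subseteq> ?C" using g by auto
      have *: "B (map g index_list) = 0" if "g i = g j" "index_pos i < index_pos j" for i j
        by (rule multivectors_alternating[OF B _ gs that(2)]) (use that in auto)
      have "index_pos i \<noteq> index_pos j" using ij by (metis index_list_pos)
      then show "?F g = 0" using *[of i j] *[of j i] ij by (metis linorder_neqE_nat)
    qed (use differential_cotangent in auto)
    moreover have "(\<Sum>j\<in>UNIV. ?M $ i $ j *\<^sub>R coframe j x) = ws ! index_pos i" for i
      using cotangent_expand[OF wsC x, of i] by simp
    moreover have "map (\<lambda>i::'n. ws ! index_pos i) index_list = ws"
      using list_as_map_index True by blast
    ultimately have "B ws = det ?M * B (coframe_list x)" by simp
    then show ?thesis using True by (simp add: scaleR_fun_apply vol_def)
  qed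
qed

text \<open>The alternative E y = 0 lets W exceed the chart, as required for a volume element that
  is cut off and extended by zero.\<close>

lemma top_fieldsI:
  assumes E: "\<And>x. x \<in> W \<Longrightarrow> E x \<in> multivectors A CARD('n) x" "\<And>x. x \<notin> W \<Longrightarrow> E x = 0"
    and loc: "\<And>x. x \<in> W \<Longrightarrow> \<exists>N. open N \<and> x \<in> N \<and>
      ((\<forall>y\<in>N. E y = 0) \<or> (N \<subseteq> U \<and> smooth_fun A N (\<lambda>y. E y (coframe_list y))))"
  shows "E \<in> multivector_fields A CARD('n) W"
proof -
  have "smooth_fun A W' (\<lambda>x. E x (map (\<lambda>w. w x) ws))"
    if W': "open W'" "W' \<subseteq> W" and ws: "length ws = CARD('n)" "set ws \<subseteq> one_forms A W'" for W' ws
  proof (rule smooth_fun_union)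
    fix x assume x: "x \<in> W'"
    then obtain N where N: "open N" "x \<in> N"
      and alt: "(\<forall>y\<in>N. E y = 0) \<or> (N \<subseteq> U \<and> smooth_fun A N (\<lambda>y. E y (coframe_list y)))"
      using loc[OF subsetD[OF W'(2) x]] by blast
    let ?N = "N \<inter> W'"
    have oN: "open ?N" using N W' by auto
    from alt have "smooth_fun A ?N (\<lambda>x. E x (map (\<lambda>w. w x) ws))"
    proof
      assume "\<forall>y\<in>N. E y = 0"
      then show ?thesis using smooth_fun_cong[OF oN _ smooth_fun_const, of 0 "\<lambda>x. E x (map (\<lambda>w. w x) ws)"] by simp
    next
      assume c: "N \<subseteq> U \<and> smooth_fun A N (\<lambda>y. E y (coframe_list y))"
      let ?M = "\<lambda>y. \<chi> i j. (ws ! index_pos i) y (frame j y) :: ((real, 'n) vec, 'n) vec"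
      have "smooth_fun A ?N (\<lambda>y. (ws ! index_pos i) y (frame j y))" for i j :: 'n
        by (rule one_forms_frame_smooth[OF oN, where G=W']) (use c ws in auto)
      then have "smooth_fun A ?N (\<lambda>y. E y (coframe_list y) * det (?M y))"
        by (intro smooth_fun_mult oN smooth_fun_det smooth_fun_subset[OF conjunct2[OF c]]) auto
      then show ?thesis
      proof (rule smooth_fun_cong[OF oN, rotated])
        fix y assume y: "y \<in> ?N"
        have wsy: "set (map (\<lambda>w. w y) ws) \<subseteq> cotangent_space A y"
          using ws(2) y by (auto simp: one_forms_def)
        have "y \<in> W" "y \<in> U" using y c W'(2) by auto
        from fun_cong[OF top_expand[OF E(1)[OF this(1)] this(2)], of "map (\<lambda>w. w y) ws"]
        have "E y (map (\<lambda>w. w y) ws) = E y (coframe_list y) * vol y (map (\<lambda>w. w y) ws)"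
          by (simp add: scaleR_fun_apply)
        also have "vol y (map (\<lambda>w. w y) ws) = det (?M y)"
          using wsy ws(1) by (simp add: vol_def)
        finally show "E y (coframe_list y) * det (?M y) = E y (map (\<lambda>w. w y) ws)" by simp
      qed
    qed
    then show "\<exists>N. open N \<and> x \<in> N \<and> smooth_fun A N (\<lambda>x. E x (map (\<lambda>w. w x) ws))" using oN N x by blast
  qed
  then show ?thesis using E by (auto simp: multivector_fields_def)
qed

lemma multivector_field_coframe_smooth:
  assumes W: "open W" "W \<subseteq> U" "W \<subseteq> G" and B: "B \<in> multivector_fields A q G" and ks: "length ks = q"
  shows "smooth_fun A W (\<lambda>x. B x (map (\<lambda>i. coframe i x) ks))"
proof -
  have all: "\<forall>W ws. open W \<longrightarrow> W \<subseteq> G \<longrightarrow> length ws = q \<longrightarrow> set ws \<subseteq> one_forms A W \<longrightarrow>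
      smooth_fun A W (\<lambda>x. B x (map (\<lambda>w. w x) ws))"
    using B by (simp add: multivector_fields_def)
  have "smooth_fun A W (\<lambda>x. B x (map (\<lambda>w. w x) (map (\<lambda>i. restrict_field W (coframe i)) ks)))"
    by (rule all[rule_format]) (use W ks coframe_field[OF W(1,2)] in auto)
  then show ?thesis
    by (rule smooth_fun_cong[OF W(1), rotated]) (simp add: o_def)
qed

text \<open>The covector \<open>\<beta>\<close> with \<open>v \<and> B = \<beta>(v) vol\<close>.\<close>

definition codual :: "'m mvec \<Rightarrow> 'm \<Rightarrow> 'm covec"
  where "codual B x = (\<Sum>i\<in>UNIV. ((- 1) ^ index_pos i *
    B (map (\<lambda>i. coframe i x) (take (index_pos i) index_list @ drop (Suc (index_pos i)) index_list))) *\<^sub>R coframe i x)"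

lemma codual_cotangent: "codual B x \<in> cotangent_space A x"
  unfolding codual_def
  by (intro subspace_sum subspace_scale cotangent_space_subspace differential_cotangent)

lemma codual_frame:
  "x \<in> U \<Longrightarrow> codual B x (frame i x) = (- 1) ^ index_pos i *
    B (map (\<lambda>i. coframe i x) (take (index_pos i) index_list @ drop (Suc (index_pos i)) index_list))"
  by (simp add: codual_def sum_fun_apply scaleR_fun_apply coframe_frame if_distrib[of "(*) _"] cong: if_cong)

lemma codual_smooth:
  assumes W: "open W" "W \<subseteq> U" "W \<subseteq> G" and B: "B \<in> multivector_fields A (CARD('n) - 1) G"
  shows "smooth_fun A W (\<lambda>x. codual (B x) x (frame i x))"
proof -
  have len: "index_pos i + (CARD('n) - Suc (index_pos i)) = CARD('n) - Suc 0"
    using index_pos_less[of i] by arith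
  have "smooth_fun A W (\<lambda>x. (- 1) ^ index_pos i *
    B x (map (\<lambda>i. coframe i x) (take (index_pos i) index_list @ drop (Suc (index_pos i)) index_list)))"
    by (intro smooth_fun_cmult W(1) multivector_field_coframe_smooth[OF W B]) (simp add: len)
  then show ?thesis
    by (rule smooth_fun_cong[OF W(1), rotated]) (use W codual_frame in auto)
qed

text \<open>Both sides lie in the line of top multivectors, so it is enough to evaluate them on the
  coframe; there the terms of the wedge formula are those in the definition of
  \<open>codual\<close>.\<close>

lemma wedge_codual:
  assumes B: "B \<in> multivectors A (CARD('n) - 1) x" and x: "x \<in> U" and v: "v \<in> tangent_space A x"
  shows "wedge A (CARD('n) - 1) x v B = codual B x v *\<^sub>R vol x"
proof -
  let ?q = "CARD('n) - 1"
  have q: "Suc ?q = CARD('n)" by simp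
  have top: "wedge A ?q x v B \<in> multivectors A CARD('n) x"
    using wedge_multivectors[OF B v] by simp
  have "set (coframe_list x) \<subseteq> cotangent_space A x"
    by (auto simp: differential_cotangent)
  then have "wedge A ?q x v B (coframe_list x) =
      (\<Sum>k<CARD('n). (- 1) ^ k * (coframe_list x ! k) v * B (take k (coframe_list x) @ drop (Suc k) (coframe_list x)))"
    unfolding wedge_def q by simp
  also have "\<dots> = (\<Sum>i\<in>UNIV. (- 1) ^ index_pos i * coframe i x v *
      B (map (\<lambda>i. coframe i x) (take (index_pos i) index_list @ drop (Suc (index_pos i)) index_list)))"
    by (rule sum.reindex_bij_witness[of _ index_pos "(!) index_list"]) (auto simp: take_map drop_map)
  also have "\<dots> = codual B x v"
    by (simp add: codual_def sum_fun_apply scaleR_fun_apply mult_ac)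
  finally show ?thesis using top_expand[OF top x] by simp
qed

text \<open>Fewer than n covectors do not span, so some coordinate vector is orthogonal to all of
  them. The covector w witnesses that v is nonzero.\<close>

lemma annihilated_vector:
  assumes ws: "length ws < CARD('n)" "set ws \<subseteq> cotangent_space A x" and x: "x \<in> U"
  obtains v w where "v \<in> tangent_space A x" "\<And>w'. w' \<in> set ws \<Longrightarrow> w' v = 0" "w \<in> cotangent_space A x" "w v = 1"
proof -
  let ?a = "\<lambda>w. \<chi> j. w (frame j x) :: (real, 'n) vec"
  have "dim (?a ` set ws) \<le> card (?a ` set ws)" by (rule dim_le_card') simp
  also have "\<dots> \<le> length ws" using card_image_le[of "set ws" ?a] card_length[of ws] by simp
  also have "\<dots> < DIM((real, 'n) vec)" using ws by simp
  finally obtain y :: "(real, 'n) vec" where y: "y \<noteq> 0" "\<And>z. z \<in> span (?a ` set ws) \<Longrightarrow> orthogonal y z"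
    using orthogonal_to_subspace_exists by blast
  define v where "v = (\<Sum>j\<in>UNIV. y $ j *\<^sub>R frame j x)"
  have v: "v \<in> tangent_space A x"
    unfolding v_def by (intro subspace_sum subspace_scale tangent_space_subspace frame_tangent[OF x])
  have wv: "w' v = (\<Sum>j\<in>UNIV. y $ j * w' (frame j x))" if "w' \<in> cotangent_space A x" for w'
    unfolding v_def by (rule cotangent_sum[OF that frame_tangent[OF x]])
  have "w' v = 0" if "w' \<in> set ws" for w'
  proof -
    have "orthogonal y (?a w')" using y(2) that by (simp add: span_base)
    then have "(\<Sum>j\<in>UNIV. y $ j * w' (frame j x)) = 0" by (simp add: orthogonal_def inner_vec_def)
    then show ?thesis using wv that ws by auto
  qed
  moreover obtain j where j: "y $ j \<noteq> 0" using y(1) by (auto simp: vec_eq_iff)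
  define w where "w = (1 / y $ j) *\<^sub>R coframe j x"
  have w: "w \<in> cotangent_space A x"
    unfolding w_def by (intro subspace_scale cotangent_space_subspace differential_cotangent)
  moreover have "w v = 1"
    unfolding wv[OF w] using j x
    by (simp add: w_def scaleR_fun_apply coframe_frame if_distrib[of "(*) _"] cong: if_cong)
  ultimately show ?thesis using that v by blast
qed

text \<open>This expands (v \<and> B)(w, ws) along its arguments; assumption \<open>z\<close>
  removes every term except the one omitting w. It is applied when v is annihilated by all of ws,
  and when B is annihilated by w.\<close>

lemma codual_eval:
  assumes B: "B \<in> multivectors A (CARD('n) - 1) x" and x: "x \<in> U" and v: "v \<in> tangent_space A x"
    and ws: "length ws = CARD('n) - 1" "set ws \<subseteq> cotangent_space A x" and w: "w \<in> cotangent_space A x"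
    and z: "\<And>k. k < length ws \<Longrightarrow> (ws ! k) v * B (w # take k ws @ drop (Suc k) ws) = 0"
  shows "w v * B ws = codual B x v * vol x (w # ws)"
proof -
  have "codual B x v * vol x (w # ws) = wedge A (CARD('n) - 1) x v B (w # ws)"
    using wedge_codual[OF B x v] by (simp add: scaleR_fun_apply)
  also have "\<dots> = (\<Sum>k<Suc (CARD('n) - 1). (- 1) ^ k * ((w # ws) ! k) v * B (take k (w # ws) @ drop (Suc k) (w # ws)))"
    using ws w unfolding wedge_def by (simp del: sum.lessThan_Suc)
  also have "\<dots> = w v * B ws + (\<Sum>k<CARD('n) - 1. (- 1) ^ Suc k * (ws ! k) v * B (w # take k ws @ drop (Suc k) ws))"
    by (simp only: sum.lessThan_Suc_shift) simp
  also have "(\<Sum>k<CARD('n) - 1. (- 1) ^ Suc k * (ws ! k) v * B (w # take k ws @ drop (Suc k) ws)) = 0"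
    by (rule sum.neutral) (use z ws in \<open>auto simp: mult.assoc\<close>)
  finally show ?thesis by simp
qed

text \<open>Each value of B is a multiple of a value of its covector at a vector killed by all
  arguments. Hence B vanishes with \<open>codual\<close>, and also as soon as \<open>codual\<close>
  is proportional to one of the arguments.\<close>

lemma multivector_from_codual:
  assumes B: "B \<in> multivectors A (CARD('n) - 1) x" and x: "x \<in> U"
    and ws: "length ws = CARD('n) - 1" "set ws \<subseteq> cotangent_space A x"
  obtains v c where "v \<in> tangent_space A x" "\<And>w'. w' \<in> set ws \<Longrightarrow> w' v = 0" "B ws = codual B x v * c"
proof -
  have "CARD('n) - 1 < CARD('n)" by simp
  then obtain v w where vw: "v \<in> tangent_space A x" "\<And>w'. w' \<in> set ws \<Longrightarrow> w' v = 0" "w \<in> cotangent_space A x" "w v = 1"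
    using annihilated_vector[of ws x] ws x by metis
  then have "w v * B ws = codual B x v * vol x (w # ws)"
    by (intro codual_eval[OF B x _ ws]) auto
  then show ?thesis using that vw by auto
qed

lemma codual_nonzero:
  assumes B: "B \<in> multivectors A (CARD('n) - 1) x" and x: "x \<in> U" and nz: "B \<noteq> 0"
  shows "codual B x \<noteq> 0"
proof
  assume z: "codual B x = 0"
  have "B ws = 0" for ws
  proof (cases "length ws = CARD('n) - 1 \<and> set ws \<subseteq> cotangent_space A x")
    case True
    then show ?thesis using multivector_from_codual[OF B x, of ws] z by (metis mult_zero_left zero_fun_apply)
  qed (rule multivectors_outside[OF B])
  then show False using nz by (simp add: fun_eq_iff)
qed

lemma codual_component:
  assumes "B \<in> multivectors A (CARD('n) - 1) x" "x \<in> U" "B \<noteq> 0"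
  obtains i where "codual B x (frame i x) \<noteq> 0"
  using codual_nonzero[OF assms] cotangent_expand[OF codual_cotangent assms(2), of B]
  by (metis (no_types, lifting) scaleR_zero_left sum.neutral)

lemma pfaffian_span:
  assumes B: "B \<in> multivectors A (CARD('n) - 1) x" and x: "x \<in> U" and nz: "B \<noteq> 0"
  shows "{w \<in> cotangent_space A x. contract w B = 0} = span {codual B x}"
proof
  show "span {codual B x} \<subseteq> {w \<in> cotangent_space A x. contract w B = 0}"
  proof
    fix w assume "w \<in> span {codual B x}"
    then obtain c where w: "w = c *\<^sub>R codual B x" by (auto simp: span_singleton)
    have wC: "w \<in> cotangent_space A x"
      unfolding w by (intro subspace_scale cotangent_space_subspace codual_cotangent)
    have "B (w # ws) = 0" for ws
    proof (cases "length (w # ws) = CARD('n) - 1 \<and> set (w # ws) \<subseteq> cotangent_space A x")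
      case True
      obtain v d where v: "\<And>w'. w' \<in> set (w # ws) \<Longrightarrow> w' v = 0" "B (w # ws) = codual B x v * d"
        using multivector_from_codual[OF B x, of "w # ws"] True by metis
      show ?thesis
      \<comment> \<open>For w = 0 the equation w v = 0 says nothing about \<open>codual\<close>, and
        linearity of B is used instead.\<close>
      proof (cases "c = 0")
        case True
        have "B (w # ws) = B ((w # ws)[0 := 0 *\<^sub>R w + 0 *\<^sub>R w])" using w True by simp
        also have "\<dots> = 0"
        proof -
          have len: "length (w # ws) = CARD('n) - 1" "set (w # ws) \<subseteq> cotangent_space A x"
            using \<open>length (w # ws) = _ \<and> _\<close> by auto
          then have "0 < CARD('n) - 1" by (metis length_Cons zero_less_Suc)
          then show ?thesis using multivectors_linear[OF B len wC wC, of 0 0 0] by simp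
        qed
        finally show ?thesis .
      next
        case False
        then show ?thesis using v(1)[of w] v(2) by (simp add: w scaleR_fun_apply)
      qed
    qed (rule multivectors_outside[OF B])
    then show "w \<in> {w \<in> cotangent_space A x. contract w B = 0}"
      using wC by (simp add: contract_def fun_eq_iff)
  qed
  show "{w \<in> cotangent_space A x. contract w B = 0} \<subseteq> span {codual B x}"
  proof
    fix w assume "w \<in> {w \<in> cotangent_space A x. contract w B = 0}"
    then have w: "w \<in> cotangent_space A x" "\<And>ws. B (w # ws) = 0"
      by (auto simp: contract_def fun_eq_iff)
    obtain ws where "B ws \<noteq> 0" using nz by (auto simp: fun_eq_iff)
    then have ws: "length ws = CARD('n) - 1" "set ws \<subseteq> cotangent_space A x" and Bws: "B ws \<noteq> 0"
      using multivectors_outside[OF B, of ws] by auto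
    \<comment> \<open>Since w contracts B to zero, \<open>codual_eval\<close> holds for every v;
      dividing by the nonzero number B ws gives the factor.\<close>
    have "w = (vol x (w # ws) / B ws) *\<^sub>R codual B x"
    proof
      fix v
      show "w v = ((vol x (w # ws) / B ws) *\<^sub>R codual B x) v"
      proof (cases "v \<in> tangent_space A x")
        case True
        have "w v * B ws = codual B x v * vol x (w # ws)"
          by (rule codual_eval[OF B x True ws w(1)]) (simp add: w(2))
        then show ?thesis using Bws by (simp add: scaleR_fun_apply field_simps)
      next
        case False
        then show ?thesis
          using w(1) codual_cotangent[of B x] by (simp add: cotangent_space_def scaleR_fun_apply)
      qed
    qed
    then show "w \<in> span {codual B x}" by (auto simp: span_singleton)
  qed
qed

subsection \<open>The flat connection of a chart\<close>

text \<open>With E = \<phi> vol only the coefficient \<phi> is differentiated. The result vanishes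
  outside U because X does.\<close>

definition flat_connection :: "('m \<Rightarrow> 'm tvec) \<Rightarrow> ('m \<Rightarrow> 'm mvec) \<Rightarrow> 'm \<Rightarrow> 'm mvec"
  where "flat_connection X E = (\<lambda>x. X x (\<lambda>y. E y (coframe_list y)) *\<^sub>R vol x)"

lemma top_field_coefficient_smooth:
  "E \<in> multivector_fields A CARD('n) U \<Longrightarrow> smooth_fun A U (\<lambda>y. E y (coframe_list y))"
  by (rule multivector_field_coframe_smooth[OF openU order_refl order_refl]) auto

lemma top_field_expand:
  "E \<in> multivector_fields A CARD('n) U \<Longrightarrow> x \<in> U \<Longrightarrow> E x = E x (coframe_list x) *\<^sub>R vol x"
  by (rule top_expand) (auto simp: multivector_fields_def)

lemma flat_connection_coefficient:
  "x \<in> U \<Longrightarrow> flat_connection X E x (coframe_list x) = X x (\<lambda>y. E y (coframe_list y))"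
  by (simp add: flat_connection_def scaleR_fun_apply vol_coframe)

lemma flat_connection_outside:
  "X \<in> vector_fields A U \<Longrightarrow> x \<notin> U \<Longrightarrow> flat_connection X E x = 0"
  by (simp add: flat_connection_def vector_field_outside)

lemma top_field_smooth_at:
  "E \<in> multivector_fields A CARD('n) U \<Longrightarrow> x \<in> U \<Longrightarrow> smooth_at A x (\<lambda>y. E y (coframe_list y))"
  by (rule smooth_atI[OF openU _ top_field_coefficient_smooth])

lemma flat_connection_derivation_law: "derivation_law A U flat_connection"
proof -
  have eqI: "F = G" if "\<And>x. x \<in> U \<Longrightarrow> F x = G x" "\<And>x. x \<notin> U \<Longrightarrow> F x = G x" for F G :: "'m \<Rightarrow> 'm mvec"
    using that by blast
  have "flat_connection X E \<in> multivector_fields A CARD('n) U"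
    if X: "X \<in> vector_fields A U" and E: "E \<in> multivector_fields A CARD('n) U" for X E
  proof (rule top_fieldsI)
    show "flat_connection X E x \<in> multivectors A CARD('n) x" if "x \<in> U" for x
      unfolding flat_connection_def by (intro subspace_scale multivectors_subspace vol_multivector)
    have "smooth_fun A U (\<lambda>y. flat_connection X E y (coframe_list y))"
      by (rule smooth_fun_cong[OF openU _ vector_field_smooth[OF X openU order_refl top_field_coefficient_smooth[OF E]]])
         (simp add: flat_connection_coefficient)
    then show "\<exists>N. open N \<and> x \<in> N \<and> ((\<forall>y\<in>N. flat_connection X E y = 0) \<or>
        (N \<subseteq> U \<and> smooth_fun A N (\<lambda>y. flat_connection X E y (coframe_list y))))" if "x \<in> U" for x
      using that openU by blast
  qed (rule flat_connection_outside[OF X])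
  moreover have "flat_connection (X + Y) E = flat_connection X E + flat_connection Y E" for X Y E
    by (simp add: flat_connection_def fun_eq_iff scaleR_fun_apply algebra_simps)
  moreover have "flat_connection (fun_mult f X) E = fun_mult f (flat_connection X E)" for f X E
    by (simp add: flat_connection_def fun_eq_iff fun_mult_def scaleR_fun_apply)
  moreover have "flat_connection X (E + F) = flat_connection X E + flat_connection X F"
    if X: "X \<in> vector_fields A U" and E: "E \<in> multivector_fields A CARD('n) U" and F: "F \<in> multivector_fields A CARD('n) U" for X E F
  proof (rule eqI)
    fix x assume x: "x \<in> U"
    show "flat_connection X (E + F) x = (flat_connection X E + flat_connection X F) x"
      using tangent_add[OF vector_field_tangent[OF X x] top_field_smooth_at[OF E x] top_field_smooth_at[OF F x]]
      by (simp add: flat_connection_def scaleR_add_left)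
  qed (simp add: flat_connection_outside[OF X])
  moreover have "flat_connection X (fun_mult f E) = fun_mult (lie_deriv X f) E + fun_mult f (flat_connection X E)"
    if f: "f \<in> smooth_functions A U" and X: "X \<in> vector_fields A U" and E: "E \<in> multivector_fields A CARD('n) U" for f X E
  proof (rule eqI)
    fix x assume x: "x \<in> U"
    have sf: "smooth_at A x f" using f smooth_atI[OF openU x] by (simp add: smooth_functions_def)
    have "X x (\<lambda>y. f y * E y (coframe_list y)) = f x * X x (\<lambda>y. E y (coframe_list y)) + E x (coframe_list x) * X x f"
      by (rule tangent_leibniz[OF vector_field_tangent[OF X x] sf top_field_smooth_at[OF E x]])
    then have "flat_connection X (fun_mult f E) x = X x f *\<^sub>R (E x (coframe_list x) *\<^sub>R vol x) + f x *\<^sub>R flat_connection X E x"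
      by (simp add: flat_connection_def fun_mult_def scaleR_fun_apply scaleR_add_left mult.commute)
    then show "flat_connection X (fun_mult f E) x = (fun_mult (lie_deriv X f) E + fun_mult f (flat_connection X E)) x"
      using top_field_expand[OF E x] by (simp add: fun_mult_def lie_deriv_def)
  next
    fix x assume "x \<notin> U"
    then show "flat_connection X (fun_mult f E) x = (fun_mult (lie_deriv X f) E + fun_mult f (flat_connection X E)) x"
      using f E by (simp add: flat_connection_outside[OF X] fun_mult_def lie_deriv_def smooth_functions_def vector_field_outside[OF X])
  qed
  ultimately show ?thesis unfolding derivation_law_def Let_def by blast
qed

text \<open>On coefficients, the curvature is X Y \<phi> - Y X \<phi> - [X,Y] \<phi>, which is zero
  by the definition of the bracket.\<close>

lemma flat_connection_flat: "flat_law A U flat_connection"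
  unfolding flat_law_def
proof (intro ballI)
  fix X Y E
  assume X: "X \<in> vector_fields A U" and Y: "Y \<in> vector_fields A U" and E: "E \<in> multivector_fields A CARD('n) U"
  let ?\<phi> = "\<lambda>y. E y (coframe_list y)"
  have *: "flat_connection X (flat_connection Y E) x = X x (lie_deriv Y ?\<phi>) *\<^sub>R vol x"
    if x: "x \<in> U" and X: "X \<in> vector_fields A U" for X Y x
  proof -
    have "X x (\<lambda>y. flat_connection Y E y (coframe_list y)) = X x (lie_deriv Y ?\<phi>)"
      by (rule tangent_cong[OF vector_field_tangent[OF X x] openU x]) (simp add: flat_connection_coefficient lie_deriv_def)
    then show ?thesis by (simp add: flat_connection_def)
  qed
  show "flat_connection X (flat_connection Y E) - flat_connection Y (flat_connection X E)
      - flat_connection (lie_bracket A X Y) E = 0"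
  proof
    fix x
    show "(flat_connection X (flat_connection Y E) - flat_connection Y (flat_connection X E)
        - flat_connection (lie_bracket A X Y) E) x = 0 x"
    proof (cases "x \<in> U")
      case True
      then show ?thesis
        using *[OF True X] *[OF True Y] lie_bracket_smooth[OF top_field_smooth_at[OF E True], of X Y]
        by (simp add: flat_connection_def[of "lie_bracket A X Y"] scaleR_diff_left)
    next
      case False
      then show ?thesis
        using lie_bracket_outside[OF X Y False]
        by (simp add: flat_connection_outside[OF X] flat_connection_outside[OF Y] flat_connection_def[of "lie_bracket A X Y"])
    qed
  qed
qed

section \<open>Constant coefficients imply both conditions\<close>

text \<open>The covector of V has constant components c_i, so it is the differential of l, the sum
  of the c_i u_i. As its value on v is v l, both closedness and the vanishing of the covariant
  derivative of \<open>eta_form\<close> reduce to the definition of the bracket applied to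
  l.\<close>

lemma constant_coefficients_imp:
  assumes V: "V \<in> multivector_fields A (CARD('n) - 1) UNIV" and x0: "x0 \<in> U" and nz: "V x0 \<noteq> 0"
    and const: "\<And>ks. length ks = CARD('n) - 1 \<Longrightarrow> sorted_wrt (<) ks \<Longrightarrow>
      \<exists>c. \<forall>x\<in>U. V x (map (\<lambda>i. coframe i x) ks) = c"
  shows "locally_constant_rank U (pfaffian_system A V)" "locally_closed_basis A U (pfaffian_system A V)"
    "\<And>X Y. X \<in> vector_fields A U \<Longrightarrow> Y \<in> vector_fields A U \<Longrightarrow>
      ext_cov_deriv A flat_connection (eta_form A V) X Y = 0"
proof -
  have Vm: "V x \<in> multivectors A (CARD('n) - 1) x" for x using V by (simp add: multivector_fields_def)
  have "\<exists>c. \<forall>x\<in>U. codual (V x) x (frame i x) = c" for i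
  proof -
    have "index_pos i + (CARD('n) - Suc (index_pos i)) = CARD('n) - Suc 0"
      using index_pos_less[of i] by arith
    then have "length (take (index_pos i) index_list @ drop (Suc (index_pos i)) (index_list :: 'n list)) = CARD('n) - 1"
      by simp
    from const[OF this index_list_remove_sorted] show ?thesis using codual_frame by auto
  qed
  then obtain c where c: "\<And>i x. x \<in> U \<Longrightarrow> codual (V x) x (frame i x) = c i" by metis
  define \<omega> where "\<omega> x = restrict_field U (\<lambda>x. codual (V x) x) x" for x
  define l where "l = (\<lambda>y. \<Sum>i\<in>UNIV. c i * coord i y)"
  have sl: "smooth_at A x l" if "x \<in> U" for x
    unfolding l_def by (intro smooth_at_sum smooth_at_mult smooth_at_const smooth_at_coord that)
  have vl: "codual (V x) x v = v l" if x: "x \<in> U" and v: "v \<in> tangent_space A x" for x v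
  proof -
    have "v l = (\<Sum>i\<in>UNIV. v (\<lambda>y. c i * coord i y))"
      unfolding l_def
      by (rule tangent_sum[OF v]) (intro smooth_at_mult smooth_at_const smooth_at_coord x)
    also have "\<dots> = (\<Sum>i\<in>UNIV. c i * v (coord i))"
      by (intro sum.cong refl tangent_cmult[OF v] smooth_at_coord x)
    finally show ?thesis
      using cotangent_apply[OF codual_cotangent v x, of "V x"] by (simp add: c x mult.commute)
  qed
  \<comment> \<open>One nonzero constant component keeps V and its covector away from zero on all of
    U, which gives rank one everywhere.\<close>
  obtain m where m: "c m \<noteq> 0"
    using codual_component[OF Vm x0 nz] c[OF x0] by metis
  have cnz: "codual (V x) x \<noteq> 0" if "x \<in> U" for x
    using c[OF that, of m] m by auto
  have Vnz: "V x \<noteq> 0" if "x \<in> U" for x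
    using c[OF that, of m] m codual_frame[OF that, of "V x" m] by auto
  have P: "pfaffian_system A V x = span {codual (V x) x}" if "x \<in> U" for x
    unfolding pfaffian_system_def by (rule pfaffian_span[OF Vm that Vnz[OF that]])
  have "dim (pfaffian_system A V x) = 1" if "x \<in> U" for x
    using dim_eq_card_independent[of "{codual (V x) x}"] cnz[OF that] by (simp add: P[OF that])
  then show "locally_constant_rank U (pfaffian_system A V)"
    unfolding locally_constant_rank_def using openU by blast
  have \<omega>1: "\<omega> \<in> one_forms A U"
  proof (rule one_formsI[OF openU order_refl])
    show "smooth_fun A U (\<lambda>x. \<omega> x (frame j x))" for j
      by (rule smooth_fun_cong[OF openU _ smooth_fun_const[of _ "c j"]]) (simp add: \<omega>_def c)
  qed (simp_all add: \<omega>_def codual_cotangent)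
  have \<omega>P: "\<omega> \<in> pfaff_sections A U (pfaffian_system A V)"
    using \<omega>1 by (auto simp: pfaff_sections_def P \<omega>_def span_base)
  have \<omega>c: "closed_form A U \<omega>"
    unfolding closed_form_def
  proof (intro ballI)
    fix X Y x assume X: "X \<in> vector_fields A U" and Y: "Y \<in> vector_fields A U" and x: "x \<in> U"
    have *: "X x (\<lambda>y. \<omega> y (Y y)) = X x (lie_deriv Y l)" if X: "X \<in> vector_fields A U" and Y: "Y \<in> vector_fields A U" for X Y
      by (rule tangent_cong[OF vector_field_tangent[OF X x] openU x])
         (simp add: \<omega>_def lie_deriv_def vl vector_field_tangent[OF Y])
    have "\<omega> x (lie_bracket A X Y x) = lie_bracket A X Y x l"
      using vl[OF x lie_bracket_tangent[OF openU X Y x]] x by (simp add: \<omega>_def)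
    then show "X x (\<lambda>y. \<omega> y (Y y)) - Y x (\<lambda>y. \<omega> y (X y)) - \<omega> x (lie_bracket A X Y x) = 0"
      using *[OF X Y] *[OF Y X] lie_bracket_smooth[OF sl[OF x]] by simp
  qed
  have "\<exists>!fs. length fs = length [\<omega>] \<and> set fs \<subseteq> smooth_functions A U \<and>
       w = (\<Sum>i<length [\<omega>]. fun_mult (fs ! i) ([\<omega>] ! i))" if w: "w \<in> pfaff_sections A U (pfaffian_system A V)" for w
  proof (rule ex1I)
    \<comment> \<open>If w = f \<omega>, then evaluation on the m-th frame vector forces this f;
      dividing by the constant c_m keeps it smooth.\<close>
    define f where "f = (\<lambda>x. if x \<in> U then w x (frame m x) / c m else 0)"
    have w1: "w \<in> one_forms A U" and wP: "\<And>x. x \<in> U \<Longrightarrow> w x \<in> pfaffian_system A V x"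
      using w by (auto simp: pfaff_sections_def)
    have "smooth_fun A U (\<lambda>x. (1 / c m) * w x (frame m x))"
      by (intro smooth_fun_cmult openU one_forms_frame_smooth[OF openU order_refl order_refl w1])
    then have "smooth_fun A U f"
      by (rule smooth_fun_cong[OF openU, rotated]) (simp add: f_def)
    then have fs: "f \<in> smooth_functions A U" by (simp add: smooth_functions_def f_def)
    have "w x = fun_mult f \<omega> x" for x
    proof (cases "x \<in> U")
      case True
      then obtain k where k: "w x = k *\<^sub>R codual (V x) x" using wP[OF True] P[OF True] by (auto simp: span_singleton)
      then have "f x = k" using True m by (simp add: f_def c scaleR_fun_apply)
      then show ?thesis using k True by (simp add: fun_mult_def \<omega>_def)
    next
      case False
      then show ?thesis using w1 by (simp add: one_forms_def fun_mult_def f_def)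
    qed
    then have wf: "w = fun_mult f \<omega>" by blast
    then show "length [f] = length [\<omega>] \<and> set [f] \<subseteq> smooth_functions A U \<and>
       w = (\<Sum>i<length [\<omega>]. fun_mult ([f] ! i) ([\<omega>] ! i))"
      using fs by simp
    fix gs assume gs: "length gs = length [\<omega>] \<and> set gs \<subseteq> smooth_functions A U \<and>
       w = (\<Sum>i<length [\<omega>]. fun_mult (gs ! i) ([\<omega>] ! i))"
    then obtain g where g: "gs = [g]" by (auto simp: length_Suc_conv)
    have gU: "g \<in> smooth_functions A U" and wg: "w = fun_mult g \<omega>" using gs g by auto
    \<comment> \<open>Outside U both factors are zero by the convention for functions over U;
      without it they would not be unique.\<close>
    have "g x = f x" for x
    proof (cases "x \<in> U")
      case True
      have "w x (frame m x) = g x * c m"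
        using True by (simp add: wg fun_mult_def \<omega>_def scaleR_fun_apply c)
      then show ?thesis using True m by (simp add: f_def)
    next
      case False
      then show ?thesis using gU by (simp add: smooth_functions_def f_def)
    qed
    then show "gs = [f]" using g by auto
  qed
  then have "is_closed_basis A U (pfaffian_system A V) [\<omega>]"
    unfolding is_closed_basis_def using \<omega>P \<omega>c by auto
  then show "locally_closed_basis A U (pfaffian_system A V)"
    unfolding locally_closed_basis_def using openU by blast
  fix X Y assume X: "X \<in> vector_fields A U" and Y: "Y \<in> vector_fields A U"
  have eta: "eta_form A V Y y = Y y l *\<^sub>R vol y" if "y \<in> U" "Y y \<in> tangent_space A y" for Y y
    using wedge_codual[OF Vm that] vl[OF that] by (simp add: eta_form_def)
  have *: "flat_connection X (eta_form A V Y) x = X x (lie_deriv Y l) *\<^sub>R vol x"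
    if x: "x \<in> U" and X: "X \<in> vector_fields A U" and Y: "Y \<in> vector_fields A U" for X Y x
  proof -
    have "X x (\<lambda>y. eta_form A V Y y (coframe_list y)) = X x (lie_deriv Y l)"
      by (rule tangent_cong[OF vector_field_tangent[OF X x] openU x])
         (simp add: eta vector_field_tangent[OF Y] scaleR_fun_apply vol_coframe lie_deriv_def)
    then show ?thesis by (simp add: flat_connection_def)
  qed
  show "ext_cov_deriv A flat_connection (eta_form A V) X Y = 0"
  proof
    fix x
    show "ext_cov_deriv A flat_connection (eta_form A V) X Y x = 0 x"
    proof (cases "x \<in> U")
      case True
      then show ?thesis
        using *[OF True X Y] *[OF True Y X] lie_bracket_smooth[OF sl[OF True], of X Y]
          eta[of x "lie_bracket A X Y", OF True lie_bracket_tangent[OF openU X Y True]]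
        by (simp add: ext_cov_deriv_def scaleR_diff_left)
    next
      case False
      have "eta_form A V (lie_bracket A X Y) x = 0"
        unfolding eta_form_def lie_bracket_outside[OF X Y False] by (rule wedge_zero)
      then show ?thesis
        using False by (simp add: ext_cov_deriv_def flat_connection_outside[OF X] flat_connection_outside[OF Y])
    qed
  qed
qed

section \<open>From a derivation law to equations in coordinates\<close>

text \<open>The bump function is supported in K, the preimage of a closed ball. A product with
  \<rho> is smooth on G since both factors are, and it is zero on the open complement of K; these
  two sets cover the manifold, whatever values g takes outside G.\<close>

lemma cutoff:
  assumes G: "open G" "x0 \<in> G" "G \<subseteq> U"
  obtains \<rho> N K where "open N" "x0 \<in> N" "N \<subseteq> G" "\<And>x. x \<in> N \<Longrightarrow> \<rho> x = (1::real)"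
    "closed K" "K \<subseteq> G" "\<And>x. x \<notin> K \<Longrightarrow> \<rho> x = 0"
    "\<And>g. smooth_fun A G g \<Longrightarrow> smooth_fun A UNIV (\<lambda>x. \<rho> x * g x)"
proof -
  have "open (u ` G)" "u x0 \<in> u ` G" using open_image G by auto
  then obtain e where e: "e > 0" "cball (u x0) e \<subseteq> u ` G" using open_contains_cball by blast
  define r where "r = e / 2"
  have r: "r > 0" "cball (u x0) (2 * r) \<subseteq> u ` G" using e by (simp_all add: r_def)
  obtain b :: "(real, 'n) vec \<Rightarrow> real" where b: "smooth_on UNIV b"
    "\<And>q. dist (u x0) q \<le> r \<Longrightarrow> b q = 1" "\<And>q. dist (u x0) q \<ge> 2 * r \<Longrightarrow> b q = 0"
    using that by (rule smooth_bump[OF r(1)])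
  define K where "K = \<iota> ` cball (u x0) (2 * r)"
  define N where "N = G \<inter> (U \<inter> u -` ball (u x0) r)"
  define \<rho> where "\<rho> = (\<lambda>x. if x \<in> G then b (u x) else 0)"
  have "u ` G \<subseteq> u ` U" using G by auto
  then have "continuous_on (cball (u x0) (2 * r)) \<iota>"
    by (intro continuous_on_subset[OF is_chart_D(5)[OF ch]] order_trans[OF r(2)])
  then have "compact K" unfolding K_def using compact_cball by (rule compact_continuous_image)
  \<comment> \<open>This uses that the manifold is Hausdorff.\<close>
  then have K: "closed K" by (rule compact_imp_closed)
  have KG: "K \<subseteq> G"
  proof
    fix x assume "x \<in> K"
    then obtain q where q: "q \<in> cball (u x0) (2 * r)" "x = \<iota> q" by (auto simp: K_def)
    then obtain x' where "x' \<in> G" "q = u x'" using r by blast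
    then show "x \<in> G" using q G by auto
  qed
  have out: "\<rho> x = 0" if "x \<notin> K" for x
  proof (cases "x \<in> G")
    case True
    have "u x \<notin> cball (u x0) (2 * r)"
    proof
      assume "u x \<in> cball (u x0) (2 * r)"
      then have "\<iota> (u x) \<in> K" by (auto simp: K_def)
      then show False using that True G by auto
    qed
    then show ?thesis using True b(3)[of "u x"] by (simp add: \<rho>_def)
  qed (simp add: \<rho>_def)
  have "open N"
    unfolding N_def by (rule open_Int[OF G(1) is_chart_open_preimage[OF ch open_ball]])
  moreover have "x0 \<in> N" "N \<subseteq> G" using G r by (auto simp: N_def)
  moreover have "\<rho> x = 1" if "x \<in> N" for x
    using that b(2)[of "u x"] by (simp add: N_def \<rho>_def)
  moreover have "smooth_fun A UNIV (\<lambda>x. \<rho> x * g x)" if g: "smooth_fun A G g" for g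
  proof (rule smooth_fun_union)
    fix x :: 'm
    show "\<exists>N. open N \<and> x \<in> N \<and> smooth_fun A N (\<lambda>x. \<rho> x * g x)"
    proof (cases "x \<in> G")
      case True
      have "smooth_fun A G (\<lambda>x. b (u x))"
        by (rule smooth_fun_subset[OF smooth_fun_pullback[OF open_UNIV b(1)]]) (use G in auto)
      then have "smooth_fun A G (\<lambda>x. b (u x) * g x)" by (intro smooth_fun_mult G g)
      then have "smooth_fun A G (\<lambda>x. \<rho> x * g x)"
        by (rule smooth_fun_cong[OF G(1), rotated]) (simp add: \<rho>_def)
      then show ?thesis using True G(1) by blast
    next
      case False
      have "smooth_fun A (- K) (\<lambda>x. \<rho> x * g x)"
        by (rule smooth_fun_cong[OF open_Compl[OF K] _ smooth_fun_const[of _ 0]]) (simp add: out)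
      then show ?thesis using False KG open_Compl[OF K] by blast
    qed
  qed
  ultimately show ?thesis using that K KG out by blast
qed

text \<open>The functions f_j and h_j are the components of \<theta> and \<beta> near x0, and the
  two equations say d\<theta> = 0 and d\<beta> + \<theta> \<and> \<beta> = 0. They are read off from
  cut-off versions of the frame and of \<open>vol\<close>, which are fields over all of G and agree
  with the originals where \<rho> = 1.\<close>

lemma flat_torsion_free_equations:
  assumes G: "open G" "U \<subseteq> G" and x0: "x0 \<in> U" and V: "V \<in> multivector_fields A (CARD('n) - 1) UNIV"
    and law: "derivation_law A G nabla" and flat: "flat_law A G nabla"
    and tor: "\<And>X Y. X \<in> vector_fields A G \<Longrightarrow> Y \<in> vector_fields A G \<Longrightarrow> ext_cov_deriv A nabla (eta_form A V) X Y = 0"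
  obtains N f h where "open N" "x0 \<in> N" "N \<subseteq> U" "\<And>j. smooth_fun A N (f j)" "\<And>j. smooth_fun A N (h j)"
    "\<And>j x. x \<in> N \<Longrightarrow> h j x = codual (V x) x (frame j x)"
    "\<And>i j x. x \<in> N \<Longrightarrow> partial i (f j) x = partial j (f i) x"
    "\<And>i j x. x \<in> N \<Longrightarrow> partial i (h j) x + h j x * f i x = partial j (h i) x + h i x * f j x"
proof -
  obtain \<rho> N K where N: "open N" "x0 \<in> N" "N \<subseteq> U" "\<And>x. x \<in> N \<Longrightarrow> \<rho> x = (1::real)"
    and K: "closed K" "K \<subseteq> U" "\<And>x. x \<notin> K \<Longrightarrow> \<rho> x = 0"
    and \<rho>: "\<And>g. smooth_fun A U g \<Longrightarrow> smooth_fun A UNIV (\<lambda>x. \<rho> x * g x)"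
    using that by (rule cutoff[OF openU x0 order_refl])
  obtain \<sigma> N' K' where N': "open N'" "x0 \<in> N'" "N' \<subseteq> N" "\<And>x. x \<in> N' \<Longrightarrow> \<sigma> x = (1::real)"
    and K': "closed K'" "K' \<subseteq> N" "\<And>x. x \<notin> K' \<Longrightarrow> \<sigma> x = 0"
    and \<sigma>: "\<And>g. smooth_fun A N g \<Longrightarrow> smooth_fun A UNIV (\<lambda>x. \<sigma> x * g x)"
    using that by (rule cutoff[OF N(1,2,3)])
  let ?XX = "vector_fields A G" and ?EE = "multivector_fields A CARD('n) G" and ?CC = "smooth_functions A G"
  have l1: "nabla X E \<in> ?EE" if "X \<in> ?XX" "E \<in> ?EE" for X E
    using law that unfolding derivation_law_def Let_def by blast
  have l3: "nabla (fun_mult f X) E = fun_mult f (nabla X E)" if "f \<in> ?CC" "X \<in> ?XX" "E \<in> ?EE" for f X E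
    using law that unfolding derivation_law_def Let_def by blast
  have l5: "nabla X (fun_mult f E) = fun_mult (lie_deriv X f) E + fun_mult f (nabla X E)"
    if "f \<in> ?CC" "X \<in> ?XX" "E \<in> ?EE" for f X E
    using law that unfolding derivation_law_def Let_def by blast
  have Vm: "V x \<in> multivectors A (CARD('n) - 1) x" for x using V by (simp add: multivector_fields_def)
  have out: "\<rho> x = 0" if "x \<notin> U" for x using K that by blast
  have CC: "(\<lambda>x. \<rho> x * g x) \<in> ?CC" if "smooth_fun A U g" for g
    using smooth_fun_subset[OF \<rho>[OF that]] out G by (auto simp: smooth_functions_def)
  have s\<rho>: "smooth_fun A UNIV \<rho>" using \<rho>[OF smooth_fun_const[of _ 1]] by simp
  have Upow: "smooth_fun A U (\<lambda>x. \<rho> x ^ m)" for m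
  proof (induction m)
    case (Suc m)
    then show ?case using smooth_fun_mult[OF openU smooth_fun_subset[OF s\<rho>]] by simp
  qed simp
  \<comment> \<open>A cut-off field vanishes near points outside U and has smooth coordinates on U,
    which are the two alternatives in \<open>vector_fieldsI\<close> and
    \<open>top_fieldsI\<close>.\<close>
  have near: "\<exists>M. open M \<and> x \<in> M \<and> (M \<subseteq> - K \<or> M = U)" for x
  proof (cases "x \<in> U")
    case False
    then have "x \<in> - K" using K by auto
    then show ?thesis using K(1) by (metis open_Compl order_refl)
  qed (use openU in blast)
  define E where "E = (\<lambda>x. \<rho> x *\<^sub>R vol x)"
  have E: "E \<in> ?EE"
  proof (rule top_fieldsI)
    show "E x \<in> multivectors A CARD('n) x" for x
      unfolding E_def by (intro subspace_scale multivectors_subspace vol_multivector)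
    show "E x = 0" if "x \<notin> G" for x using that G out by (auto simp: E_def)
    have "smooth_fun A U (\<lambda>y. E y (coframe_list y))"
      by (rule smooth_fun_cong[OF openU _ smooth_fun_subset[OF s\<rho> subset_UNIV]])
         (simp add: E_def scaleR_fun_apply vol_coframe)
    moreover have "E y = 0" if "y \<in> - K" for y using that K by (simp add: E_def)
    ultimately show "\<exists>M. open M \<and> x \<in> M \<and> ((\<forall>y\<in>M. E y = 0) \<or>
        (M \<subseteq> U \<and> smooth_fun A M (\<lambda>y. E y (coframe_list y))))" for x
      using near[of x] by blast
  qed
  have XX: "(\<lambda>x. \<rho> x ^ Suc m *\<^sub>R frame j x) \<in> ?XX" for j m
  proof (rule vector_fieldsI)
    let ?X = "\<lambda>x. \<rho> x ^ Suc m *\<^sub>R frame j x"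
    have z: "?X x = 0" if "x \<notin> U" for x using out[OF that] by simp
    show "?X x \<in> tangent_space A x" for x
    proof (cases "x \<in> U")
      case True
      then show ?thesis by (intro subspace_scale tangent_space_subspace frame_tangent)
    next
      case False
      then show ?thesis using z subspace_0[OF tangent_space_subspace] by metis
    qed
    show "?X x = 0" if "x \<notin> G" for x using that G z by blast
    have "smooth_fun A U (\<lambda>y. ?X y (coord i))" for i
    proof -
      have "smooth_fun A U (\<lambda>y. \<rho> y ^ Suc m * (if j = i then 1 else 0))"
        by (intro smooth_fun_mult openU Upow smooth_fun_const)
      then show ?thesis
        by (rule smooth_fun_cong[OF openU, rotated]) (simp add: scaleR_fun_apply frame_coord)
    qed
    moreover have "?X y = 0" if "y \<in> - K" for y using that K by simp
    ultimately show "\<exists>M. open M \<and> x \<in> M \<and> ((\<forall>y\<in>M. ?X y = 0) \<or>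
        (M \<subseteq> U \<and> (\<forall>i. smooth_fun A M (\<lambda>y. ?X y (coord i)))))" for x
      using near[of x] by blast
  qed
  \<comment> \<open>With the exponent 3, both \<open>nabla (X j) E\<close> and \<open>eta_form A V (X j)\<close> are multiples of \<open>E\<close> by functions
    that are smooth on all of \<open>G\<close>, so that the Leibniz rule of \<open>nabla\<close> applies to them.\<close>
  define Z where "Z j = (\<lambda>x. \<rho> x *\<^sub>R frame j x)" for j
  define X where "X j = (\<lambda>x. \<rho> x ^ 3 *\<^sub>R frame j x)" for j
  have Z: "Z j \<in> ?XX" and X: "X j \<in> ?XX" for j
    using XX[of 0 j] XX[of 2 j] by (simp_all add: Z_def X_def numeral_eq_Suc)
  have XN: "X j x = frame j x" if "x \<in> N" for j x using N(4)[OF that] by (simp add: X_def)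
  define f where "f j = (\<lambda>x. \<rho> x * nabla (Z j) E x (coframe_list x))" for j
  define h where "h j = (\<lambda>x. \<rho> x * (\<rho> x * codual (V x) x (frame j x)))" for j
  have fC: "f j \<in> ?CC" for j
    unfolding f_def
    by (intro CC multivector_field_coframe_smooth[OF openU order_refl G(2) l1[OF Z E]]) simp
  have hC: "h j \<in> ?CC" for j
    unfolding h_def
    by (intro CC smooth_fun_mult openU smooth_fun_subset[OF s\<rho> subset_UNIV]
        codual_smooth[OF openU order_refl subset_UNIV V])
  \<comment> \<open>Of the three factors \<rho> in X j, one belongs to Z j and two come out of the
    law by linearity. Of these two, one makes f j smooth on G and the other turns \<open>vol\<close>
    into E.\<close>
  have nX: "nabla (X j) E = fun_mult (f j) E" for j
  proof -
    have "(\<lambda>x. \<rho> x * \<rho> x) \<in> ?CC" by (rule CC[OF smooth_fun_subset[OF s\<rho> subset_UNIV]])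
    from l3[OF this Z E, of j]
    have "nabla (X j) E = fun_mult (\<lambda>x. \<rho> x * \<rho> x) (nabla (Z j) E)"
      by (simp add: X_def Z_def fun_mult_def power3_eq_cube)
    also have "\<dots> = fun_mult (f j) E"
    proof
      fix x
      show "fun_mult (\<lambda>x. \<rho> x * \<rho> x) (nabla (Z j) E) x = fun_mult (f j) E x"
      proof (cases "x \<in> U")
        case True
        have "nabla (Z j) E x \<in> multivectors A CARD('n) x"
          using l1[OF Z E] True G by (auto simp: multivector_fields_def)
        from top_expand[OF this True]
        have "nabla (Z j) E x = nabla (Z j) E x (coframe_list x) *\<^sub>R vol x" .
        then have "fun_mult (\<lambda>x. \<rho> x * \<rho> x) (nabla (Z j) E) x = (\<rho> x * \<rho> x) *\<^sub>R (nabla (Z j) E x (coframe_list x) *\<^sub>R vol x)"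
          unfolding fun_mult_def by (rule arg_cong)
        then show ?thesis by (simp add: fun_mult_def f_def E_def mult_ac)
      qed (simp add: fun_mult_def out E_def)
    qed
    finally show ?thesis .
  qed
  have etaX: "eta_form A V (X j) = fun_mult (h j) E" for j
  proof
    fix x
    show "eta_form A V (X j) x = fun_mult (h j) E x"
    proof (cases "x \<in> U")
      case True
      have t: "X j x \<in> tangent_space A x"
        unfolding X_def using True by (intro subspace_scale tangent_space_subspace frame_tangent)
      have "codual (V x) x (X j x) = \<rho> x ^ 3 * codual (V x) x (frame j x)"
        using cotangent_linear[OF codual_cotangent frame_tangent[OF True] frame_tangent[OF True], of "V x" "\<rho> x ^ 3" j 0 j]
        by (simp add: X_def)
      then show ?thesis
        unfolding eta_form_def wedge_codual[OF Vm True t]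
        by (simp add: fun_mult_def h_def E_def power3_eq_cube mult_ac)
    next
      case False
      then have "X j x = 0" by (simp add: X_def out)
      then show ?thesis using out[OF False] by (simp add: eta_form_def wedge_zero fun_mult_def E_def)
    qed
  qed
  \<comment> \<open>On N the fields are coordinate fields, so each has constant values on the
    coordinate functions; a tangent vector that kills all coordinates is zero.\<close>
  have br0: "lie_bracket A (X i) (X j) x = 0" if x: "x \<in> N" for i j x
  proof -
    have xU: "x \<in> U" and xG: "x \<in> G" using x N G by auto
    note t = lie_bracket_tangent[OF G(1) X X xG, of i j]
    have *: "X i x (lie_deriv (X j) (coord k)) = 0" for i j k
    proof -
      have "X i x (lie_deriv (X j) (coord k)) = X i x (\<lambda>y. if j = k then 1 else 0)"
        by (rule tangent_cong[OF vector_field_tangent[OF X xG] N(1) x])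
           (use N in \<open>auto simp: lie_deriv_def XN frame_coord\<close>)
      then show ?thesis using tangent_const[OF vector_field_tangent[OF X xG]] by simp
    qed
    have "lie_bracket A (X i) (X j) x (coord k) = 0" for k
      using lie_bracket_smooth[OF smooth_at_coord[OF xU]] * by simp
    then show ?thesis using tangent_expand[OF t xU] by simp
  qed
  \<comment> \<open>A derivation law over \<open>G\<close> is local in its vector field; \<open>\<sigma>\<close> is used to see this.\<close>
  have nbr: "nabla (lie_bracket A (X i) (X j)) E x = 0" if x: "x \<in> N'" for i j x
  proof -
    let ?B = "lie_bracket A (X i) (X j)"
    have B: "?B \<in> ?XX" by (rule lie_bracket_field[OF G(1) X X])
    have "\<sigma> x = 0" if "x \<notin> G" for x
    proof -
      have "x \<notin> K'" using that K'(2) N(3) G(2) by blast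
      then show ?thesis by (rule K'(3))
    qed
    then have s: "\<sigma> \<in> ?CC"
      using smooth_fun_subset[OF \<sigma>[OF smooth_fun_const[of _ 1]] subset_UNIV] by (simp add: smooth_functions_def)
    have z: "(\<lambda>x. 0) \<in> ?CC" by (simp add: smooth_functions_def)
    have "fun_mult \<sigma> ?B x = fun_mult (\<lambda>x. 0) ?B x" for x
      using br0[of x i j] K' by (cases "x \<in> N") (auto simp: fun_mult_def)
    then have "fun_mult \<sigma> ?B = fun_mult (\<lambda>x. 0) ?B" by blast
    then have "fun_mult \<sigma> (nabla ?B E) = fun_mult (\<lambda>x. 0) (nabla ?B E)"
      using l3[OF s B E] l3[OF z B E] by simp
    then have "fun_mult \<sigma> (nabla ?B E) x = fun_mult (\<lambda>x. 0) (nabla ?B E) x" by simp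
    then show ?thesis using N'(4)[OF x] by (simp add: fun_mult_def)
  qed
  have E1: "E x (coframe_list x) = 1" if "x \<in> N" for x
    using that N by (auto simp: E_def scaleR_fun_apply vol_coframe)
  have smC: "smooth_at A x g" if "g \<in> ?CC" "x \<in> N" for g x
    using that smooth_atI[OF G(1), of x g] N(3) G by (auto simp: smooth_functions_def)
  \<comment> \<open>The Leibniz rule with \<rho> = 1: covariant differentiation of g vol along the
    i-th frame vector has coefficient \<partial>_i g + g f_i. With g = f_j this gives the curvature,
    with g = h_j the derivative of \<open>eta_form\<close>.\<close>
  have nfE: "nabla (X i) (fun_mult g E) x (coframe_list x) = partial i g x + g x * f i x"
    if g: "g \<in> ?CC" and x: "x \<in> N" for i g x
    using fun_cong[OF fun_cong[OF l5[OF g X E, of i], of x], of "coframe_list x"] frame_smooth[OF smC[OF g x]]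
    by (simp add: nX fun_mult_def scaleR_fun_apply lie_deriv_def XN[OF x] E1[OF x])
  have sub: "N' \<subseteq> N" "N' \<subseteq> U" using N N' by auto
  have feq: "partial i (f j) x = partial j (f i) x" if x: "x \<in> N'" for i j x
  proof -
    have xN: "x \<in> N" using x sub by auto
    have "nabla (X i) (nabla (X j) E) - nabla (X j) (nabla (X i) E) - nabla (lie_bracket A (X i) (X j)) E = 0"
      using flat X E unfolding flat_law_def by blast
    then have "(nabla (X i) (nabla (X j) E) - nabla (X j) (nabla (X i) E) - nabla (lie_bracket A (X i) (X j)) E) x (coframe_list x) = 0"
      by simp
    \<comment> \<open>The products f_j f_i and f_i f_j cancel, as always for the curvature of a line
      bundle.\<close>
    then show ?thesis using nfE[OF fC xN] nbr[OF x] by (simp add: nX)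
  qed
  have heq: "partial i (h j) x + h j x * f i x = partial j (h i) x + h i x * f j x" if x: "x \<in> N'" for i j x
  proof -
    have xN: "x \<in> N" using x sub by auto
    have e0: "eta_form A V (lie_bracket A (X i) (X j)) x = 0"
      unfolding eta_form_def br0[OF xN] by (rule wedge_zero)
    have "ext_cov_deriv A nabla (eta_form A V) (X i) (X j) x (coframe_list x) = 0"
      using tor[OF X X] by simp
    then show ?thesis using nfE[OF hC xN] e0 by (simp add: ext_cov_deriv_def etaX)
  qed
  have smN: "smooth_fun A N' g" if "g \<in> ?CC" for g
    using that smooth_fun_subset[of G g N'] sub G by (auto simp: smooth_functions_def)
  have hN: "h j x = codual (V x) x (frame j x)" if "x \<in> N'" for j x
    using N(4)[of x] sub that by (auto simp: h_def)
  show ?thesis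
    by (rule that[OF N'(1,2) sub(2) smN[OF fC] smN[OF hC] hN feq heq])
qed

section \<open>Construction of the chart with constant coefficients\<close>

lemma partial_pullback:
  assumes h: "(h has_derivative D) (at (u x))" and x: "x \<in> U"
  shows "partial j (\<lambda>y. h (u y)) x = D (axis j 1)"
proof -
  have "((\<lambda>y. h (u y)) \<circ> \<iota> has_derivative D) (at (u x))"
    by (rule has_derivative_transform_within_open[OF h is_chart_D(2)[OF ch]])
       (use x in \<open>auto simp: f_inv_into_f\<close>)
  from fun_cong[OF frechet_derivative_at[OF this], of "axis j 1"] show ?thesis by (simp add: partial_def)
qed

text \<open>With \<open>dF = f\<close>, the form \<open>e\<^sup>F h\<close> is closed. Its primitive \<open>y\<close> becomes a coordinate, and the other
  coordinates are chosen such that the new chart has the volume element \<open>e\<^sup>-\<^sup>F vol\<close>.\<close>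

lemma constant_coefficients_if:
  assumes n: "CARD('n) \<ge> 2" and x0: "x0 \<in> U" and V: "V \<in> multivector_fields A (CARD('n) - 1) UNIV" and nz: "V x0 \<noteq> 0"
    and N: "open N" "x0 \<in> N" "N \<subseteq> U" and f: "\<And>j. smooth_fun A N (f j)" and h: "\<And>j. smooth_fun A N (h j)"
    and hV: "\<And>j x. x \<in> N \<Longrightarrow> h j x = codual (V x) x (frame j x)"
    and feq: "\<And>i j x. x \<in> N \<Longrightarrow> partial i (f j) x = partial j (f i) x"
    and heq: "\<And>i j x. x \<in> N \<Longrightarrow> partial i (h j) x + h j x * f i x = partial j (h i) x + h i x * f j x"
  shows "constant_coefficients_near A (CARD('n) - 1) V x0"
proof -
  have Vm: "V x \<in> multivectors A (CARD('n) - 1) x" for x using V by (simp add: multivector_fields_def)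
  have "open (u ` N)" "u x0 \<in> u ` N" using open_image N by auto
  then obtain r where r: "r > 0" "ball (u x0) r \<subseteq> u ` N" using open_contains_ball by blast
  let ?B = "ball (u x0) r"
  have \<iota>N: "\<iota> q \<in> N" "u (\<iota> q) = q" if "q \<in> ?B" for q
  proof -
    obtain x where "x \<in> N" "q = u x" using \<open>q \<in> ?B\<close> r(2) by blast
    then show "\<iota> q \<in> N" "u (\<iota> q) = q" using N by auto
  qed
  define a where "a j = f j \<circ> \<iota>" for j
  define b where "b j = h j \<circ> \<iota>" for j
  have a: "smooth_on ?B (a j)" and b: "smooth_on ?B (b j)" for j
    using f[of j] h[of j] smooth_fun_iff[OF N(1,3)] smooth_on_subset[OF r(2)] by (auto simp: a_def b_def)
  have pa: "FD (a j) q (axis i 1) = partial i (f j) (\<iota> q)"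
    and pb: "FD (b j) q (axis i 1) = partial i (h j) (\<iota> q)" if "q \<in> ?B" for i j q
    using \<iota>N[OF that] by (simp_all add: a_def b_def partial_def)
  obtain F where F: "smooth_on ?B F" "\<And>q. q \<in> ?B \<Longrightarrow> (F has_derivative (\<lambda>v. \<Sum>i\<in>UNIV. v $ i * a i q)) (at q)"
  proof (rule poincare_one_form[of "u x0" r a, OF a])
    show "FD (a i) q (axis j 1) = FD (a j) q (axis i 1)" if "q \<in> ?B" for q i j
      using pa[OF that] feq \<iota>N[OF that] by simp
  qed (use that in blast)
  define c where "c j = (\<lambda>q. exp (F q) * b j q)" for j
  have c: "smooth_on ?B (c j)" for j
    unfolding c_def by (intro smooth_on_mult smooth_on_exp F b open_ball)
  \<comment> \<open>Up to the factor e^F, this is the expression that \<open>heq\<close> makes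
    symmetric in i and j, so the form with components c_j is closed.\<close>
  have cd: "FD (c j) q (axis i 1) = exp (F q) * (partial i (h j) (\<iota> q) + b j q * a i q)"
    if q: "q \<in> ?B" for i j q
  proof -
    have e: "((\<lambda>q. exp (F q)) has_derivative (\<lambda>v. exp (F q) * (\<Sum>i\<in>UNIV. v $ i * a i q))) (at q)"
      by (rule has_derivative_eq_rhs[OF has_derivative_exp[OF F(2)[OF q]]]) (simp add: fun_eq_iff mult.commute)
    have "(c j has_derivative (\<lambda>v. exp (F q) * FD (b j) q v
        + exp (F q) * (\<Sum>i\<in>UNIV. v $ i * a i q) * b j q)) (at q)"
      unfolding c_def by (rule has_derivative_mult[OF e smooth_on_has_derivative[OF b q]])
    from fun_cong[OF frechet_derivative_at[OF this], of "axis i 1"]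
    have "FD (c j) q (axis i 1) = exp (F q) * FD (b j) q (axis i 1)
        + exp (F q) * (\<Sum>k\<in>UNIV. axis i 1 $ k * a k q) * b j q"
      by simp
    also have "(\<Sum>k\<in>UNIV. axis i 1 $ k * a k q) = (\<Sum>k\<in>UNIV. if i = k then a k q else 0)"
      by (intro sum.cong) (auto simp: axis_def)
    also have "\<dots> = a i q" by simp
    finally show ?thesis by (simp add: pb[OF q] algebra_simps)
  qed
  obtain y where y: "smooth_on ?B y" "\<And>q. q \<in> ?B \<Longrightarrow> (y has_derivative (\<lambda>v. \<Sum>i\<in>UNIV. v $ i * c i q)) (at q)"
  proof (rule poincare_one_form[of "u x0" r c, OF c])
    show "FD (c i) q (axis j 1) = FD (c j) q (axis i 1)" if "q \<in> ?B" for q i j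
      using cd[OF that] heq[OF \<iota>N(1)[OF that], of j i] by (simp add: a_def b_def)
  qed (use that in blast)
  have yax: "(\<Sum>i\<in>UNIV. axis j 1 $ i * c i q) = c j q" for j q
  proof -
    have "(\<Sum>i\<in>UNIV. axis j 1 $ i * c i q) = (\<Sum>i\<in>UNIV. if j = i then c i q else 0)"
      by (intro sum.cong) (auto simp: axis_def)
    then show ?thesis by simp
  qed
  have p0: "u x0 \<in> ?B" using r by simp
  \<comment> \<open>Since V is nonzero at x0, so is its covector. A nonvanishing component k lets y
    replace the k-th coordinate.\<close>
  obtain k where k: "h k x0 \<noteq> 0"
    using codual_component[OF Vm x0 nz] hV[OF N(2)] by metis
  have "FD y (u x0) (axis k 1) = c k (u x0)"
    using fun_cong[OF frechet_derivative_at[OF y(2)[OF p0]], of "axis k 1"] yax by simp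
  then have yk: "FD y (u x0) (axis k 1) \<noteq> 0"
    using k x0 by (simp add: c_def b_def)
  have "smooth_on ?B (\<lambda>q. exp (F q))" by (intro smooth_on_exp F open_ball)
  then obtain T \<phi> g where T: "open T" "u x0 \<in> T" "T \<subseteq> ?B" and s\<phi>: "smooth_on T \<phi>" and oT: "open (\<phi> ` T)"
    and hom: "homeomorphism T (\<phi> ` T) \<phi> g" and sg: "smooth_on (\<phi> ` T) g" and \<phi>0: "\<phi> (u x0) = 0"
    and \<phi>k: "\<And>q. q \<in> T \<Longrightarrow> \<phi> q $ k = y q - y (u x0)"
    and \<phi>d: "\<And>q. q \<in> T \<Longrightarrow> det (matrix (FD \<phi> q)) = exp (F q)"
    using unimodular_coordinates[OF n open_ball p0 y(1) _ _ yk, of "\<lambda>q. exp (F q)"] by (metis exp_not_eq_zero)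
  define W where "W = U \<inter> u -` T"
  define w where "w = \<phi> \<circ> u"
  have "T \<subseteq> u ` U" using T r N by blast
  then have csW: "coordinate_system A (W, w)"
    unfolding W_def w_def by (rule coordinate_system_compose[OF cs T(1) _ oT hom s\<phi> sg])
  interpret c2: chart A W w by unfold_locales (rule csW)
  have WU: "x \<in> U" "x \<in> N" "u x \<in> T" "u x \<in> ?B" if "x \<in> W" for x
  proof -
    show 1: "x \<in> U" "u x \<in> T" "u x \<in> ?B" using that T by (auto simp: W_def)
    show "x \<in> N" using \<iota>N(1)[OF 1(3)] 1(1) by simp
  qed
  \<comment> \<open>Pairing the new coframe with the old frame gives the Jacobian matrix of \<phi>,
    whose determinant was prescribed as e^F.\<close>
  have vol2: "vol x (c2.coframe_list x) = exp (F (u x))" if x: "x \<in> W" for x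
  proof -
    have D: "(\<phi> has_derivative FD \<phi> (u x)) (at (u x))"
      by (rule smooth_on_has_derivative[OF s\<phi> WU(3)[OF x]])
    have "c2.coframe i x (frame j x) = FD \<phi> (u x) (axis j 1) $ i" for i j
    proof -
      have "c2.coframe i x (frame j x) = frame j x (c2.coord i)"
        by (rule differential_apply[OF frame_tangent[OF WU(1)[OF x]]])
      also have "\<dots> = partial j (c2.coord i) x" by (rule frame_smooth[OF c2.smooth_at_coord[OF x]])
      also have "\<dots> = FD \<phi> (u x) (axis j 1) $ i"
        unfolding w_def o_def
        by (rule partial_pullback[OF bounded_linear.has_derivative[OF bounded_linear_vec_nth D] WU(1)[OF x]])
      finally show ?thesis .
    qed
    then have "(\<chi> i j. (c2.coframe_list x ! index_pos i) (frame j x)) = matrix (FD \<phi> (u x))"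
      by (simp add: vec_eq_iff matrix_nth)
    then show ?thesis
      using \<phi>d[OF WU(3)[OF x]] by (auto simp: vol_def differential_cotangent)
  qed
  \<comment> \<open>The product v \<and> V does not depend on the chart. Comparing its two
    expressions multiplies the old covector by e^F, and the resulting dy is the differential of the
    new coordinate k.\<close>
  have codual2: "c2.codual (V x) x (c2.frame i x) = (if i = k then 1 else 0)" if x: "x \<in> W" for x i
  proof -
    note v = c2.frame_tangent[OF x, of i] and xU = WU(1)[OF x]
    let ?v = "c2.frame i x"
    have "c2.codual (V x) x ?v *\<^sub>R c2.vol x = codual (V x) x ?v *\<^sub>R vol x"
      using c2.wedge_codual[OF Vm x v] wedge_codual[OF Vm xU v] by simp
    from fun_cong[OF this, of "c2.coframe_list x"]
    have "c2.codual (V x) x ?v = codual (V x) x ?v * exp (F (u x))"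
      by (simp add: scaleR_fun_apply c2.vol_coframe[OF x] vol2[OF x])
    also have "codual (V x) x ?v = (\<Sum>j\<in>UNIV. ?v (coord j) * h j x)"
      using cotangent_apply[OF codual_cotangent v xU, of "V x"] hV[OF WU(2)[OF x]] by simp
    also have "\<dots> * exp (F (u x)) = (\<Sum>j\<in>UNIV. ?v (coord j) * partial j (\<lambda>z. y (u z)) x)"
    proof -
      have "partial j (\<lambda>z. y (u z)) x = exp (F (u x)) * h j x" for j
      proof -
        have "partial j (\<lambda>z. y (u z)) x = c j (u x)"
          using partial_pullback[OF y(2)[OF WU(4)[OF x]] xU, of j] unfolding yax .
        then show ?thesis using xU by (simp add: c_def b_def)
      qed
      then show ?thesis by (simp add: sum_distrib_left sum_distrib_right mult_ac)
    qed
    also have "\<dots> = ?v (\<lambda>z. y (u z))"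
    proof (rule tangent_coord_apply[OF v xU, symmetric])
      show "smooth_at A x (\<lambda>z. y (u z))"
        by (rule smooth_atI[OF is_chart_open_preimage[OF ch open_ball] _ smooth_fun_pullback[OF open_ball y(1)]])
           (use WU[OF x] in auto)
    qed
    also have "\<dots> = ?v (\<lambda>z. c2.coord k z + y (u x0))"
    proof (rule tangent_cong[OF v c2.openU x])
      fix z assume "z \<in> W"
      then show "y (u z) = c2.coord k z + y (u x0)" using \<phi>k[OF WU(3)] by (simp add: w_def)
    qed
    also have "\<dots> = (if i = k then 1 else 0)"
      using tangent_add[OF v c2.smooth_at_coord[OF x] smooth_at_const] tangent_const[OF v] c2.frame_coord[OF x] by simp
    finally show ?thesis .
  qed
  have "\<exists>d. \<forall>x\<in>W. V x (map (\<lambda>i. c2.coframe i x) ks) = d"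
    if ks: "length ks = CARD('n) - 1" "sorted_wrt (<) ks" for ks :: "'n list"
  proof -
    obtain l where l: "l < CARD('n)" "ks = take l index_list @ drop (Suc l) index_list"
      using that by (rule index_list_remove[OF ks])
    define i where "i = (index_list ! l :: 'n)"
    have il: "index_pos i = l" using l by (simp add: i_def)
    have "V x (map (\<lambda>i. c2.coframe i x) ks) = (- 1) ^ l * (if i = k then 1 else 0)" if x: "x \<in> W" for x
    proof -
      have "(- 1) ^ l * V x (map (\<lambda>i. c2.coframe i x) ks) = (if i = k then 1 else 0)"
        using c2.codual_frame[OF x, of "V x" i] codual2[OF x, of i] by (simp add: il l(2))
      \<comment> \<open>The sign is its own inverse, so the coefficient of V is recovered from the
        component of the covector.\<close>
      then have "(- 1) ^ l * ((- 1) ^ l * V x (map (\<lambda>i. c2.coframe i x) ks)) = (- 1) ^ l * (if i = k then 1 else 0)"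
        by (rule arg_cong)
      then show ?thesis by (simp flip: mult.assoc power_add add: mult_2[symmetric])
    qed
    then show ?thesis by blast
  qed
  moreover have "x0 \<in> W" "w x0 = 0" using x0 T \<phi>0 by (auto simp: W_def w_def)
  ultimately show ?thesis
    unfolding constant_coefficients_near_def using csW by blast
qed

end

text \<open>Both sides concern a neighbourhood of x0, so the conditions are imposed over an open U
  containing x0. The bound n \<ge> 2 matters: for n = 1 the field V is a function and the right-hand
  side holds for every V that is nonzero at x0, whereas constant coefficients would force V to be
  constant near x0.\<close>

theorem proposition1p16:
  fixes A :: "('m::{t2_space, second_countable_topology}, 'n::{finite, linorder}) chart set"
    and V :: "'m \<Rightarrow> 'm mvec"
    and x0 :: 'm
  assumes "smooth_manifold A"
    and "CARD('n) \<ge> 2"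
    and "V \<in> multivector_fields A (CARD('n) - 1) UNIV"
    and "V x0 \<noteq> 0"
  shows "constant_coefficients_near A (CARD('n) - 1) V x0 \<longleftrightarrow>
    (\<exists>U. open U \<and> x0 \<in> U \<and>
      (locally_constant_rank U (pfaffian_system A V) \<and>
       locally_closed_basis A U (pfaffian_system A V)) \<and>
      (\<exists>nabla. derivation_law A U nabla \<and> flat_law A U nabla \<and>
         (\<forall>X\<in>vector_fields A U. \<forall>Y\<in>vector_fields A U.
            ext_cov_deriv A nabla (eta_form A V) X Y = 0)))" (is "?L \<longleftrightarrow> ?R")
proof
  interpret manifold A by unfold_locales fact
  assume ?L
  then obtain U u where cs: "coordinate_system A (U, u)" and x0: "x0 \<in> U"
    and const: "\<And>ks :: 'n list. length ks = CARD('n) - 1 \<Longrightarrow> sorted_wrt (<) ks \<Longrightarrow>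
         (\<exists>c. \<forall>x\<in>U. V x (map (\<lambda>i. differential A (\<lambda>y. u y $ i) x) ks) = c)"
    unfolding constant_coefficients_near_def by blast
  interpret chart A U u by unfold_locales fact
  note * = constant_coefficients_imp[OF assms(3) x0 assms(4) const]
  show ?R
    using openU x0 *(1,2) flat_connection_derivation_law flat_connection_flat *(3) by blast
next
  interpret manifold A by unfold_locales fact
  assume ?R
  then obtain G nabla where G: "open G" "x0 \<in> G" and law: "derivation_law A G nabla" "flat_law A G nabla"
    and tor: "\<And>X Y. X \<in> vector_fields A G \<Longrightarrow> Y \<in> vector_fields A G \<Longrightarrow> ext_cov_deriv A nabla (eta_form A V) X Y = 0"
    by blast
  obtain C v where c: "(C, v) \<in> A" "x0 \<in> C" by (rule atlas_cover)
  let ?S = "v ` (C \<inter> G)"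
  have S: "open ?S" by (rule open_chart_image[OF c(1) G(1)])
  \<comment> \<open>An atlas chart is shrunk to lie in G by composing it with the identity of the
    open set \<open>?S\<close>; the law over G can then be evaluated in it.\<close>
  have "coordinate_system A (C \<inter> v -` ?S, (\<lambda>q. q) \<circ> v)"
    by (rule coordinate_system_compose[OF coordinate_system_atlas[OF c(1)] S, where g="\<lambda>q. q"])
       (use S in \<open>auto intro: homeomorphismI smooth_on_id continuous_intros\<close>)
  then interpret chart A "C \<inter> v -` ?S" "(\<lambda>q. q) \<circ> v" by unfold_locales
  have U: "C \<inter> v -` ?S \<subseteq> G"
  proof
    fix x assume "x \<in> C \<inter> v -` ?S"
    then obtain x' where "x \<in> C" "x' \<in> C" "x' \<in> G" "v x = v x'" by auto
    then show "x \<in> G" using is_chart_inv_into[OF atlas_chart[OF c(1)]] by metis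
  qed
  have x0: "x0 \<in> C \<inter> v -` ?S" using c G by auto
  show ?L
    by (rule flat_torsion_free_equations[OF G(1) U x0 assms(3) law tor], assumption, assumption)
       (rule constant_coefficients_if[OF assms(2) x0 assms(3,4)]; assumption)
qed

end
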